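(* Let $X$ be a domain in $\mathbb{C}^n$, let $K:X\times X\to\mathbb{C}$ be a sesqui-holomorphic non-degenerate positive semi-definite kernel, let $F$ be the RKHS over $X$ with reproducing kernel $K$, and let $\kappa:X\to F^*$ be its evaluation map. Assume that a Hermitean metric $\sigma^K$ on $X$ is the pull-back via $\kappa$ of a unitary-invariant metric on $F^*\setminus\{0\}$. Then there are smooth functions $\varphi,\psi:(0,+\infty)\to\mathbb{R}$ such that for every $x\in X$ and all $u,v\in T_x$ $$\sigma^K_x(u,v)=\varphi\big(\widehat{K}(x)\big)\,(u\otimes\overline{v})\widehat{K}+\psi\big(\widehat{K}(x)\big)\,(u\widehat{K})\,(\overline{v}\widehat{K}).$$
   Context: A domain is an open connected set. A function $K:X\times X\to\mathbb{C}$ is sesqui-holomorphic if it is holomorphic in the first variable and antiholomorphic in the second; its diagonal function is $\widehat{K}(x)=K(x,x)$; $K$ is non-degenerate if $\widehat{K}(x)>0$ for all $x\in X$. It is positive semi-definite if all matrices $(K(x_i,x_j))_{i,j}$ are positive semi-definite. Inner products are linear in the first argument. The RKHS $F$ with kernel $K$ is the unique Hilbert space of functions on $X$ with $K_x=K(\cdot,x)\in F$ and $f(x)=\langle f,K_x\rangle_F$ for all $f\in F$, $x\in X$. For $h\in F$ let $h^*\in F^*$ be the functional $g\mapsto\langle g,h\rangle_F$; $F^*$ is a Hilbert space with $\langle g^*,h^*\rangle_{F^*}=\langle h,g\rangle_F$. The evaluation map is $\kappa:X\to F^*$, $\kappa(x)=K_x^*$ (so $\kappa(x)$ is evaluation at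 $x$ and $K(x,y)=\langle\kappa(x),\kappa(y)\rangle_{F^*}$); it is holomorphic since $K$ is sesqui-holomorphic, and $\kappa(x)\neq0$ for all $x$ since $K$ is non-degenerate. $T_x$ is the complex vector space of (holomorphic) tangent vectors $\sum_{j=1}^n a_j\frac{\partial}{\partial z_j}\big|_x$, $a_j\in\mathbb{C}$. For $u=\sum_{j=1}^n a_j\frac{\partial}{\partial z_j}\big|_x$ and $v=\sum_{j=1}^n b_j\frac{\partial}{\partial z_j}\big|_x$ in $T_x$, put $\overline{v}=\sum_j\overline{b_j}\frac{\partial}{\partial\overline{z_j}}\big|_x$ (Wirtinger derivatives), $u\otimes\overline{v}=\sum_{j,k}a_j\overline{b_k}\frac{\partial^2}{\partial z_j\partial\overline{z_k}}\big|_x$, and $u\kappa=\sum_j a_j\frac{\partial\kappa}{\partial z_j}(x)\in F^*$. Let $G=F^*\setminus\{0\}$. A unitary-invariant metric on $G$ is a smooth function $\sigma:G\times F^*\times F^*\to\mathbb{C}$ such that each $\sigma_g=\sigma(g,\cdot,\cdot)$ is conjugate-symmetric and sesquilinear on $F^*$, and $\sigma_{Tg}(Tf,Th)=\sigma_g(f,h)$ for all unitary operators $T$ on $F^*$, $g\in G$, $f,h\in F^*$ (positive definiteness of $\sigma$ is not needed here: degenerate $\sigma$ are allowed). Its pull-back via $\kappa$ is $\sigma^K_x(u,v)=\sigma_{\kappa(x)}(u\kappa,v\kappa)$, for $x\in X$, $u,v\in T_x$. *)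

theory Defs
  imports "HOL-Analysis.Analysis" "HOL-Library.Function_Algebras" "HOL-Library.Nonpos_Ints"
begin

section \<open>Pointwise vector space structure on functions\<close>

instantiation "fun" :: (type, real_vector) real_vector
begin

definition scaleR_fun :: "real \<Rightarrow> ('a \<Rightarrow> 'b) \<Rightarrow> 'a \<Rightarrow> 'b" where
  "scaleR_fun r f = (\<lambda>x. r *\<^sub>R f x)"

instance
  by standard (auto simp: scaleR_fun_def fun_eq_iff scaleR_add_right scaleR_add_left)

end

definition cscale :: "complex \<Rightarrow> ('a \<Rightarrow> complex) \<Rightarrow> 'a \<Rightarrow> complex" where
  "cscale c f = (\<lambda>x. c * f x)"


section \<open>Smooth maps\<close>

text \<open>
  Hilbert spaces of functions below are subsets of function types and carry norms that depend on
  parameters, so smoothness is defined relative to a real subspace \<open>V\<close> of some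
  \<^class>\<open>real_vector\<close> type and a norm \<open>N\<close> on \<open>V\<close>. The map \<open>D x\<close> restricted to lists of length \<open>k\<close>
  is the \<open>k\<close>-th Frechet derivative at \<open>x\<close>, viewed as a bounded \<open>k\<close>-linear map, and the last clause
  says that the \<open>k\<close>-th derivative is Frechet differentiable on \<open>S\<close> with respect to the operator
  norm of \<open>k\<close>-linear maps, with derivative given by the \<open>(k+1)\<close>-st one. The set \<open>S\<close> is meant to be
  relatively open in \<open>V\<close>.
\<close>

definition bounded_multilinear_on ::
  "('e::real_vector \<Rightarrow> real) \<Rightarrow> 'e set \<Rightarrow> ('e list \<Rightarrow> 'b::real_normed_vector) \<Rightarrow> bool" where
  "bounded_multilinear_on N V M \<longleftrightarrow>
     (\<forall>vs ws. set vs \<subseteq> V \<longrightarrow> set ws \<subseteq> V \<longrightarrow>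
        (\<forall>u\<in>V. \<forall>w\<in>V. M (vs @ (u + w) # ws) = M (vs @ u # ws) + M (vs @ w # ws)) \<and>
        (\<forall>r. \<forall>u\<in>V. M (vs @ (r *\<^sub>R u) # ws) = r *\<^sub>R M (vs @ u # ws))) \<and>
     (\<forall>k. \<exists>C. \<forall>vs. length vs = k \<longrightarrow> set vs \<subseteq> V \<longrightarrow> norm (M vs) \<le> C * prod_list (map N vs))"

definition smooth_wrt ::
  "('e::real_vector \<Rightarrow> real) \<Rightarrow> 'e set \<Rightarrow> 'e set \<Rightarrow> ('e \<Rightarrow> 'b::real_normed_vector) \<Rightarrow> bool" where
  "smooth_wrt N V S f \<longleftrightarrow>
     (\<exists>D :: 'e \<Rightarrow> 'e list \<Rightarrow> 'b.
        (\<forall>x\<in>S. D x [] = f x) \<and>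
        (\<forall>x\<in>S. bounded_multilinear_on N V (D x)) \<and>
        (\<forall>k. \<forall>x\<in>S. \<forall>\<epsilon>>0. \<exists>\<delta>>0. \<forall>y\<in>S. N (y - x) < \<delta> \<longrightarrow>
           (\<forall>vs. length vs = k \<longrightarrow> set vs \<subseteq> V \<longrightarrow>
              norm (D y vs - D x vs - D x ((y - x) # vs)) \<le> \<epsilon> * N (y - x) * prod_list (map N vs))))"

abbreviation smooth_on :: "'e::real_normed_vector set \<Rightarrow> ('e \<Rightarrow> 'b::real_normed_vector) \<Rightarrow> bool" where
  "smooth_on \<equiv> smooth_wrt norm UNIV"

definition norm3 :: "('e \<Rightarrow> real) \<Rightarrow> 'e \<times> 'e \<times> 'e \<Rightarrow> real" where
  "norm3 N = (\<lambda>(x, u, v). sqrt ((N x)\<^sup>2 + (N u)\<^sup>2 + (N v)\<^sup>2))"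


section \<open>Hermitean forms and Hermitean metrics\<close>

definition hermitean_form_on ::
  "(complex \<Rightarrow> 'e \<Rightarrow> 'e) \<Rightarrow> 'e::real_vector set \<Rightarrow> ('e \<Rightarrow> 'e \<Rightarrow> complex) \<Rightarrow> bool" where
  "hermitean_form_on scl V s \<longleftrightarrow>
     (\<forall>u\<in>V. \<forall>v\<in>V. \<forall>w\<in>V. s (u + v) w = s u w + s v w \<and> s w (u + v) = s w u + s w v) \<and>
     (\<forall>c. \<forall>u\<in>V. \<forall>v\<in>V. s (scl c u) v = c * s u v \<and> s u (scl c v) = cnj c * s u v) \<and>
     (\<forall>u\<in>V. \<forall>v\<in>V. s v u = cnj (s u v))"

text \<open>
  A Hermitean metric on the open subset \<open>S\<close> of the complex normed space \<open>V\<close> (with complex scalar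
  multiplication \<open>scl\<close> and norm \<open>N\<close>); it may be degenerate.
\<close>

definition hermitean_metric_on ::
  "(complex \<Rightarrow> 'e \<Rightarrow> 'e) \<Rightarrow> ('e::real_vector \<Rightarrow> real) \<Rightarrow> 'e set \<Rightarrow> 'e set \<Rightarrow>
   ('e \<Rightarrow> 'e \<Rightarrow> 'e \<Rightarrow> complex) \<Rightarrow> bool" where
  "hermitean_metric_on scl N V S \<sigma> \<longleftrightarrow>
     smooth_wrt (norm3 N) (V \<times> V \<times> V) (S \<times> V \<times> V) (\<lambda>(x, u, v). \<sigma> x u v) \<and>
     (\<forall>x\<in>S. hermitean_form_on scl V (\<sigma> x))"


section \<open>Hilbert spaces of functions and their duals\<close>

text \<open>A function on a set \<open>A\<close> is represented by a function that vanishes outside \<open>A\<close>.\<close>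

definition hnorm :: "('a \<Rightarrow> 'a \<Rightarrow> complex) \<Rightarrow> 'a \<Rightarrow> real" where
  "hnorm ip f = sqrt (Re (ip f f))"

definition hilbert_function_space ::
  "'a set \<Rightarrow> ('a \<Rightarrow> complex) set \<Rightarrow> (('a \<Rightarrow> complex) \<Rightarrow> ('a \<Rightarrow> complex) \<Rightarrow> complex) \<Rightarrow> bool" where
  "hilbert_function_space A H ip \<longleftrightarrow>
     (\<forall>f\<in>H. \<forall>x. x \<notin> A \<longrightarrow> f x = 0) \<and>
     0 \<in> H \<and> (\<forall>f\<in>H. \<forall>g\<in>H. f + g \<in> H) \<and> (\<forall>c. \<forall>f\<in>H. cscale c f \<in> H) \<and>
     hermitean_form_on cscale H ip \<and>
     (\<forall>f\<in>H. f \<noteq> 0 \<longrightarrow> 0 < Re (ip f f)) \<and>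
     (\<forall>s :: nat \<Rightarrow> 'a \<Rightarrow> complex. (\<forall>n. s n \<in> H) \<longrightarrow>
        (\<forall>\<epsilon>>0. \<exists>M. \<forall>m\<ge>M. \<forall>n\<ge>M. hnorm ip (s m - s n) < \<epsilon>) \<longrightarrow>
        (\<exists>l\<in>H. (\<lambda>n. hnorm ip (s n - l)) \<longlonglongrightarrow> 0))"

definition dual_space ::
  "('a \<Rightarrow> complex) set \<Rightarrow> (('a \<Rightarrow> complex) \<Rightarrow> ('a \<Rightarrow> complex) \<Rightarrow> complex) \<Rightarrow>
   (('a \<Rightarrow> complex) \<Rightarrow> complex) set" where
  "dual_space H ip =
     {p. (\<forall>f. f \<notin> H \<longrightarrow> p f = 0) \<and>
         (\<forall>f\<in>H. \<forall>g\<in>H. p (f + g) = p f + p g) \<and>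
         (\<forall>c. \<forall>f\<in>H. p (cscale c f) = c * p f) \<and>
         (\<exists>C. \<forall>f\<in>H. norm (p f) \<le> C * hnorm ip f)}"

definition hstar ::
  "('a \<Rightarrow> complex) set \<Rightarrow> (('a \<Rightarrow> complex) \<Rightarrow> ('a \<Rightarrow> complex) \<Rightarrow> complex) \<Rightarrow>
   ('a \<Rightarrow> complex) \<Rightarrow> (('a \<Rightarrow> complex) \<Rightarrow> complex)" where
  "hstar H ip h = (\<lambda>g. if g \<in> H then ip g h else 0)"

definition riesz ::
  "('a \<Rightarrow> complex) set \<Rightarrow> (('a \<Rightarrow> complex) \<Rightarrow> ('a \<Rightarrow> complex) \<Rightarrow> complex) \<Rightarrow>
   (('a \<Rightarrow> complex) \<Rightarrow> complex) \<Rightarrow> 'a \<Rightarrow> complex" where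
  "riesz H ip p = (THE h. h \<in> H \<and> hstar H ip h = p)"

text \<open>This is the inner product with \<open>\<langle>g\<^sup>*, h\<^sup>*\<rangle> = \<langle>h, g\<rangle>\<close>.\<close>

definition dual_ip ::
  "('a \<Rightarrow> complex) set \<Rightarrow> (('a \<Rightarrow> complex) \<Rightarrow> ('a \<Rightarrow> complex) \<Rightarrow> complex) \<Rightarrow>
   (('a \<Rightarrow> complex) \<Rightarrow> complex) \<Rightarrow> (('a \<Rightarrow> complex) \<Rightarrow> complex) \<Rightarrow> complex" where
  "dual_ip H ip p q = ip (riesz H ip q) (riesz H ip p)"

definition unitary_on ::
  "('a \<Rightarrow> complex) set \<Rightarrow> (('a \<Rightarrow> complex) \<Rightarrow> ('a \<Rightarrow> complex) \<Rightarrow> complex) \<Rightarrow>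
   (('a \<Rightarrow> complex) \<Rightarrow> ('a \<Rightarrow> complex)) \<Rightarrow> bool" where
  "unitary_on H ip T \<longleftrightarrow>
     bij_betw T H H \<and>
     (\<forall>f\<in>H. \<forall>g\<in>H. T (f + g) = T f + T g) \<and>
     (\<forall>c. \<forall>f\<in>H. T (cscale c f) = cscale c (T f)) \<and>
     (\<forall>f\<in>H. \<forall>g\<in>H. ip (T f) (T g) = ip f g)"

definition unitary_invariant_metric ::
  "('a \<Rightarrow> complex) set \<Rightarrow> (('a \<Rightarrow> complex) \<Rightarrow> ('a \<Rightarrow> complex) \<Rightarrow> complex) \<Rightarrow>
   (('a \<Rightarrow> complex) \<Rightarrow> ('a \<Rightarrow> complex) \<Rightarrow> ('a \<Rightarrow> complex) \<Rightarrow> complex) \<Rightarrow> bool" where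
  "unitary_invariant_metric H ip \<sigma> \<longleftrightarrow>
     hermitean_metric_on cscale (hnorm ip) H (H - {0}) \<sigma> \<and>
     (\<forall>T. unitary_on H ip T \<longrightarrow>
        (\<forall>g\<in>H - {0}. \<forall>f\<in>H. \<forall>h\<in>H. \<sigma> (T g) (T f) (T h) = \<sigma> g f h))"


section \<open>Kernels and reproducing kernel Hilbert spaces\<close>

definition domain :: "(complex^'n) set \<Rightarrow> bool" where
  "domain X \<longleftrightarrow> open X \<and> connected X"

definition holomorphic_several_on :: "(complex^'n \<Rightarrow> complex) \<Rightarrow> (complex^'n) set \<Rightarrow> bool" where
  "holomorphic_several_on f X \<longleftrightarrow>
     (\<forall>x\<in>X. \<exists>D. (f has_derivative D) (at x) \<and> (\<forall>c v. D (c *s v) = c * D v))"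

definition sesqui_holomorphic_on ::
  "(complex^'n \<Rightarrow> complex^'n \<Rightarrow> complex) \<Rightarrow> (complex^'n) set \<Rightarrow> bool" where
  "sesqui_holomorphic_on K X \<longleftrightarrow>
     (\<forall>y\<in>X. holomorphic_several_on (\<lambda>x. K x y) X) \<and>
     (\<forall>x\<in>X. holomorphic_several_on (\<lambda>y. cnj (K x y)) X)"

definition diag :: "('a \<Rightarrow> 'a \<Rightarrow> complex) \<Rightarrow> 'a \<Rightarrow> complex" where
  "diag K x = K x x"

definition nondegenerate_on :: "('a \<Rightarrow> 'a \<Rightarrow> complex) \<Rightarrow> 'a set \<Rightarrow> bool" where
  "nondegenerate_on K X \<longleftrightarrow> (\<forall>x\<in>X. diag K x \<in> \<real> \<and> 0 < Re (diag K x))"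

definition psd_kernel_on :: "('a \<Rightarrow> 'a \<Rightarrow> complex) \<Rightarrow> 'a set \<Rightarrow> bool" where
  "psd_kernel_on K X \<longleftrightarrow>
     (\<forall>(m::nat) (x :: nat \<Rightarrow> 'a) (c :: nat \<Rightarrow> complex). (\<forall>i<m. x i \<in> X) \<longrightarrow>
        (\<Sum>i<m. \<Sum>j<m. cnj (c i) * K (x i) (x j) * c j) \<in> \<real>\<^sub>\<ge>\<^sub>0)"

definition kernel_section :: "'a set \<Rightarrow> ('a \<Rightarrow> 'a \<Rightarrow> complex) \<Rightarrow> 'a \<Rightarrow> 'a \<Rightarrow> complex" where
  "kernel_section X K x = (\<lambda>y. if y \<in> X then K y x else 0)"

definition is_rkhs ::
  "'a set \<Rightarrow> ('a \<Rightarrow> 'a \<Rightarrow> complex) \<Rightarrow>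
   ('a \<Rightarrow> complex) set \<Rightarrow> (('a \<Rightarrow> complex) \<Rightarrow> ('a \<Rightarrow> complex) \<Rightarrow> complex) \<Rightarrow> bool" where
  "is_rkhs X K F ip \<longleftrightarrow>
     hilbert_function_space X F ip \<and>
     (\<forall>x\<in>X. kernel_section X K x \<in> F) \<and>
     (\<forall>f\<in>F. \<forall>x\<in>X. f x = ip f (kernel_section X K x))"

definition evaluation_map ::
  "'a set \<Rightarrow> ('a \<Rightarrow> 'a \<Rightarrow> complex) \<Rightarrow>
   ('a \<Rightarrow> complex) set \<Rightarrow> (('a \<Rightarrow> complex) \<Rightarrow> ('a \<Rightarrow> complex) \<Rightarrow> complex) \<Rightarrow>
   'a \<Rightarrow> (('a \<Rightarrow> complex) \<Rightarrow> complex)" where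
  "evaluation_map X K F ip x = hstar F ip (kernel_section X K x)"


section \<open>Wirtinger derivatives and the action of tangent vectors\<close>

text \<open>
  With \<open>z\<^sub>j = s\<^sub>j + \<i> t\<^sub>j\<close>, the derivatives in the directions \<open>axis j 1\<close> and \<open>axis j \<i>\<close> are those
  with respect to \<open>s\<^sub>j\<close> and \<open>t\<^sub>j\<close>. The tangent vector \<open>\<Sum>j. a\<^sub>j \<partial>/\<partial>z\<^sub>j\<close> at a point of \<open>X\<close> is
  represented by its coefficient vector \<open>a\<close>.
\<close>

definition line_deriv :: "(complex^'n \<Rightarrow> complex) \<Rightarrow> complex^'n \<Rightarrow> complex^'n \<Rightarrow> complex" where
  "line_deriv f x v = vector_derivative (\<lambda>t::real. f (x + t *\<^sub>R v)) (at 0)"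

definition dz :: "'n \<Rightarrow> (complex^'n \<Rightarrow> complex) \<Rightarrow> complex^'n \<Rightarrow> complex" where
  "dz j f x = (line_deriv f x (axis j 1) - \<i> * line_deriv f x (axis j \<i>)) / 2"

definition dzbar :: "'n \<Rightarrow> (complex^'n \<Rightarrow> complex) \<Rightarrow> complex^'n \<Rightarrow> complex" where
  "dzbar j f x = (line_deriv f x (axis j 1) + \<i> * line_deriv f x (axis j \<i>)) / 2"

definition tangent_act :: "complex^'n \<Rightarrow> (complex^'n \<Rightarrow> complex) \<Rightarrow> complex^'n \<Rightarrow> complex" where
  "tangent_act u f x = (\<Sum>j\<in>UNIV. u $ j * dz j f x)"

definition conj_tangent_act :: "complex^'n \<Rightarrow> (complex^'n \<Rightarrow> complex) \<Rightarrow> complex^'n \<Rightarrow> complex" where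
  "conj_tangent_act v f x = (\<Sum>j\<in>UNIV. cnj (v $ j) * dzbar j f x)"

definition mixed_act ::
  "complex^'n \<Rightarrow> complex^'n \<Rightarrow> (complex^'n \<Rightarrow> complex) \<Rightarrow> complex^'n \<Rightarrow> complex" where
  "mixed_act u v f x = (\<Sum>j\<in>UNIV. \<Sum>k\<in>UNIV. u $ j * cnj (v $ k) * dz j (dzbar k f) x)"

text \<open>The same for maps into a Hilbert space \<open>H\<close> of functions, with limits taken in its norm.\<close>

definition line_deriv_in ::
  "('a \<Rightarrow> complex) set \<Rightarrow> (('a \<Rightarrow> complex) \<Rightarrow> ('a \<Rightarrow> complex) \<Rightarrow> complex) \<Rightarrow>
   (complex^'n \<Rightarrow> 'a \<Rightarrow> complex) \<Rightarrow> complex^'n \<Rightarrow> complex^'n \<Rightarrow> 'a \<Rightarrow> complex" where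
  "line_deriv_in H ip f x v =
     (THE d. d \<in> H \<and>
        ((\<lambda>t::real. hnorm ip ((f (x + t *\<^sub>R v) - f x) /\<^sub>R t - d)) \<longlongrightarrow> 0) (at 0))"

definition dz_in ::
  "('a \<Rightarrow> complex) set \<Rightarrow> (('a \<Rightarrow> complex) \<Rightarrow> ('a \<Rightarrow> complex) \<Rightarrow> complex) \<Rightarrow>
   'n \<Rightarrow> (complex^'n \<Rightarrow> 'a \<Rightarrow> complex) \<Rightarrow> complex^'n \<Rightarrow> 'a \<Rightarrow> complex" where
  "dz_in H ip j f x =
     cscale (1/2) (line_deriv_in H ip f x (axis j 1) - cscale \<i> (line_deriv_in H ip f x (axis j \<i>)))"

definition tangent_act_in ::
  "('a \<Rightarrow> complex) set \<Rightarrow> (('a \<Rightarrow> complex) \<Rightarrow> ('a \<Rightarrow> complex) \<Rightarrow> complex) \<Rightarrow>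
   complex^'n \<Rightarrow> (complex^'n \<Rightarrow> 'a \<Rightarrow> complex) \<Rightarrow> complex^'n \<Rightarrow> 'a \<Rightarrow> complex" where
  "tangent_act_in H ip u f x = (\<Sum>j\<in>UNIV. cscale (u $ j) (dz_in H ip j f x))"

definition pull_back ::
  "('a \<Rightarrow> complex) set \<Rightarrow> (('a \<Rightarrow> complex) \<Rightarrow> ('a \<Rightarrow> complex) \<Rightarrow> complex) \<Rightarrow>
   (complex^'n \<Rightarrow> 'a \<Rightarrow> complex) \<Rightarrow>
   (('a \<Rightarrow> complex) \<Rightarrow> ('a \<Rightarrow> complex) \<Rightarrow> ('a \<Rightarrow> complex) \<Rightarrow> complex) \<Rightarrow>
   complex^'n \<Rightarrow> complex^'n \<Rightarrow> complex^'n \<Rightarrow> complex" where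
  "pull_back H ip f \<sigma> x u v = \<sigma> (f x) (tangent_act_in H ip u f x) (tangent_act_in H ip v f x)"

end

theory Submission
  imports Defs "HOL-Complex_Analysis.Complex_Analysis"
begin

text \<open>
  A unitary-invariant Hermitean form at \<open>g\<close> is invariant under the stabilizer of \<open>g\<close>, so it is
  \<open>\<phi> \<langle>f, h\<rangle> + \<psi> \<langle>f, g\<rangle> \<langle>g, h\<rangle>\<close>, where \<open>\<phi>\<close> and \<open>\<psi>\<close> depend only on the norm of \<open>g\<close>. Restricting
  the metric to a ray \<open>\<surd>t e\<close> shows that they are smooth functions of \<open>t = \<parallel>g\<parallel>\<^sup>2\<close>. For \<open>g = \<kappa>(x)\<close> it remains
  to identify \<open>\<langle>u\<kappa>, v\<kappa>\<rangle>\<close>, \<open>\<langle>u\<kappa>, \<kappa>\<rangle>\<close> and \<open>\<langle>\<kappa>, v\<kappa>\<rangle>\<close> with derivatives of the diagonal of \<open>K\<close>, which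
  needs the norm derivatives of \<open>\<kappa>\<close> to exist.

  The kernel is only assumed to be separately holomorphic, so already the local boundedness of \<open>\<kappa>\<close>
  is a theorem of Hartogs type. By Baire's theorem the functions are bounded on a product with one
  small factor; the Taylor coefficients in that variable are then bounded uniformly with a bad
  exponential rate and pointwise with a good rate, and a two-constants estimate on circles (the set
  where the pointwise estimate has a large constant has small measure) makes the good rate uniform.
  This is applied first to \<open>K\<close> on complex lines and then, on complex planes, to the unit ball of
  the space of holomorphic members of the RKHS.
\<close>

section \<open>Functions peaking on arcs\<close>

text \<open>Members of F are not known to be holomorphic at the outset, so norms are estimated by
  testing against \<open>FH\<close>, the holomorphic members. This suffices because the vectors
  tested are combinations of kernel functions, which lie in \<open>FH\<close>, and a vector of
  \<open>FH\<close> detects its own norm. Complex planes can take the place of a Hartogs theorem in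
  n variables, since every Wirtinger derivative in the formula involves at most two directions. On a
  plane, values of K would bring in four complex variables; evaluating members of a unit ball keeps
  it at two, with the result on lines as the input on slices. A second norm derivative of the kernel
  is avoided as well: when the dzbar-derivative of the diagonal is differentiated again, one factor
  is only Lipschitz in norm and weakly differentiable. The weak derivative is conjugate-linear in
  the direction, so d/dz removes it. On the algebraic side, reflections and unimodular scalars
  provide all the unitary operators required, in any dimension.\<close>

text \<open>Cells of a grid finer than the distance from K to the complement of U are disjoint and
  stay in U as soon as they meet K, so their total length is at most the measure of U. In the
  application K varies with the function considered, while U is one fixed set of small
  measure.\<close>

lemma compact_covered_by_grid:
  fixes K U :: "real set"
  assumes K: "compact K" "K \<subseteq> U" "K \<subseteq> {0..a}" and U: "open U"
  obtains C :: "real set" and l :: real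
  where "finite C" "0 < l" "l \<le> 1" "\<And>t. t \<in> K \<Longrightarrow> \<exists>c\<in>C. \<bar>t - c\<bar> \<le> l"
    "2 * l * card C \<le> measure lborel (U \<inter> {-1..a+1})"
proof -
  obtain e where e: "e > 0" "\<And>x y. x \<in> K \<Longrightarrow> \<bar>y - x\<bar> < e \<Longrightarrow> y \<in> U"
  proof -
    have "\<exists>e>0. (\<Union>x\<in>K. ball x e) \<subseteq> U"
      using compact_subset_open_imp_ball_epsilon_subset[OF K(1) U K(2)] by metis
    then show ?thesis using that by (force simp: dist_real_def)
  qed
  \<comment> \<open>\<open>2 * l < e\<close> keeps a cell that meets K inside U;
    \<open>2 * l \<le> 1\<close> keeps it inside the bounded window, whose measure is
    finite.\<close>
  define l where "l = min (e/2) 1 / 2"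
  have l: "0 < l" "l \<le> 1" "2 * l < e" "2 * l \<le> 1"
    using e by (auto simp: l_def)
  define I where "I j = {2 * l * of_int j ..< 2 * l * (of_int j + 1)}" for j :: int
  define J where "J = {j. I j \<inter> K \<noteq> {}}"
  define c where "c j = 2 * l * of_int j + l" for j :: int
  have subJ: "J \<subseteq> {-1..\<lceil>a / (2*l)\<rceil>}"
  proof
    fix j assume "j \<in> J"
    then obtain t where t: "t \<in> I j" "t \<in> K" by (auto simp: J_def)
    then have *: "0 \<le> t" "t \<le> a" using K(3) by auto
    have 1: "of_int j \<le> t / (2*l)" using t l by (simp add: I_def field_simps)
    have 2: "t / (2 * l) < of_int j + 1" using t l by (simp add: I_def field_simps)
    have "t / (2*l) \<le> a / (2*l)" using * l by (simp add: divide_right_mono)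
    with 1 have "of_int j \<le> a / (2*l)" by linarith
    then have "j \<le> \<lceil>a / (2*l)\<rceil>" by linarith
    moreover have "0 \<le> t / (2*l)" using * l by simp
    with 2 have "of_int j > (-1::real)" by linarith
    then have "j \<ge> -1" by linarith
    ultimately show "j \<in> {-1..\<lceil>a / (2*l)\<rceil>}" by simp
  qed
  then have finJ: "finite J" using finite_subset by blast
  have injc: "inj_on c J" using l by (auto simp: inj_on_def c_def)
  have dis: "disjoint_family_on I J"
    unfolding disjoint_family_on_def
  proof (intro ballI impI)
    fix i j :: int assume "i \<noteq> j"
    have False if "t \<in> I i" "t \<in> I j" for t
    proof -
      have "2 * l * of_int i < 2 * l * (of_int j + 1)" "2 * l * of_int j < 2 * l * (of_int i + 1)"
        using that by (auto simp: I_def)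
      then have "2 * l * (of_int j + 1 - of_int i) > 0" "2 * l * (of_int i + 1 - of_int j) > 0"
        by (simp_all add: algebra_simps)
      then have "(of_int i :: real) < of_int j + 1" "(of_int j :: real) < of_int i + 1"
        using l by (simp_all add: zero_less_mult_iff)
      with \<open>i \<noteq> j\<close> show False by linarith
    qed
    then show "I i \<inter> I j = {}" by auto
  qed
  have measI: "measure lborel (I j) = 2 * l" for j
    using l by (simp add: I_def algebra_simps)
  have emI: "emeasure lborel (I j) = ennreal (2 * l)" for j
  proof -
    have "2 * l * of_int j \<le> 2 * l * (of_int j + 1)" using l by (intro mult_left_mono) auto
    then show ?thesis unfolding I_def by (subst emeasure_lborel_Ico) (auto simp: algebra_simps)
  qed
  have "measure lborel (\<Union>j\<in>J. I j) = (\<Sum>j\<in>J. measure lborel (I j))"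
    by (intro measure_finite_Union finJ dis) (simp_all add: image_subset_iff emI, simp add: I_def)
  also have "\<dots> = 2 * l * card (c ` J)"
    by (simp add: measI card_image injc)
  finally have eq: "2 * l * card (c ` J) = measure lborel (\<Union>j\<in>J. I j)" by simp
  have sub: "(\<Union>j\<in>J. I j) \<subseteq> U \<inter> {-1..a+1}"
  proof clarify
    fix j s assume "j \<in> J" and s: "s \<in> I j"
    then obtain t where t: "t \<in> I j" "t \<in> K" by (auto simp: J_def)
    have "\<bar>s - t\<bar> < 2 * l" using s t by (auto simp: I_def algebra_simps abs_if)
    moreover have "0 \<le> t" "t \<le> a" using t K by auto
    ultimately show "s \<in> U \<inter> {-1..a+1}"
      using e(2)[OF t(2), of s] l by (auto simp: abs_if split: if_splits)
  qed
  have "measure lborel (\<Union>j\<in>J. I j) \<le> measure lborel (U \<inter> {-1..a+1})"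
  proof (rule measure_mono_fmeasurable[OF sub])
    show "\<Union> (I ` J) \<in> sets lborel" by (intro sets.finite_UN finJ) (simp add: I_def)
    have "emeasure lborel (U \<inter> {-1..a+1}) \<le> emeasure lborel {-1..a+1}"
      by (intro emeasure_mono) auto
    also have "\<dots> < \<infinity>" by (simp add: emeasure_lborel_Icc_eq)
    finally show "U \<inter> {-1..a+1} \<in> fmeasurable lborel"
      using U by (intro fmeasurableI) auto
  qed
  with eq have *: "2 * l * card (c ` J) \<le> measure lborel (U \<inter> {-1..a+1})" by simp
  have "\<exists>c'\<in>c ` J. \<bar>t - c'\<bar> \<le> l" if "t \<in> K" for t
  proof -
    define j where "j = \<lfloor>t / (2*l)\<rfloor>"
    have "of_int j \<le> t / (2*l)" "t / (2*l) < of_int j + 1" by (auto simp: j_def)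
    then have "2 * l * of_int j \<le> t" "t < 2 * l * (of_int j + 1)"
      using l by (simp_all add: field_simps)
    then have "t \<in> I j" "\<bar>t - c j\<bar> \<le> l" by (auto simp: I_def c_def algebra_simps abs_if)
    with that show ?thesis by (auto simp: J_def)
  qed
  with * finJ l show ?thesis by (intro that[of "c ` J" l]) auto
qed

text \<open>An elementary substitute for the harmonic measure of an arc.\<close>

lemma arc_peak_function:
  fixes c l :: real
  assumes l: "0 < l" "l \<le> 1"
  defines "p \<equiv> \<lambda>z::complex. 4 * of_real l / (of_real (1 + l) - z * cis (-c))"
  shows "p holomorphic_on cball 0 1"
    and "norm z \<le> 1 \<Longrightarrow> 0 \<le> Re (p z)"
    and "\<bar>t - c\<bar> \<le> l \<Longrightarrow> 1 \<le> Re (p (cis t))"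
    and "norm z \<le> 1/2 \<Longrightarrow> Re (p z) \<le> 8 * l"
proof -
  \<comment> \<open>On the closed unit disc the denominator has real part at least l > 0; this gives
    both the holomorphy of p and the sign of its real part.\<close>
  have Re_ge: "Re (of_real (1 + l) - z * cis (-c)) \<ge> 1 + l - norm z" for z
    using complex_Re_le_cmod[of "z * cis (-c)"] by (simp add: norm_mult)
  have Re_p: "Re (p z) = 4 * l * Re (of_real (1 + l) - z * cis (-c)) / (norm (of_real (1 + l) - z * cis (-c)))\<^sup>2" for z
    unfolding p_def Re_divide cmod_power2 by (simp add: algebra_simps)
  have nz: "of_real (1 + l) - z * cis (-c) \<noteq> 0" if "norm z \<le> 1" for z
  proof
    assume eq: "of_real (1 + l) - z * cis (-c) = 0"
    have "Re (of_real (1 + l) - z * cis (-c)) = 0" unfolding eq by simp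
    then show False using Re_ge[of z] that l by linarith
  qed
  show "p holomorphic_on cball 0 1"
    unfolding p_def using nz by (intro holomorphic_intros) auto
  show "norm z \<le> 1 \<Longrightarrow> 0 \<le> Re (p z)" for z
    unfolding Re_p using Re_ge[of z] l by (intro divide_nonneg_nonneg mult_nonneg_nonneg) auto
  show "norm z \<le> 1/2 \<Longrightarrow> Re (p z) \<le> 8 * l" for z
  proof -
    assume z: "norm z \<le> 1/2"
    have "1/2 \<le> norm (of_real (1 + l) - z * cis (-c))"
      using Re_ge[of z] complex_Re_le_cmod[of "of_real (1 + l) - z * cis (-c)"] z l by linarith
    then have "norm (p z) \<le> 4 * l / (1/2)"
      unfolding p_def norm_divide using l
      by (intro frac_le) (auto simp: norm_mult)
    then show ?thesis using complex_Re_le_cmod[of "p z"] by simp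
  qed
  show "1 \<le> Re (p (cis t))" if t: "\<bar>t - c\<bar> \<le> l"
  proof -
    define s where "s = t - c"
    have eq: "of_real (1 + l) - cis t * cis (-c) = Complex (1 + l - cos s) (- sin s)"
      by (simp add: cis_mult complex_eq_iff s_def)
    have "\<bar>sin s\<bar> \<le> \<bar>s\<bar>" by (rule abs_sin_x_le_abs_x) 
    then have sin: "(sin s)\<^sup>2 \<le> l\<^sup>2" using t by (intro abs_le_square_iff[THEN iffD1]) (auto simp: s_def)
    have "cos s \<ge> 1 - s\<^sup>2 / 2"
    proof -
      have "\<bar>sin (s/2)\<bar> \<le> \<bar>s/2\<bar>" by (rule abs_sin_x_le_abs_x)
      then have "(sin (s/2))\<^sup>2 \<le> (s/2)\<^sup>2" by (simp only: abs_le_square_iff)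
      then show ?thesis using cos_double_sin[of "s/2"] by (simp add: power2_eq_square)
    qed
    moreover have s2: "s\<^sup>2 \<le> l\<^sup>2" using t by (intro abs_le_square_iff[THEN iffD1]) (auto simp: s_def)
    ultimately have u: "1 - cos s \<le> l\<^sup>2 / 2" by linarith
    \<comment> \<open>a is the real part of the denominator, and Re p \<ge> 1 at this point amounts
      to \<open>a\<^sup>2 + (sin s)\<^sup>2 \<le> 4 * l * a\<close>. Since l \<le> a \<le> 3/2 l and
      |sin s| \<le> l, the left side is at most 5/2 l a, which the factor 4 in p covers.\<close>
    define a where "a = 1 + l - cos s"
    have a: "l \<le> a" by (simp add: a_def)
    have l2: "l\<^sup>2 \<le> l" using l by (simp add: power2_eq_square mult_left_le)
    then have a2: "a \<le> 3/2 * l" using u by (simp add: a_def)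
    have "a\<^sup>2 + (sin s)\<^sup>2 \<le> 4 * l * a"
    proof -
      have "a * a \<le> 3/2 * l * a" using a2 a l by (intro mult_right_mono) auto
      moreover have "l * l \<le> l * a" using a l by (intro mult_left_mono) auto
      moreover have "0 \<le> l * a" using a l by auto
      ultimately show ?thesis using sin unfolding power2_eq_square by linarith
    qed
    moreover have "0 < a\<^sup>2 + (sin s)\<^sup>2" using a l by (intro add_pos_nonneg) auto
    ultimately show ?thesis
      unfolding Re_p eq by (simp add: cmod_power2 a_def)
  qed
qed

text \<open>Let q be the sum of the peak functions of the arcs. Multiplying f by exp(-L q) lowers B
  to A on the arcs, where Re q \<ge> 1, and increases nothing elsewhere, since Re q \<ge> 0. The
  maximum principle then leaves the factor exp(L Re q) at w, where Re q \<le> 8 l card C.\<close>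

lemma two_constants_arcs:
  fixes f :: "complex \<Rightarrow> complex"
  assumes f: "f holomorphic_on ball 0 2"
    and C: "finite C" "0 < l" "l \<le> 1"
    and A: "0 < A" "A \<le> B"
    and fB: "\<And>z. norm z = 1 \<Longrightarrow> norm (f z) \<le> B"
    and fA: "\<And>t. t \<in> {0..2*pi} \<Longrightarrow> norm (f (cis t)) \<le> A \<or> (\<exists>c\<in>C. \<bar>t - c\<bar> \<le> l)"
    and w: "norm w \<le> 1/2"
  shows "norm (f w) \<le> A * exp (ln (B/A) * (8 * l * card C))"
proof -
  define p where "p c z = 4 * of_real l / (of_real (1 + l) - z * cis (-c))" for c and z :: complex
  note p = arc_peak_function[OF C(2,3), folded p_def]
  define L where "L = ln (B / A)"
  have L: "0 \<le> L" "exp L = B / A" using A by (auto simp: L_def)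
  define q where "q z = (\<Sum>c\<in>C. p c z)" for z
  define g where "g z = f z * exp (- of_real L * q z)" for z
  have norm_g: "norm (g z) = norm (f z) * exp (- L * Re (q z))" for z
    by (simp add: g_def norm_mult)
  have q0: "0 \<le> Re (q z)" if "norm z \<le> 1" for z
    unfolding q_def Re_sum using p(2) that by (intro sum_nonneg) auto
  have holg: "g holomorphic_on cball 0 1"
  proof -
    have "f holomorphic_on cball 0 1" using f by (rule holomorphic_on_subset) auto
    then show ?thesis unfolding g_def q_def by (intro holomorphic_intros p)
  qed
  have "norm (g w) \<le> A"
  proof (rule maximum_modulus_frontier[where S = "cball 0 1" and f = g and \<xi> = w])
    show "g holomorphic_on interior (cball 0 1)" "continuous_on (closure (cball 0 1)) g"
      using holg by (auto intro: holomorphic_on_subset holomorphic_on_imp_continuous_on)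
    show "w \<in> cball 0 1" using w by auto
    fix z :: complex assume "z \<in> frontier (cball 0 1)"
    then have z: "norm z = 1" by simp
    then obtain t where t: "0 \<le> t" "t < 2*pi" "z = cis t"
      using complex_unimodular_polar[of z] by (metis cis.ctr complex_eq_iff cis.sel)
    show "norm (g z) \<le> A"
    proof (cases "norm (f z) \<le> A")
      case True
      have "exp (- L * Re (q z)) \<le> 1" using q0[of z] z L by simp
      then have "norm (f z) * exp (- L * Re (q z)) \<le> A * 1"
        using A True by (intro mult_mono) auto
      then show ?thesis by (simp add: norm_g)
    next
      case False
      with fA[of t] t obtain c where c: "c \<in> C" "\<bar>t - c\<bar> \<le> l" by auto
      have "1 \<le> Re (p c z)" using p(3)[OF c(2)] t by simp
      also have "\<dots> \<le> Re (q z)"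
        unfolding q_def Re_sum using C(1) c(1) p(2) z by (intro member_le_sum) auto
      finally have "L \<le> L * Re (q z)" using L by (simp add: mult_le_cancel_left1)
      then have "exp (- L * Re (q z)) \<le> exp (- L)" by simp
      then have "norm (f z) * exp (- L * Re (q z)) \<le> B * exp (- L)"
        using fB[OF z] A by (intro mult_mono) auto
      also have "\<dots> = A" using A L(2) by (simp add: exp_minus)
      finally show ?thesis by (simp add: norm_g)
    qed
  qed auto
  then have "norm (f w) \<le> A * exp (L * Re (q w))"
    unfolding norm_g using A by (simp add: exp_minus field_simps)
  also have "Re (q w) \<le> 8 * l * card C"
    unfolding q_def Re_sum using sum_mono[of C "\<lambda>c. Re (p c w)" "\<lambda>_. 8 * l"] p(4)[OF w] by (simp add: mult_ac)
  then have "A * exp (L * Re (q w)) \<le> A * exp (L * (8 * l * card C))"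
    using A L by (simp add: mult_left_mono)
  finally show ?thesis by (simp add: L_def)
qed

section \<open>Holomorphic functions depending on a parameter\<close>

lemma holomorphic_bounded_estimates:
  fixes F :: "complex \<Rightarrow> complex"
  assumes F: "F holomorphic_on ball a r" "0 < r" and C: "\<And>z. z \<in> ball a r \<Longrightarrow> norm (F z) \<le> C"
  shows holomorphic_bounded_deriv: "\<And>z. z \<in> ball a (r/2) \<Longrightarrow> norm (deriv F z) \<le> 2 * C / r"
    and holomorphic_bounded_Lipschitz:
      "\<And>x y. x \<in> ball a (r/2) \<Longrightarrow> y \<in> ball a (r/2) \<Longrightarrow> norm (F x - F y) \<le> 2 * C / r * norm (x - y)"
proof -
  show 1: "norm (deriv F z) \<le> 2 * C / r" if z: "z \<in> ball a (r/2)" for z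
  proof -
    have sub: "cball z (r/2) \<subseteq> ball a r"
    proof
      fix x assume "x \<in> cball z (r/2)"
      then show "x \<in> ball a r" using z dist_triangle[of a x z] by auto
    qed
    have "norm ((deriv ^^ 1) F z) \<le> fact 1 * C / (r/2)^1"
    proof (rule Cauchy_inequality)
      show "F holomorphic_on ball z (r/2)" "continuous_on (cball z (r/2)) F"
        using F(1) sub ball_subset_cball[of z "r/2"]
        by (meson holomorphic_on_subset holomorphic_on_imp_continuous_on order_trans)+
      show "norm (F x) \<le> C" if "norm (z - x) = r/2" for x
        using that sub by (intro C) (auto simp: dist_norm)
    qed (use F in auto)
    then show ?thesis by (simp add: mult.commute)
  qed
  show "norm (F x - F y) \<le> 2 * C / r * norm (x - y)" if xy: "x \<in> ball a (r/2)" "y \<in> ball a (r/2)" for x y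
  proof (rule field_differentiable_bound[OF convex_ball _ _ xy])
    fix z assume z: "z \<in> ball a (r/2)"
    then have "z \<in> ball a r" using F(2) by auto
    then show "(F has_field_derivative deriv F z) (at z within ball a (r/2))"
      using F(1) by (intro DERIV_subset[OF holomorphic_derivI]) auto
  qed (rule 1)
qed

text \<open>The constant comes from two Cauchy estimates, each halving the radius: F' is at most
  2C/r on the half disc and F'' at most 2(2C/r)/(r/2) on the quarter disc. It depends on F through C
  alone, which makes difference quotients converge uniformly over families.\<close>

lemma holomorphic_bounded_Taylor:
  fixes F :: "complex \<Rightarrow> complex"
  assumes F: "F holomorphic_on ball a r" "0 < r" and C: "\<And>z. z \<in> ball a r \<Longrightarrow> norm (F z) \<le> C"
    and h: "norm h < r/4"
  shows "norm (F (a + h) - F a - h * deriv F a) \<le> 8 * C / r\<^sup>2 * norm h ^ 2"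
proof -
  define D where "D i = (deriv ^^ i) F" for i :: nat
  have hol: "D i holomorphic_on ball a r" for i
    unfolding D_def using F by (intro holomorphic_higher_deriv) auto
  have der: "(D i has_field_derivative D (Suc i) z) (at z within ball a (r/4))" if "z \<in> ball a (r/4)" for i z
    using hol[of i] that F(2) unfolding D_def by (auto intro!: DERIV_subset[OF holomorphic_derivI])
  have "norm (D 0 (a + h) - (\<Sum>i\<le>1. D i a * (a + h - a) ^ i / fact i)) \<le> 8 * C / r\<^sup>2 * norm (a + h - a) ^ (Suc 1) / fact 1"
  proof (rule complex_Taylor[where S = "ball a (r/4)" and f = D])
    show "(D i has_field_derivative D (Suc i) z) (at z within ball a (r/4))" if "z \<in> ball a (r/4)" for i z
      using der that by blast
    fix z assume z: "z \<in> ball a (r/4)"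
    have "norm (deriv (deriv F) z) \<le> 2 * (2 * C / r) / (r / 2)"
    proof (rule holomorphic_bounded_deriv)
      show "deriv F holomorphic_on ball a (r/2)"
        using F by (intro holomorphic_deriv holomorphic_on_subset[OF F(1)]) auto
      show "norm (deriv F z) \<le> 2 * C / r" if "z \<in> ball a (r/2)" for z
        using holomorphic_bounded_deriv[OF F C] that by blast
    qed (use F z in auto)
    then show "norm (D (Suc 1) z) \<le> 8 * C / r\<^sup>2"
      by (simp add: D_def power2_eq_square)
  qed (use h F in \<open>auto simp: dist_norm\<close>)
  then show ?thesis by (simp add: D_def algebra_simps power2_eq_square)
qed

text \<open>The difference quotients in z are holomorphic in w, and by the Taylor estimate they
  converge uniformly in w, so the limit is holomorphic too.\<close>

lemma holomorphic_deriv_parameter: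
  fixes g :: "complex \<Rightarrow> complex \<Rightarrow> complex"
  assumes T: "open T"
    and hz: "\<And>w. w \<in> T \<Longrightarrow> (\<lambda>z. g z w) holomorphic_on ball a r" and r: "0 < r"
    and hw: "\<And>z. z \<in> ball a r \<Longrightarrow> g z holomorphic_on T"
    and C: "\<And>z w. z \<in> ball a r \<Longrightarrow> w \<in> T \<Longrightarrow> norm (g z w) \<le> C"
  shows "(\<lambda>w. deriv (\<lambda>z. g z w) a) holomorphic_on T"
proof -
  define h where "h n = r / 8 / Suc n" for n :: nat
  have h: "0 < h n" "h n < r / 4" for n
  proof -
    show "0 < h n" using r by (simp add: h_def)
    have "r / 8 / Suc n \<le> r / 8 / 1" using r by (intro divide_left_mono) auto
    then have "h n \<le> r / 8" by (simp only: h_def div_by_1)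
    then show "h n < r / 4" using r by linarith
  qed
  have h0: "h \<longlonglongrightarrow> 0"
    unfolding h_def divide_inverse[of _ "real (Suc _)"] by (rule tendsto_mult_right_zero[OF LIMSEQ_inverse_real_of_nat])
  define f where "f n w = (g (a + of_real (h n)) w - g a w) / of_real (h n)" for n w
  have unif: "uniform_limit T f (\<lambda>w. deriv (\<lambda>z. g z w) a) sequentially"
  proof (rule uniform_limitI)
    fix e :: real assume "0 < e"
    have "(\<lambda>n. 8 * C / r\<^sup>2 * h n) \<longlonglongrightarrow> 0" by (rule tendsto_mult_right_zero[OF h0])
    then have "\<forall>\<^sub>F n in sequentially. 8 * C / r\<^sup>2 * h n < e"
      using \<open>0 < e\<close> by (intro order_tendstoD) auto
    then show "\<forall>\<^sub>F n in sequentially. \<forall>w\<in>T. dist (f n w) (deriv (\<lambda>z. g z w) a) < e"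
    proof eventually_elim
      case (elim n)
      show ?case
      proof
        fix w assume w: "w \<in> T"
        have "norm (g (a + of_real (h n)) w - g a w - of_real (h n) * deriv (\<lambda>z. g z w) a)
            \<le> 8 * C / r\<^sup>2 * norm (of_real (h n) :: complex) ^ 2"
          using holomorphic_bounded_Taylor[OF hz[OF w] r C[OF _ w], of "of_real (h n)"] h[of n] by simp
        then have "norm (g (a + of_real (h n)) w - g a w - of_real (h n) * deriv (\<lambda>z. g z w) a) / h n
            \<le> 8 * C / r\<^sup>2 * h n"
          using h[of n] by (simp add: divide_le_eq power2_eq_square mult_ac)
        moreover have "f n w - deriv (\<lambda>z. g z w) a
            = (g (a + of_real (h n)) w - g a w - of_real (h n) * deriv (\<lambda>z. g z w) a) / of_real (h n)"
          using h[of n] by (simp add: f_def field_simps)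
        ultimately have "norm (f n w - deriv (\<lambda>z. g z w) a) \<le> 8 * C / r\<^sup>2 * h n"
          using h[of n] by (simp add: norm_divide)
        with elim show "dist (f n w) (deriv (\<lambda>z. g z w) a) < e" by (simp add: dist_norm)
      qed
    qed
  qed
  show ?thesis
  proof (rule holomorphic_uniform_sequence[OF T])
    fix n
    have "a + of_real (h n) \<in> ball a r" using h[of n] by (auto simp: dist_norm)
    then show "f n holomorphic_on T"
      unfolding f_def using h[of n] r by (intro holomorphic_intros hw) auto
  next
    fix w assume "w \<in> T"
    then obtain d where "0 < d" "cball w d \<subseteq> T" using T open_contains_cball by blast
    then show "\<exists>d>0. cball w d \<subseteq> T \<and> uniform_limit (cball w d) f (\<lambda>w. deriv (\<lambda>z. g z w) a) sequentially"
      using uniform_limit_on_subset[OF unif] by blast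
  qed
qed

lemma holomorphic_higher_deriv_parameter:
  fixes g :: "complex \<Rightarrow> complex \<Rightarrow> complex"
  assumes T: "open T"
    and hz: "\<And>w. w \<in> T \<Longrightarrow> (\<lambda>z. g z w) holomorphic_on ball a r" and r: "0 < r"
    and hw: "\<And>z. z \<in> ball a r \<Longrightarrow> g z holomorphic_on T"
    and C: "\<And>z w. z \<in> ball a r \<Longrightarrow> w \<in> T \<Longrightarrow> norm (g z w) \<le> C"
  shows "(\<lambda>w. (deriv ^^ k) (\<lambda>z. g z w) a) holomorphic_on T"
  using hz r hw C
proof (induction k arbitrary: g r C)
  case 0
  then show ?case by simp
next
  case (Suc k)
  \<comment> \<open>The extra derivative is taken first, on the inside, so the induction hypothesis
    is applied to the z-derivative of g, with half the radius and the Cauchy bound 2C/r in place of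
    C.\<close>
  have "(\<lambda>w. (deriv ^^ k) (\<lambda>z. deriv (\<lambda>z. g z w) z) a) holomorphic_on T"
  proof (rule Suc.IH)
    show "(\<lambda>z. deriv (\<lambda>z. g z w) z) holomorphic_on ball a (r/2)" if "w \<in> T" for w
      using Suc.prems(1)[OF that] \<open>0 < r\<close>
      by (intro holomorphic_deriv) (auto intro: holomorphic_on_subset)
    show "0 < r/2" using \<open>0 < r\<close> by simp
    show "(\<lambda>w. deriv (\<lambda>z. g z w) z) holomorphic_on T" if z: "z \<in> ball a (r/2)" for z
    proof (rule holomorphic_deriv_parameter[OF T, where r = "r/2"])
      have sub: "ball z (r/2) \<subseteq> ball a r"
      proof
        fix x assume "x \<in> ball z (r/2)"
        then show "x \<in> ball a r" using z dist_triangle[of a x z] by auto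
      qed
      show "(\<lambda>z. g z w) holomorphic_on ball z (r/2)" if "w \<in> T" for w
        using Suc.prems(1)[OF that] sub by (rule holomorphic_on_subset)
      show "g z' holomorphic_on T" "\<And>w. w \<in> T \<Longrightarrow> norm (g z' w) \<le> C" if "z' \<in> ball z (r/2)" for z'
        using Suc.prems(3,4) sub that by blast+
    qed (use \<open>0 < r\<close> in auto)
    show "norm (deriv (\<lambda>z. g z w) z) \<le> 2 * C / r" if "z \<in> ball a (r/2)" "w \<in> T" for z w
      using holomorphic_bounded_deriv[OF Suc.prems(1,2,4)] that by blast
  qed
  then show ?case by (simp add: funpow_Suc_right del: funpow.simps)
qed

section \<open>Hartogs' lemma for families of functions\<close>

text \<open>The angles at which the rate (2/3)^k fails with constant m form open sets that decrease
  to the empty set as m grows, so their measure tends to 0. Once it is small, the two-constants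
  estimate costs, up to a constant, only a factor (3/2)^k, which the good rate pays for. The choice
  of m depends neither on k nor on p.\<close>

lemma hartogs_uniform_bound:
  fixes f :: "nat \<Rightarrow> 'i \<Rightarrow> complex \<Rightarrow> complex"
  assumes hol: "\<And>k p. p \<in> P \<Longrightarrow> f k p holomorphic_on ball 0 2"
    and d: "0 < d"
    and M: "\<And>k p w. p \<in> P \<Longrightarrow> norm w < 2 \<Longrightarrow> norm (f k p w) \<le> M / d ^ k"
    and C: "\<And>w. norm w < 2 \<Longrightarrow> \<exists>C. \<forall>k. \<forall>p\<in>P. norm (f k p w) \<le> C * (2/3) ^ k"
  obtains B where "\<And>k p w. p \<in> P \<Longrightarrow> norm w \<le> 1/2 \<Longrightarrow> norm (f k p w) \<le> B"
proof -
  define U where "U m = {t. \<exists>k. \<exists>p\<in>P. norm (f k p (cis t)) > real m * (2/3) ^ k}" for m :: nat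
  define E where "E m = U m \<inter> {-1..2*pi+1}" for m
  have cont: "continuous_on UNIV (\<lambda>t. norm (f k p (cis t)))" if "p \<in> P" for k p
  proof -
    have "continuous_on (ball 0 2) (f k p)"
      using hol[OF that] by (rule holomorphic_on_imp_continuous_on)
    moreover have "range cis \<subseteq> ball 0 2" by auto
    ultimately have "continuous_on (range cis) (f k p)" by (rule continuous_on_subset)
    then have "continuous_on UNIV (f k p \<circ> cis)" by (intro continuous_on_compose continuous_intros)
    then show ?thesis by (auto simp: o_def intro: continuous_intros)
  qed
  have openU: "open (U m)" for m
  proof -
    \<comment> \<open>A union over all k and p of strict inequalities between continuous functions,
      hence open however large P is.\<close>
    have "U m = (\<Union>k. \<Union>p\<in>P. {t. norm (f k p (cis t)) > real m * (2/3) ^ k})"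
      by (auto simp: U_def)
    also have "open \<dots>"
      by (intro open_UN ballI open_Collect_less cont continuous_on_const)
    finally show ?thesis .
  qed
  have decU: "U n \<subseteq> U m" if "m \<le> n" for m n
  proof
    fix t assume "t \<in> U n"
    then obtain k p where kp: "p \<in> P" "norm (f k p (cis t)) > real n * (2/3) ^ k" by (auto simp: U_def)
    have "real m * (2/3) ^ k \<le> real n * (2/3) ^ k" using that by (intro mult_right_mono) auto
    with kp(2) have "real m * (2/3) ^ k < norm (f k p (cis t))" by (rule le_less_trans[rotated])
    with kp(1) show "t \<in> U m" unfolding U_def by blast
  qed
  have InterU: "(\<Inter>m. E m) = {}"
  proof -
    have "\<exists>m. t \<notin> U m" for t
    proof -
      obtain C where C: "\<And>k p. p \<in> P \<Longrightarrow> norm (f k p (cis t)) \<le> C * (2/3) ^ k"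
        using C[of "cis t"] by auto
      obtain m :: nat where m: "C \<le> real m" using real_arch_simple by blast
      have "norm (f k p (cis t)) \<le> real m * (2/3) ^ k" if "p \<in> P" for k p
        using C[OF that, of k] by (rule order_trans) (intro mult_right_mono m, simp)
      then have "t \<notin> U m" by (auto simp: U_def not_less)
      then show ?thesis ..
    qed
    then show ?thesis by (auto simp: E_def)
  qed
  have Em: "E m \<in> sets lborel" "emeasure lborel (E m) \<noteq> \<infinity>" for m
  proof -
    show "E m \<in> sets lborel" using openU by (auto simp: E_def)
    have "emeasure lborel (E m) \<le> emeasure lborel {-1..2*pi+1}"
      by (intro emeasure_mono) (auto simp: E_def)
    also have "\<dots> < \<infinity>" by (simp add: emeasure_lborel_Icc_eq)
    finally show "emeasure lborel (E m) \<noteq> \<infinity>" by simp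
  qed
  have "(\<lambda>m. measure lborel (E m)) \<longlonglongrightarrow> measure lborel (\<Inter>m. E m)"
  proof (rule Lim_measure_decseq)
    show "decseq E" using decU by (force simp: decseq_def E_def)
  qed (use Em in auto)
  then have lim: "(\<lambda>m. measure lborel (E m)) \<longlonglongrightarrow> 0" by (simp add: InterU)

  define M' where "M' = max M 0"
  define r where "r = max 1 (3 / (2 * d))"
  have r: "r \<ge> 1" "3 / (2 * d) \<le> r" by (auto simp: r_def)
  \<comment> \<open>By the grid lemma the exponent \<open>8 * l * card S\<close> of the
    two-constants estimate will be at most \<open>4 * measure lborel (E m)\<close>. The first
    condition keeps it below 1, which handles the constant part of \<open>ln (B / A)\<close>; by the
    second, the part linear in k loses at most \<open>k * ln (3/2)\<close>.\<close>
  have "\<forall>\<^sub>F m in sequentially. 4 * measure lborel (E m) < 1 \<and> 4 * measure lborel (E m) * ln r < ln (3/2) \<and> m \<ge> 1"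
  proof (intro eventually_conj eventually_ge_at_top)
    have "(\<lambda>m. 4 * measure lborel (E m)) \<longlonglongrightarrow> 0" using lim by (auto intro!: tendsto_eq_intros)
    then show "\<forall>\<^sub>F m in sequentially. 4 * measure lborel (E m) < 1" by (rule order_tendstoD) simp
    have "(\<lambda>m. 4 * measure lborel (E m) * ln r) \<longlonglongrightarrow> 0" using lim by (auto intro!: tendsto_eq_intros)
    then show "\<forall>\<^sub>F m in sequentially. 4 * measure lborel (E m) * ln r < ln (3/2)" by (rule order_tendstoD) simp
  qed
  then obtain m where m: "4 * measure lborel (E m) < 1" "4 * measure lborel (E m) * ln r < ln (3/2)" "m \<ge> 1"
    unfolding eventually_sequentially by blast
  have "norm (f k p w) \<le> 2 * m * (1 + M')" if p: "p \<in> P" and w: "norm w \<le> 1/2" for k p w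
  proof -
    \<comment> \<open>The factor 2 makes the closed condition A \<le> |f| imply the strict
      inequality that defines \<open>U m\<close> (as m \<ge> 1), so that a compact set is placed
      inside this open one.\<close>
    define A where "A = 2 * m * (2/3::real) ^ k"
    define K where "K = {t \<in> {0..2*pi}. A \<le> norm (f k p (cis t))}"
    have A: "0 < A" "(2/3)^k \<le> A" using m(3) by (auto simp: A_def)
    have "closed {t. A \<le> norm (f k p (cis t))}"
      by (intro closed_Collect_le cont[OF p] continuous_on_const)
    then have "compact ({0..2*pi} \<inter> {t. A \<le> norm (f k p (cis t))})"
      by (rule compact_Int_closed[OF compact_Icc])
    also have "{0..2*pi} \<inter> {t. A \<le> norm (f k p (cis t))} = K" by (auto simp: K_def)
    finally have "compact K" .
    have "K \<subseteq> U m"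
    proof
      fix t assume "t \<in> K"
      then have "A \<le> norm (f k p (cis t))" by (simp add: K_def)
      moreover have "real m * (2/3) ^ k < A" using m(3) by (simp add: A_def)
      ultimately show "t \<in> U m" using p unfolding U_def by (blast intro: less_le_trans)
    qed
    obtain S l where S: "finite S" "0 < l" "l \<le> 1" "\<And>t. t \<in> K \<Longrightarrow> \<exists>c\<in>S. \<bar>t - c\<bar> \<le> l"
      "2 * l * card S \<le> measure lborel (E m)"
    proof (rule compact_covered_by_grid[OF \<open>compact K\<close> \<open>K \<subseteq> U m\<close> _ openU])
      show "K \<subseteq> {0..2*pi}" by (auto simp: K_def)
    qed (use that in \<open>auto simp: E_def\<close>)
    \<comment> \<open>As a multiple of A, so that \<open>ln (B / A)\<close> splits into a constant
      and a part linear in k; r \<ge> 3/(2d) makes (2/3)^k r^k dominate the bad rate 1/d^k.\<close>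
    define B where "B = A * ((1 + M') * r ^ k)"
    have M': "0 \<le> M'" "M \<le> M'" by (auto simp: M'_def)
    have 1: "1 \<le> (1 + M') * r ^ k" using mult_mono[of 1 "1 + M'" 1 "r ^ k"] M' r(1) by simp
    have "A \<le> B" using mult_left_mono[OF 1, of A] A by (simp add: B_def)
    have "norm (f k p w) \<le> A * exp (ln (B / A) * (8 * l * card S))"
    proof (rule two_constants_arcs[OF hol[OF p] S(1,2,3) A(1) \<open>A \<le> B\<close> _ _ w])
      fix z :: complex assume "norm z = 1"
      then have "norm (f k p z) \<le> M / d ^ k" using M[OF p] by simp
      also have "\<dots> = M * ((2/3) ^ k * (3 / (2*d)) ^ k)"
      proof -
        have "(2/3) ^ k * (3 / (2*d)) ^ k = ((2/3) * (3 / (2*d))) ^ k" by (rule power_mult_distrib[symmetric])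
        also have "(2/3) * (3 / (2*d)) = 1 / d" by simp
        finally show ?thesis by (simp add: power_divide)
      qed
      also have "\<dots> \<le> (1 + M') * (A * r ^ k)"
        using M' A r d by (intro mult_mono power_mono) auto
      finally show "norm (f k p z) \<le> B" by (simp add: B_def mult_ac)
    next
      fix t assume t: "t \<in> {0..2*pi}"
      show "norm (f k p (cis t)) \<le> A \<or> (\<exists>c\<in>S. \<bar>t - c\<bar> \<le> l)"
      proof (cases "A \<le> norm (f k p (cis t))")
        case True
        then have "t \<in> K" using t by (simp add: K_def)
        then show ?thesis using S(4) by blast
      qed auto
    qed
    also have "ln (B / A) = ln (1 + M') + k * ln r"
      using A M' r by (simp add: B_def ln_mult ln_realpow)
    also have "A * exp ((ln (1 + M') + k * ln r) * (8 * l * card S)) \<le> A * exp (ln (1 + M') + k * ln (3/2))"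
    proof -
      define \<eta> where "\<eta> = 8 * l * card S"
      have \<eta>: "0 \<le> \<eta>" "\<eta> \<le> 4 * measure lborel (E m)" using S by (auto simp: \<eta>_def)
      have lr: "0 \<le> ln r" "0 \<le> ln (1 + M')" using r M' by auto
      have "\<eta> * ln r \<le> 4 * measure lborel (E m) * ln r"
        using \<eta> lr by (intro mult_right_mono) auto
      then have "\<eta> * ln r \<le> ln (3/2)" using m by linarith
      then have "k * (\<eta> * ln r) \<le> k * ln (3/2)" by (intro mult_left_mono) auto
      moreover have "ln (1 + M') * \<eta> \<le> ln (1 + M') * 1"
        using \<eta> m lr by (intro mult_left_mono) auto
      ultimately have "(ln (1 + M') + k * ln r) * \<eta> \<le> ln (1 + M') + k * ln (3/2)"
        by (simp add: algebra_simps)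
      then show ?thesis using A by (simp add: \<eta>_def)
    qed
    also have "\<dots> = A * ((1 + M') * (3/2) ^ k)"
      using M' by (simp add: exp_add exp_of_nat_mult)
    also have "\<dots> = 2 * m * (1 + M')"
      by (simp add: A_def power_divide)
    finally show ?thesis .
  qed
  then show ?thesis by (rule that)
qed

text \<open>\<open>bw\<close> feeds Baire's theorem and thereby the bad rate, \<open>bz\<close>
  feeds the good one. The index p is carried along because on planes all members of a unit ball have
  to be bounded at once.\<close>

proposition hartogs_bounded:
  fixes G :: "'i \<Rightarrow> complex \<Rightarrow> complex \<Rightarrow> complex"
  assumes hz: "\<And>p w. p \<in> P \<Longrightarrow> norm w < 2 \<Longrightarrow> (\<lambda>z. G p z w) holomorphic_on ball 0 2"
    and hw: "\<And>p z. p \<in> P \<Longrightarrow> norm z < 2 \<Longrightarrow> G p z holomorphic_on ball 0 2"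
    and bw: "\<And>z. norm z < 2 \<Longrightarrow> \<exists>C. \<forall>p\<in>P. \<forall>w\<in>ball 0 2. norm (G p z w) \<le> C"
    and bz: "\<And>w. norm w < 2 \<Longrightarrow> \<exists>C. \<forall>p\<in>P. \<forall>z\<in>ball 0 2. norm (G p z w) \<le> C"
  obtains B where "\<And>p z w. p \<in> P \<Longrightarrow> norm z \<le> 1/4 \<Longrightarrow> norm w \<le> 1/2 \<Longrightarrow> norm (G p z w) \<le> B"
proof -
  define E where "E m = {z \<in> cball 0 (1/4). \<forall>p\<in>P. \<forall>w\<in>ball 0 2. norm (G p z w) \<le> real m}" for m :: nat
  have closedE: "closed (E m)" for m
  proof -
    have "E m = cball 0 (1/4) \<inter> (\<Inter>p\<in>P. \<Inter>w\<in>ball 0 2. {z \<in> cball 0 (1/4). norm (G p z w) \<le> real m})"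
      by (auto simp: E_def)
    also have "closed \<dots>"
    proof (intro closed_Int closed_INT ballI closed_cball)
      fix p and w :: complex assume "p \<in> P" "w \<in> ball 0 2"
      then have "continuous_on (cball 0 (1/4)) (\<lambda>z. G p z w)"
        by (intro holomorphic_on_imp_continuous_on holomorphic_on_subset[OF hz]) auto
      then show "closed {z \<in> cball 0 (1/4). norm (G p z w) \<le> real m}"
        by (intro continuous_on_closed_Collect_le continuous_intros) auto
    qed
    finally show ?thesis .
  qed
  have UE: "\<exists>m. z \<in> E m" if "z \<in> cball 0 (1/4)" for z
  proof -
    obtain C where "\<forall>p\<in>P. \<forall>w\<in>ball 0 2. norm (G p z w) \<le> C" using bw[of z] \<open>z \<in> _\<close> by auto
    moreover obtain m :: nat where "C \<le> real m" using real_arch_simple by blast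
    ultimately show ?thesis using that unfolding E_def by (blast intro: order_trans)
  qed
  have "\<exists>m. \<not> cball 0 (1/4) \<subseteq> closure (cball 0 (1/4) - E m)"
  proof (rule ccontr)
    assume "\<nexists>m. \<not> cball 0 (1/4) \<subseteq> closure (cball 0 (1/4) - E m)"
    then have "cball 0 (1/4) \<subseteq> closure (\<Inter>m. cball 0 (1/4) - E m)"
      using closedE by (intro Baire) (auto simp: Diff_eq intro!: openin_open_Int)
    moreover have "(\<Inter>m. cball 0 (1/4) - E m) = {}" using UE by auto
    ultimately have "cball (0::complex) (1/4) \<subseteq> {}" by (metis closure_empty)
    then show False by simp
  qed
  then obtain m x where x: "x \<in> cball 0 (1/4)" "x \<notin> closure (cball 0 (1/4) - E m)" by blast
  then obtain e where e: "0 < e" "\<And>y. y \<in> cball 0 (1/4) - E m \<Longrightarrow> \<not> dist y x < e"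
    unfolding closure_approachable by blast
  \<comment> \<open>x may lie on the boundary of the disc; it is replaced by a nearby interior point
    b, about which a full disc fits into \<open>E m\<close>.\<close>
  have "x \<in> closure (ball 0 (1/4))" using x(1) by simp
  then obtain b where b: "b \<in> ball 0 (1/4)" "dist b x < e"
    using e(1) unfolding closure_approachable by blast
  have "open (ball 0 (1/4) \<inter> ball x e)" "b \<in> ball 0 (1/4) \<inter> ball x e" using b by (auto simp: dist_commute)
  then obtain d where d: "0 < d" "ball b d \<subseteq> ball 0 (1/4) \<inter> ball x e" by (meson open_contains_ball)
  have bd: "norm (G p z w) \<le> real m" if "p \<in> P" "z \<in> ball b d" "norm w < 2" for p z w
  proof -
    have "z \<in> ball 0 (1/4) \<inter> ball x e" using that(2) d(2) by (rule set_rev_mp)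
    then have "z \<in> E m" using e(2)[of z] by (auto simp: dist_commute)
    then show ?thesis using that by (auto simp: E_def)
  qed
  have bsub: "ball b d \<subseteq> ball 0 2"
  proof
    fix z assume "z \<in> ball b d"
    then have "z \<in> ball 0 (1/4)" using d(2) by blast
    then show "z \<in> ball 0 2" by simp
  qed
  have subb: "ball b (7/4) \<subseteq> ball 0 2"
  proof
    fix z assume "z \<in> ball b (7/4)"
    then show "z \<in> ball 0 2" using b(1) dist_triangle[of 0 z b] by auto
  qed
  define f where "f k p w = (deriv ^^ k) (\<lambda>z. G p z w) b / fact k" for k p w
  obtain B where B: "\<And>k p w. p \<in> P \<Longrightarrow> norm w \<le> 1/2 \<Longrightarrow> norm (f k p w) \<le> B"
  proof (rule hartogs_uniform_bound[of P f "d/2" "real m"])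
    show "f k p holomorphic_on ball 0 2" if "p \<in> P" for k p
    proof -
      have "(\<lambda>w. (deriv ^^ k) (\<lambda>z. G p z w) b) holomorphic_on ball 0 2"
      proof (rule holomorphic_higher_deriv_parameter[OF open_ball _ d(1)])
        show "(\<lambda>z. G p z w) holomorphic_on ball b d" if "w \<in> ball 0 2" for w
          using hz[OF \<open>p \<in> P\<close>, of w] that bsub by (auto intro: holomorphic_on_subset)
        show "G p z holomorphic_on ball 0 2" if "z \<in> ball b d" for z
          using that bsub by (intro hw[OF \<open>p \<in> P\<close>]) auto
        show "norm (G p z w) \<le> real m" if "z \<in> ball b d" "w \<in> ball 0 2" for z w
          using bd[OF \<open>p \<in> P\<close>, of z w] that by simp
      qed
      then show ?thesis unfolding f_def by (intro holomorphic_intros) auto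
    qed
    show "0 < d/2" using d by simp
    show "norm (f k p w) \<le> real m / (d/2) ^ k" if "p \<in> P" "norm w < 2" for k p w
    proof -
      have "norm ((deriv ^^ k) (\<lambda>z. G p z w) b) \<le> fact k * real m / (d/2) ^ k"
      proof (rule Cauchy_inequality)
        have "cball b (d/2) \<subseteq> ball b d" using d by auto
        also note bsub
        finally have "(\<lambda>z. G p z w) holomorphic_on cball b (d/2)"
          using hz[OF that] by (rule holomorphic_on_subset[rotated])
        then show "(\<lambda>z. G p z w) holomorphic_on ball b (d/2)" "continuous_on (cball b (d/2)) (\<lambda>z. G p z w)"
          using ball_subset_cball by (blast intro: holomorphic_on_subset holomorphic_on_imp_continuous_on)+
        show "norm (G p z w) \<le> real m" if "norm (b - z) = d/2" for z
          using that d \<open>p \<in> P\<close> \<open>norm w < 2\<close> by (intro bd) (auto simp: dist_norm)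
      qed (use d in auto)
      then show ?thesis by (simp add: f_def norm_divide divide_le_eq mult.commute)
    qed
    show "\<exists>C. \<forall>k. \<forall>p\<in>P. norm (f k p w) \<le> C * (2/3) ^ k" if w: "norm w < 2" for w
    proof -
      obtain C where C: "\<And>p z. p \<in> P \<Longrightarrow> z \<in> ball 0 2 \<Longrightarrow> norm (G p z w) \<le> C" using bz[OF w] by blast
      have "norm (f k p w) \<le> C * (2/3) ^ k" if p: "p \<in> P" for k p
      proof -
        \<comment> \<open>As |b| < 1/4, the disc of radius 7/4 about b stays in
          \<open>ball 0 2\<close>; the Cauchy estimate on the circle of radius 3/2 produces the rate
          2/3.\<close>
        have sub: "cball b (3/2) \<subseteq> ball 0 2" using subb by auto
        have "norm ((deriv ^^ k) (\<lambda>z. G p z w) b) \<le> fact k * C / (3/2) ^ k"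
        proof (rule Cauchy_inequality)
          have "(\<lambda>z. G p z w) holomorphic_on cball b (3/2)"
            using hz[OF p w] sub by (rule holomorphic_on_subset)
          then show "(\<lambda>z. G p z w) holomorphic_on ball b (3/2)" "continuous_on (cball b (3/2)) (\<lambda>z. G p z w)"
            using ball_subset_cball by (blast intro: holomorphic_on_subset holomorphic_on_imp_continuous_on)+
          show "norm (G p z w) \<le> C" if "norm (b - z) = 3/2" for z
            using that by (intro C[OF p] subsetD[OF sub]) (simp add: dist_norm)
        qed auto
        then show ?thesis by (simp add: f_def norm_divide divide_le_eq power_divide field_simps)
      qed
      then show ?thesis by blast
    qed
  qed blast
  have "norm (G p z w) \<le> 2 * B" if p: "p \<in> P" and z: "norm z \<le> 1/4" and w: "norm w \<le> 1/2" for p z w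
  proof -
    \<comment> \<open>Both z and b lie within 1/4 of the origin, so the series about b is dominated
      by a geometric one of ratio 1/2; hence the bound 2 B.\<close>
    have zb: "norm (z - b) \<le> 1/2" using z b(1) norm_triangle_ineq4[of z b] by simp
    have "(\<lambda>z. G p z w) holomorphic_on ball b (7/4)"
      using hz[of p w] p w subb by (auto intro: holomorphic_on_subset)
    then have sums: "(\<lambda>k. f k p w * (z - b) ^ k) sums G p z w"
      unfolding f_def using zb by (intro holomorphic_power_series) (auto simp: dist_norm norm_minus_commute)
    have geo: "(\<lambda>k. B * (1/2) ^ k) sums (B * 2)"
      using sums_mult[OF geometric_sums[of "1/2::real"], of B] by simp
    have le: "norm (f k p w * (z - b) ^ k) \<le> B * (1/2) ^ k" for k
      unfolding norm_mult norm_power using zb B[OF p w] norm_ge_zero[of "f k p w"]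
      by (intro mult_mono power_mono order_trans[OF norm_ge_zero B[OF p w]]) auto
    have "norm (\<Sum>k. f k p w * (z - b) ^ k) \<le> (\<Sum>k. B * (1/2) ^ k)"
      by (rule norm_suminf_le[OF le sums_summable[OF geo]])
    then show ?thesis using sums_unique[OF sums] sums_unique[OF geo] by (simp add: mult.commute)
  qed
  then show ?thesis by (rule that)
qed

section \<open>Inner product spaces of functions\<close>

lemma scaleR_eq_cscale: "r *\<^sub>R f = cscale (of_real r) f"
  by (simp add: scaleR_fun_def cscale_def scaleR_conv_of_real)

lemma uminus_eq_cscale: "- f = cscale (-1) f"
  by (simp add: cscale_def fun_eq_iff)

lemma cscale_cscale [simp]: "cscale a (cscale b f) = cscale (a * b) f"
  by (simp add: cscale_def mult.assoc)

lemma cscale_one [simp]: "cscale 1 f = f"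
  by (simp add: cscale_def)

lemma cscale_zero [simp]: "cscale 0 f = 0" "cscale c 0 = 0"
  by (simp_all add: cscale_def fun_eq_iff)

lemma cscale_add: "cscale c (f + g) = cscale c f + cscale c g"
  by (simp add: cscale_def fun_eq_iff algebra_simps)

text \<open>Completeness is kept apart: it is used in F only, for the Riesz representation and for
  limits of difference quotients, and the dual becomes an instance by algebra alone.\<close>

locale function_inner_space =
  fixes H :: "('a \<Rightarrow> complex) set" and ip :: "('a \<Rightarrow> complex) \<Rightarrow> ('a \<Rightarrow> complex) \<Rightarrow> complex"
  assumes zero_mem [simp]: "0 \<in> H"
    and add_mem: "f \<in> H \<Longrightarrow> g \<in> H \<Longrightarrow> f + g \<in> H"
    and cscale_mem: "f \<in> H \<Longrightarrow> cscale c f \<in> H"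
    and hermitean: "hermitean_form_on cscale H ip"
    and positive: "f \<in> H \<Longrightarrow> f \<noteq> 0 \<Longrightarrow> 0 < Re (ip f f)"
begin

lemma uminus_mem: "f \<in> H \<Longrightarrow> - f \<in> H"
  unfolding uminus_eq_cscale by (rule cscale_mem)

lemma diff_mem: "f \<in> H \<Longrightarrow> g \<in> H \<Longrightarrow> f - g \<in> H"
  using add_mem[of f "- g"] uminus_mem by simp

lemma scaleR_mem: "f \<in> H \<Longrightarrow> r *\<^sub>R f \<in> H"
  unfolding scaleR_eq_cscale by (rule cscale_mem)

lemma sum_mem: "(\<And>i. i \<in> A \<Longrightarrow> f i \<in> H) \<Longrightarrow> sum f A \<in> H"
  by (induction A rule: infinite_finite_induct) (auto intro: add_mem)

lemmas mem = zero_mem add_mem diff_mem uminus_mem cscale_mem scaleR_mem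

lemma ip_add_left: "f \<in> H \<Longrightarrow> g \<in> H \<Longrightarrow> h \<in> H \<Longrightarrow> ip (f + g) h = ip f h + ip g h"
  and ip_add_right: "f \<in> H \<Longrightarrow> g \<in> H \<Longrightarrow> h \<in> H \<Longrightarrow> ip h (f + g) = ip h f + ip h g"
  and ip_cscale_left: "f \<in> H \<Longrightarrow> h \<in> H \<Longrightarrow> ip (cscale c f) h = c * ip f h"
  and ip_cscale_right: "f \<in> H \<Longrightarrow> h \<in> H \<Longrightarrow> ip h (cscale c f) = cnj c * ip h f"
  and ip_commute: "f \<in> H \<Longrightarrow> h \<in> H \<Longrightarrow> ip h f = cnj (ip f h)"
  using hermitean unfolding hermitean_form_on_def by blast+

lemma ip_uminus_left: "f \<in> H \<Longrightarrow> h \<in> H \<Longrightarrow> ip (- f) h = - ip f h"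
  and ip_uminus_right: "f \<in> H \<Longrightarrow> h \<in> H \<Longrightarrow> ip h (- f) = - ip h f"
  by (simp_all add: uminus_eq_cscale[of f] ip_cscale_left ip_cscale_right)

lemma ip_diff_left: "f \<in> H \<Longrightarrow> g \<in> H \<Longrightarrow> h \<in> H \<Longrightarrow> ip (f - g) h = ip f h - ip g h"
  and ip_diff_right: "f \<in> H \<Longrightarrow> g \<in> H \<Longrightarrow> h \<in> H \<Longrightarrow> ip h (f - g) = ip h f - ip h g"
  using ip_add_left[of f "- g" h] ip_add_right[of f "- g" h] ip_uminus_left[of g h] ip_uminus_right[of g h]
  by (simp_all add: uminus_mem)

lemma ip_scaleR_left: "f \<in> H \<Longrightarrow> h \<in> H \<Longrightarrow> ip (r *\<^sub>R f) h = of_real r * ip f h"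
  and ip_scaleR_right: "f \<in> H \<Longrightarrow> h \<in> H \<Longrightarrow> ip h (r *\<^sub>R f) = of_real r * ip h f"
  by (simp_all add: scaleR_eq_cscale ip_cscale_left ip_cscale_right)

lemma ip_zero_left: "h \<in> H \<Longrightarrow> ip 0 h = 0"
  and ip_zero_right: "h \<in> H \<Longrightarrow> ip h 0 = 0"
  using ip_cscale_left[of 0 h 0] ip_cscale_right[of 0 h 0] by simp_all

lemma ip_sum_left: "(\<And>i. i \<in> A \<Longrightarrow> f i \<in> H) \<Longrightarrow> h \<in> H \<Longrightarrow> ip (sum f A) h = (\<Sum>i\<in>A. ip (f i) h)"
  by (induction A rule: infinite_finite_induct) (auto simp: ip_zero_left ip_add_left sum_mem)

lemma ip_sum_right: "(\<And>i. i \<in> A \<Longrightarrow> f i \<in> H) \<Longrightarrow> h \<in> H \<Longrightarrow> ip h (sum f A) = (\<Sum>i\<in>A. ip h (f i))"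
  by (induction A rule: infinite_finite_induct) (auto simp: ip_zero_right ip_add_right sum_mem)

lemmas ip_simps = ip_add_left ip_add_right ip_cscale_left ip_cscale_right ip_uminus_left ip_uminus_right
  ip_diff_left ip_diff_right ip_scaleR_left ip_scaleR_right ip_zero_left ip_zero_right mem

abbreviation nrm :: "('a \<Rightarrow> complex) \<Rightarrow> real" where "nrm \<equiv> hnorm ip"

lemma Re_ip_nonneg: "f \<in> H \<Longrightarrow> 0 \<le> Re (ip f f)"
  using positive[of f] by (cases "f = 0") (auto simp: ip_zero_left)

lemma nrm_nonneg [simp]: "f \<in> H \<Longrightarrow> 0 \<le> nrm f"
  by (simp add: hnorm_def Re_ip_nonneg)

lemma nrm_power2: "f \<in> H \<Longrightarrow> (nrm f)\<^sup>2 = Re (ip f f)"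
  by (simp add: hnorm_def Re_ip_nonneg)

lemma ip_self: "f \<in> H \<Longrightarrow> ip f f = of_real ((nrm f)\<^sup>2)"
  using ip_commute[of f f] by (simp add: nrm_power2 complex_eq_iff)

lemma nrm_zero [simp]: "nrm 0 = 0"
  by (simp add: hnorm_def ip_zero_left)

lemma nrm_eq_0: "f \<in> H \<Longrightarrow> nrm f = 0 \<longleftrightarrow> f = 0"
  using positive[of f] nrm_power2[of f] by (cases "f = 0") auto

lemma nrm_pos: "f \<in> H \<Longrightarrow> f \<noteq> 0 \<Longrightarrow> 0 < nrm f"
  using nrm_eq_0[of f] nrm_nonneg[of f] by linarith

lemma nrm_cscale: "f \<in> H \<Longrightarrow> nrm (cscale c f) = norm c * nrm f"
proof -
  assume f: "f \<in> H"
  have "(nrm (cscale c f))\<^sup>2 = (norm c * nrm f)\<^sup>2"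
    using f by (simp add: power_mult_distrib nrm_power2 ip_simps cmod_power2)
      (simp add: algebra_simps power2_eq_square)
  then show ?thesis using f by (simp add: mem)
qed

lemma nrm_scaleR: "f \<in> H \<Longrightarrow> nrm (r *\<^sub>R f) = \<bar>r\<bar> * nrm f"
  by (simp add: scaleR_eq_cscale nrm_cscale)

lemma nrm_uminus: "f \<in> H \<Longrightarrow> nrm (- f) = nrm f"
  by (simp add: uminus_eq_cscale nrm_cscale)

lemma nrm_minus_commute: "f \<in> H \<Longrightarrow> g \<in> H \<Longrightarrow> nrm (f - g) = nrm (g - f)"
  using nrm_uminus[of "f - g"] by (simp add: diff_mem)

lemma Cauchy_Schwarz: 
  assumes "f \<in> H" "g \<in> H" shows "norm (ip f g) \<le> nrm f * nrm g"
proof (cases "g = 0")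
  case False
  define t where "t = ip f g / ip g g"
  have pos: "0 < (nrm g)\<^sup>2" using nrm_pos[OF assms(2) False] by simp
  have gf: "ip g f = cnj (ip f g)" using assms by (intro ip_commute)
  have "0 \<le> Re (ip (f - cscale t g) (f - cscale t g))"
    using assms by (intro Re_ip_nonneg mem)
  also have "ip (f - cscale t g) (f - cscale t g) = ip f f - (cnj t * ip f g + t * (cnj (ip f g) - cnj t * ip g g))"
    using assms by (simp add: ip_simps gf algebra_simps)
  also have "cnj t * ip g g = cnj (ip f g)"
    using pos by (simp add: t_def ip_self[OF assms(2)])
  also have "ip f f - (cnj t * ip f g + t * (cnj (ip f g) - cnj (ip f g))) = of_real ((nrm f)\<^sup>2 - (norm (ip f g))\<^sup>2 / (nrm g)\<^sup>2)"
    using complex_norm_square[of "ip f g"]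
    by (simp add: t_def ip_self[OF assms(2)] ip_self[OF assms(1)] mult.commute)
  finally have "(norm (ip f g))\<^sup>2 / (nrm g)\<^sup>2 \<le> (nrm f)\<^sup>2" by simp
  then have "(norm (ip f g))\<^sup>2 \<le> (nrm f * nrm g)\<^sup>2"
    using pos by (simp add: divide_le_eq power_mult_distrib)
  then show ?thesis using assms by (simp add: power2_le_iff_abs_le)
qed (use assms in \<open>simp add: ip_zero_right\<close>)

lemma nrm_triangle: assumes "f \<in> H" "g \<in> H" shows "nrm (f + g) \<le> nrm f + nrm g"
proof -
  have "(nrm (f + g))\<^sup>2 = (nrm f)\<^sup>2 + (nrm g)\<^sup>2 + 2 * Re (ip f g)"
    using assms ip_commute[of f g] by (simp add: nrm_power2 ip_simps)
  also have "Re (ip f g) \<le> nrm f * nrm g"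
    using Cauchy_Schwarz[OF assms] complex_Re_le_cmod order_trans by blast
  finally have "(nrm (f + g))\<^sup>2 \<le> (nrm f + nrm g)\<^sup>2" by (simp add: power2_sum)
  then show ?thesis using assms by (simp add: power2_le_iff_abs_le mem)
qed

lemma nrm_triangle_diff:
  assumes "f \<in> H" "g \<in> H" "h \<in> H" shows "nrm (f - h) \<le> nrm (f - g) + nrm (g - h)"
  using nrm_triangle[of "f - g" "g - h"] assms by (simp add: mem)

text \<open>The function \<open>J\<close> below attains its minimum exactly at the representing vector; a minimizing
  sequence is Cauchy by the parallelogram law.\<close>

lemma Riesz_representation:
  assumes complete: "\<And>s :: nat \<Rightarrow> 'a \<Rightarrow> complex. (\<And>n. s n \<in> H) \<Longrightarrow>
      (\<forall>\<epsilon>>0. \<exists>M. \<forall>m\<ge>M. \<forall>n\<ge>M. nrm (s m - s n) < \<epsilon>) \<Longrightarrow> \<exists>l\<in>H. (\<lambda>n. nrm (s n - l)) \<longlonglongrightarrow> 0"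
    and add: "\<And>f g. f \<in> H \<Longrightarrow> g \<in> H \<Longrightarrow> p (f + g) = p f + p g"
    and scale: "\<And>f c. f \<in> H \<Longrightarrow> p (cscale c f) = c * p f"
    and bound: "\<And>f. f \<in> H \<Longrightarrow> norm (p f) \<le> C * nrm f"
  shows "\<exists>h\<in>H. \<forall>f\<in>H. p f = ip f h"
proof -
  \<comment> \<open>If p is the inner product with h, then J f is ||f - h||^2 - ||h||^2.\<close>
  define J where "J f = (nrm f)\<^sup>2 - 2 * Re (p f)" for f
  have J_ge: "- C\<^sup>2 \<le> J f" if "f \<in> H" for f
  proof -
    have "Re (p f) \<le> C * nrm f" using bound[OF that] complex_Re_le_cmod order_trans by blast
    moreover have "0 \<le> (nrm f - C)\<^sup>2" by simp
    ultimately show ?thesis by (simp add: J_def power2_diff mult.commute mult.left_commute)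
  qed
  define m where "m = Inf (J ` H)"
  have bdd: "bdd_below (J ` H)" using J_ge by (intro bdd_belowI2)
  have m_le: "m \<le> J f" if "f \<in> H" for f
    unfolding m_def using bdd that by (intro cInf_lower) auto
  have "\<exists>f\<in>H. J f < m + e" if "0 < e" for e
  proof -
    have "J ` H \<noteq> {}" using zero_mem by blast
    then have "\<exists>y\<in>J ` H. y < m + e"
      using that by (intro cInf_lessD) (simp_all add: m_def)
    then show ?thesis by blast
  qed
  then have "\<forall>n. \<exists>f\<in>H. J f < m + 1 / Suc n" by simp
  then obtain s where s: "\<And>n. s n \<in> H" "\<And>n. J (s n) < m + 1 / Suc n" by metis
  have J_plus: "J (f + g) = J f + J g + 2 * Re (ip f g)" if "f \<in> H" "g \<in> H" for f g
    using that ip_commute[of f g] by (simp add: J_def nrm_power2 ip_simps add)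
  have J_scale: "J (r *\<^sub>R f) = r\<^sup>2 * (nrm f)\<^sup>2 - 2 * r * Re (p f)" if "f \<in> H" for r f
    using that by (simp add: J_def nrm_scaleR scaleR_eq_cscale[of _ f] scale nrm_cscale power_mult_distrib)
  have dist: "(nrm (s i - s j))\<^sup>2 \<le> 2 / Suc i + 2 / Suc j" for i j
  proof -
    have "(nrm (s i - s j))\<^sup>2 = 2 * J (s i) + 2 * J (s j) - 4 * J ((1/2) *\<^sub>R (s i + s j))"
      using s(1) ip_commute[of "s i" "s j"]
      by (simp add: J_scale mem) (simp add: J_def nrm_power2 ip_simps add algebra_simps power_divide)
    also have "\<dots> \<le> 2 * J (s i) + 2 * J (s j) - 4 * m"
      using m_le[of "(1/2) *\<^sub>R (s i + s j)"] s(1) by (simp add: mem)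
    also have "\<dots> \<le> 2 / Suc i + 2 / Suc j"
    proof -
      have "2 / Suc i = 2 * (1 / real (Suc i))" "2 / Suc j = 2 * (1 / real (Suc j))" by simp_all
      then show ?thesis using s(2)[of i] s(2)[of j] by linarith
    qed
    finally show ?thesis .
  qed
  have inv_small: "\<exists>M::nat. \<forall>n\<ge>M. 1 / Suc n < e" if "0 < e" for e :: real
  proof -
    have "(\<lambda>n. 1 / real (Suc n)) \<longlonglongrightarrow> 0" using LIMSEQ_inverse_real_of_nat by (simp add: divide_inverse)
    then have "\<forall>\<^sub>F n in sequentially. 1 / real (Suc n) < e" using that by (rule order_tendstoD)
    then show ?thesis by (simp add: eventually_sequentially)
  qed
  have "\<forall>\<epsilon>>0. \<exists>M. \<forall>i\<ge>M. \<forall>j\<ge>M. nrm (s i - s j) < \<epsilon>"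
  proof (intro allI impI)
    fix \<epsilon> :: real assume "0 < \<epsilon>"
    then obtain M where M: "\<And>n. n \<ge> M \<Longrightarrow> 1 / Suc n < \<epsilon>\<^sup>2 / 4"
      using inv_small[of "\<epsilon>\<^sup>2 / 4"] by auto
    have "nrm (s i - s j) < \<epsilon>" if "i \<ge> M" "j \<ge> M" for i j
    proof -
      have "(nrm (s i - s j))\<^sup>2 < \<epsilon>\<^sup>2"
      proof -
        have "2 / Suc i = 2 * (1 / real (Suc i))" "2 / Suc j = 2 * (1 / real (Suc j))" by simp_all
        then show ?thesis using dist[of i j] M[OF that(1)] M[OF that(2)] by linarith
      qed
      then show ?thesis using \<open>0 < \<epsilon>\<close> by (simp add: power_less_imp_less_base)
    qed
    then show "\<exists>M. \<forall>i\<ge>M. \<forall>j\<ge>M. nrm (s i - s j) < \<epsilon>" by blast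
  qed
  then obtain l where l: "l \<in> H" "(\<lambda>n. nrm (s n - l)) \<longlonglongrightarrow> 0" using complete[of s] s(1) by blast
  \<comment> \<open>The first variation of J at l, obtained by letting n grow in
    \<open>m \<le> J (s n + t *\<^sub>R f)\<close>; the error 1/(n+1) by which
    \<open>J (s n)\<close> may exceed the infimum disappears in the limit.\<close>
  have key: "0 \<le> 2 * t * Re (ip l f - p f) + t\<^sup>2 * (nrm f)\<^sup>2" if f: "f \<in> H" for f t
  proof -
    have "(\<lambda>n. ip (s n) f - ip l f) \<longlonglongrightarrow> 0"
    proof (rule Lim_null_comparison)
      show "\<forall>\<^sub>F n in sequentially. norm (ip (s n) f - ip l f) \<le> nrm (s n - l) * nrm f"
        using Cauchy_Schwarz[of "s _ - l" f] s(1) l(1) f by (simp add: ip_simps)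
      show "(\<lambda>n. nrm (s n - l) * nrm f) \<longlonglongrightarrow> 0"
        using tendsto_mult_left_zero[OF l(2)] by simp
    qed
    then have lim: "(\<lambda>n. Re (ip (s n) f)) \<longlonglongrightarrow> Re (ip l f)"
      by (intro tendsto_Re) (simp add: LIM_zero_iff)
    have "(\<lambda>n. 2 * t * (Re (ip (s n) f) - Re (p f)) + t\<^sup>2 * (nrm f)\<^sup>2 + 1 / Suc n) \<longlonglongrightarrow>
        2 * t * (Re (ip l f) - Re (p f)) + t\<^sup>2 * (nrm f)\<^sup>2 + 0"
      using LIMSEQ_inverse_real_of_nat by (intro tendsto_intros lim) (simp add: divide_inverse)
    moreover have "0 \<le> 2 * t * (Re (ip (s n) f) - Re (p f)) + t\<^sup>2 * (nrm f)\<^sup>2 + 1 / Suc n" for n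
    proof -
      have "m \<le> J (s n + t *\<^sub>R f)" using s(1) f by (intro m_le mem)
      also have "\<dots> = J (s n) + (t\<^sup>2 * (nrm f)\<^sup>2 - 2 * t * Re (p f)) + 2 * t * Re (ip (s n) f)"
        using s(1) f by (simp add: J_plus J_scale ip_simps)
      finally show ?thesis using s(2)[of n] by (simp add: algebra_simps)
    qed
    ultimately show ?thesis by (intro LIMSEQ_le_const) (auto simp: algebra_simps)
  qed
  have Re0: "Re (ip l f - p f) = 0" if f: "f \<in> H" for f
  proof (rule ccontr)
    define a where "a = Re (ip l f - p f)"
    \<comment> \<open>At t = -a/b the linear term beats the quadratic one; the added 1 keeps b
      positive when f = 0.\<close>
    define b where "b = (nrm f)\<^sup>2 + 1"
    assume "Re (ip l f - p f) \<noteq> 0"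
    then have a: "a \<noteq> 0" by (simp add: a_def)
    have b: "0 < b" "(nrm f)\<^sup>2 < b" by (auto simp: b_def add_nonneg_pos)
    have "0 \<le> 2 * (- a / b) * a + (- a / b)\<^sup>2 * (nrm f)\<^sup>2"
      using key[OF f, of "- a / b"] by (simp only: a_def)
    also have "(- a / b)\<^sup>2 * (nrm f)\<^sup>2 \<le> (- a / b)\<^sup>2 * b" using b by (intro mult_left_mono) auto
    also have "2 * (- a / b) * a + (- a / b)\<^sup>2 * b = - (a\<^sup>2 / b)"
      using b by (simp add: field_simps power2_eq_square)
    finally have "a\<^sup>2 / b \<le> 0" by simp
    then show False using a b by (simp add: divide_le_0_iff)
  qed
  have "p f = ip f l" if f: "f \<in> H" for f
  proof (rule complex_eqI)
    show "Re (p f) = Re (ip f l)" using Re0[OF f] ip_commute[OF f l(1)] by simp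
    \<comment> \<open>Up to sign, the imaginary part at f is the real part at i f.\<close>
    have "Re (ip l (cscale \<i> f) - p (cscale \<i> f)) = 0" using f by (intro Re0 mem)
    then show "Im (p f) = Im (ip f l)" using f l(1) ip_commute[OF f l(1)] by (simp add: ip_simps scale)
  qed
  then show ?thesis using l(1) by blast
qed

end

section \<open>Unitary-invariant forms\<close>

lemma unitary_on_comp:
  assumes "unitary_on H ip S" "unitary_on H ip T" shows "unitary_on H ip (S \<circ> T)"
proof -
  have T: "T f \<in> H" if "f \<in> H" for f
    using assms(2) that by (auto simp: unitary_on_def bij_betw_def)
  show ?thesis
    unfolding unitary_on_def
  proof (intro conjI)
    show "bij_betw (S \<circ> T) H H"
      using assms bij_betw_trans unfolding unitary_on_def by blast
  qed (use assms T in \<open>simp_all add: unitary_on_def\<close>)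
qed

context function_inner_space
begin

text \<open>The reflection in the hyperplane orthogonal to a; for a = 0 the quotient is 0 and the
  map is the identity. Reflections and phases do the work of orthonormal bases below, also in
  infinite dimension.\<close>

definition householder :: "('a \<Rightarrow> complex) \<Rightarrow> ('a \<Rightarrow> complex) \<Rightarrow> 'a \<Rightarrow> complex" where
  "householder a f = f - cscale (2 * ip f a / ip a a) a"

lemma householder_orthogonal: "ip f a = 0 \<Longrightarrow> householder a f = f"
  by (simp add: householder_def)

lemma householder_self: "a \<in> H \<Longrightarrow> householder a a = - a"
proof -
  assume a: "a \<in> H"
  show ?thesis
  proof (cases "a = 0")
    case False
    then have "ip a a \<noteq> 0" using positive[OF a] by auto
    then show ?thesis by (simp add: householder_def cscale_def fun_eq_iff)
  qed (simp add: householder_def)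
qed

lemma unitary_householder:
  assumes a: "a \<in> H" shows "unitary_on H ip (householder a)"
proof (cases "a = 0")
  case True
  then have "householder a = id" by (intro ext) (simp add: householder_def)
  then show ?thesis by (simp add: unitary_on_def)
next
  case False
  then have nz: "ip a a \<noteq> 0" using positive[OF a] by auto
  have cnj_aa: "cnj (ip a a) = ip a a" using ip_commute[OF a a] by simp
  have in_H: "householder a f \<in> H" if "f \<in> H" for f
    using that a by (simp add: householder_def mem)
  have inv: "householder a (householder a f) = f" if "f \<in> H" for f
  proof -
    have "ip (householder a f) a = - ip f a"
      using that a nz by (simp add: householder_def ip_simps)
    then show ?thesis by (simp add: householder_def[of a "householder a f"])
        (simp add: householder_def cscale_def fun_eq_iff)
  qed
  show ?thesis
    unfolding unitary_on_def
  proof (intro conjI ballI allI)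
    show "bij_betw (householder a) H H"
      by (rule bij_betwI[of _ _ _ "householder a"]) (auto simp: in_H inv)
    show "householder a (f + g) = householder a f + householder a g" if "f \<in> H" "g \<in> H" for f g
      using that a by (simp add: householder_def ip_simps cscale_def fun_eq_iff add_divide_distrib algebra_simps)
    show "householder a (cscale c f) = cscale c (householder a f)" if "f \<in> H" for c f
      using that a by (simp add: householder_def ip_simps) (simp add: cscale_def fun_eq_iff algebra_simps)
    show "ip (householder a f) (householder a g) = ip f g" if "f \<in> H" "g \<in> H" for f g
    proof -
      have "cnj (ip g a) = ip a g" using ip_commute[OF that(2) a] by simp
      then show ?thesis
        using that a nz by (simp add: householder_def ip_simps cnj_aa field_simps)
    qed
  qed
qed

lemma unitary_cscale:
  assumes "norm c = 1" shows "unitary_on H ip (cscale c)"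
proof -
  have c: "c * cnj c = 1" "cnj c * c = 1"
    using complex_norm_square[of c] assms by (auto simp: mult.commute)
  show ?thesis
    unfolding unitary_on_def
  proof (intro conjI ballI allI)
    show "bij_betw (cscale c) H H"
      using c by (intro bij_betwI[of _ _ _ "cscale (cnj c)"]) (auto simp: mem)
    show "ip (cscale c f) (cscale c g) = ip f g" if "f \<in> H" "g \<in> H" for f g
      using c that by (simp add: ip_simps mult.assoc[symmetric])
  qed (simp_all add: cscale_add mult.commute)
qed

text \<open>The reflection along f - g exchanges vectors of equal norm only if 2 <f, f - g> = ||f -
  g||^2, which requires <f, g> to be real; a phase on g arranges this.\<close>

lemma ex_phase_real_ip:
  assumes "f \<in> H" "g \<in> H"
  obtains c where "norm c = 1" "ip f (cscale c g) \<in> \<real>"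
proof
  define c where "c = (if ip f g = 0 then 1 else sgn (ip f g))"
  show "norm c = 1" by (simp add: c_def norm_sgn)
  have "cnj c * ip f g = of_real (norm (ip f g))"
    using complex_norm_square[of "ip f g"]
    by (auto simp: c_def sgn_eq field_simps power2_eq_square)
  then show "ip f (cscale c g) \<in> \<real>" using assms by (simp add: ip_simps)
qed

text \<open>The reflection along f - g', where g' is g with the right phase, takes f to g'; the
  conjugate phase then leads from g' to g.\<close>

lemma ex_unitary_transport:
  assumes f: "f \<in> H" and g: "g \<in> H" and eq: "nrm f = nrm g"
  obtains T where "unitary_on H ip T" "T f = g"
proof -
  obtain c where c: "norm c = 1" "ip f (cscale c g) \<in> \<real>" using ex_phase_real_ip[OF f g] .
  define g' where "g' = cscale c g"
  have g': "g' \<in> H" "nrm g' = nrm f" using g c eq by (simp_all add: g'_def mem nrm_cscale)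
  have sym: "ip g' f = ip f g'"
    using ip_commute[OF f g'(1)] c(2) by (simp add: g'_def Reals_cnj_iff)
  have "householder (f - g') f = g'"
  proof (cases "f = g'")
    case True
    then show ?thesis by (simp add: householder_def)
  next
    case False
    have "2 * ip f (f - g') = ip (f - g') (f - g')"
      using f g' by (simp add: ip_simps sym ip_self[OF f] ip_self[OF g'(1)])
    moreover have "ip (f - g') (f - g') \<noteq> 0"
      using positive[of "f - g'"] f g' False by (auto simp: mem)
    ultimately show ?thesis by (simp add: householder_def)
  qed
  then have "(cscale (cnj c) \<circ> householder (f - g')) f = g"
    using complex_norm_square[of c] c(1) by (simp add: g'_def mult.commute)
  moreover have "unitary_on H ip (cscale (cnj c) \<circ> householder (f - g'))"
    using f g' c by (intro unitary_on_comp unitary_cscale unitary_householder mem) auto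
  ultimately show ?thesis using that by blast
qed

text \<open>
  The stabilizer of \<open>g\<close> acts on the orthogonal complement of \<open>g\<close> as a full unitary group, so the form
  is a multiple of the inner product there, and it does not couple the complement with \<open>g\<close>.
  If the complement is trivial, there is no unit vector \<open>e'\<close> in it and \<open>e' = 0\<close> is used instead.
\<close>

lemma unitary_invariant_form:
  assumes inv: "\<And>T g f h. unitary_on H ip T \<Longrightarrow> g \<in> H - {0} \<Longrightarrow> f \<in> H \<Longrightarrow> h \<in> H \<Longrightarrow> \<sigma> (T g) (T f) (T h) = \<sigma> g f h"
    and herm: "\<And>g. g \<in> H - {0} \<Longrightarrow> hermitean_form_on cscale H (\<sigma> g)"
    and e: "e \<in> H" "nrm e = 1"
    and e': "e' \<in> H" "ip e' e = 0" "nrm e' = 1 \<or> (\<forall>f\<in>H. ip f e = 0 \<longrightarrow> f = 0)"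
    and g: "g \<in> H" "g \<noteq> 0" and f: "f \<in> H" and h: "h \<in> H"
  defines "\<phi> \<equiv> \<lambda>t. Re (\<sigma> (sqrt t *\<^sub>R e) e' e')"
    and "\<theta> \<equiv> \<lambda>t. Re (\<sigma> (sqrt t *\<^sub>R e) e e)"
    and "t \<equiv> (nrm g)\<^sup>2"
  shows "\<sigma> g f h = of_real (\<phi> t) * ip f h + of_real ((\<theta> t - \<phi> t) / t) * ip f g * ip g h"
proof -
  define s where "s = \<sigma> g"
  have gH: "g \<in> H - {0}" using g by simp
  have s_form: "hermitean_form_on cscale H s" unfolding s_def by (rule herm[OF gH])
  have s_add: "s (u + v) w = s u w + s v w" "s w (u + v) = s w u + s w v" if "u \<in> H" "v \<in> H" "w \<in> H" for u v w
    using s_form that unfolding hermitean_form_on_def by blast+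
  have s_cscale: "s (cscale c u) v = c * s u v" "s u (cscale c v) = cnj c * s u v" if "u \<in> H" "v \<in> H" for c u v
    using s_form that unfolding hermitean_form_on_def by blast+
  have s_cnj: "s v u = cnj (s u v)" if "u \<in> H" "v \<in> H" for u v
    using s_form that unfolding hermitean_form_on_def by blast
  have s_zero: "s 0 u = 0" "s u 0 = 0" if "u \<in> H" for u
    using s_cscale[of 0 u 0] s_cscale[of u 0 0] that by auto
  have s_uminus: "s (- u) v = - s u v" "s u (- v) = - s u v" if "u \<in> H" "v \<in> H" for u v
    using s_cscale[OF that, of "-1"] by (simp_all add: uminus_eq_cscale)
  have s_diff: "s w (u - v) = s w u - s w v" if "u \<in> H" "v \<in> H" "w \<in> H" for u v w
    using s_add(2)[of u "- v" w] s_uminus(2)[of w v] that by (simp add: mem)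
  \<comment> \<open>The reflection along u fixes g and v and negates u, so invariance gives s u v =
    - s u v.\<close>
  have s_orth: "s u v = 0" if u: "u \<in> H" "ip u g = 0" and v: "v \<in> H" "ip v u = 0" for u v
  proof -
    have "ip g u = 0" using ip_commute[OF u(1) g(1)] u(2) by simp
    then have "s (- u) v = s u v"
      using inv[OF unitary_householder[OF u(1)] gH u(1) v(1)] v(2) u(1)
      by (simp add: householder_orthogonal householder_self s_def)
    then show ?thesis using u v by (simp add: s_uminus)
  qed
  \<comment> \<open>If v' has the norm of u and a real inner product with u, then u + v' and u - v'
    are orthogonal. Expanding s (u + v') (u - v') = 0 gives s u u = s v' v' up to a purely imaginary
    term, and both sides are real.\<close>
  have s_norm: "s u u = s v v" if u: "u \<in> H" "ip u g = 0" and v: "v \<in> H" "ip v g = 0" and eq: "nrm u = nrm v" for u v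
  proof -
    obtain c where c: "norm c = 1" "ip u (cscale c v) \<in> \<real>" using ex_phase_real_ip[OF u(1) v(1)] .
    define v' where "v' = cscale c v"
    have v': "v' \<in> H" "ip v' g = 0" "nrm v' = nrm u"
      using v c eq g by (simp_all add: v'_def ip_simps nrm_cscale)
    have sym: "ip v' u = ip u v'"
      using ip_commute[OF u(1) v'(1)] c(2) by (simp add: v'_def Reals_cnj_iff)
    have "s (u + v') (u - v') = 0"
      using u v' g by (intro s_orth mem) (simp_all add: ip_simps sym ip_self[OF u(1)] ip_self[OF v'(1)])
    then have "s u u + s v' u = s u v' + s v' v'"
      using u v' by (simp add: s_add(1) s_diff mem)
    then have "Re (s u u) = Re (s v' v')" using s_cnj[OF u(1) v'(1)] by (simp add: complex_eq_iff)
    moreover have "s v' v' = s v v"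
      using v c complex_norm_square[of c] by (simp add: v'_def s_cscale mem mult.assoc[symmetric] mult.commute[of "cnj c"])
    ultimately show ?thesis using s_cnj[OF u(1) u(1)] s_cnj[OF v(1) v(1)] by (simp add: complex_eq_iff)
  qed
  have t: "0 < t" using nrm_pos[OF g] by (simp add: t_def)
  \<comment> \<open>The point of the reference ray with the same norm as g; T carries the values of
    the metric there to the values at g.\<close>
  define g0 where "g0 = sqrt t *\<^sub>R e"
  have g0: "g0 \<in> H" "nrm g0 = nrm g" using e g by (simp_all add: g0_def nrm_scaleR mem t_def)
  then have g00: "g0 \<in> H - {0}" using nrm_pos[OF g] by auto
  obtain T where T: "unitary_on H ip T" "T g0 = g" using ex_unitary_transport[OF g0(1) g(1) g0(2)] .
  have T_ip: "ip (T u) (T v) = ip u v" "T u \<in> H" if "u \<in> H" "v \<in> H" for u v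
    using T(1) that by (auto simp: unitary_on_def bij_betw_def)
  define u where "u = T e'"
  have u: "u \<in> H" "ip u g = 0"
  proof -
    show "u \<in> H" using T_ip e' by (simp add: u_def)
    show "ip u g = 0"
      using T_ip[of e' g0] e' e g0 unfolding T(2) u_def by (simp add: g0_def ip_simps)
  qed
  have suu: "s u u = of_real (\<phi> t)"
  proof -
    have "s u u = \<sigma> g0 e' e'"
      using inv[OF T(1) g00 e'(1) e'(1)] unfolding T(2) s_def u_def .
    then show ?thesis using s_cnj[OF u(1) u(1)] by (simp add: \<phi>_def g0_def complex_eq_iff)
  qed
  have perp_self: "s v v = of_real (\<phi> t) * ip v v" if v: "v \<in> H" "ip v g = 0" for v
  proof (cases "nrm e' = 1")
    case True
    have nu: "nrm u = 1" using T_ip[of e' e'] e'(1) True by (simp add: u_def hnorm_def)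
    have "s v v = s (nrm v *\<^sub>R u) (nrm v *\<^sub>R u)"
      using u v g nu by (intro s_norm) (simp_all add: ip_simps nrm_scaleR)
    also have "\<dots> = of_real (\<phi> t) * ip v v"
      using u v by (simp add: scaleR_eq_cscale[of _ u] s_cscale mem suu ip_self power2_eq_square)
    finally show ?thesis .
  next
    case False
    have "v = 0"
    proof -
      \<comment> \<open>Triviality is given for the complement of e, so v is first moved there by a
        unitary map taking g to g0.\<close>
      obtain S where S: "unitary_on H ip S" "S g = g0" using ex_unitary_transport[OF g(1) g0(1)] g0(2) by metis
      have S_ip: "ip (S u) (S v) = ip u v" "S u \<in> H" if "u \<in> H" "v \<in> H" for u v
        using S(1) that by (auto simp: unitary_on_def bij_betw_def)
      have "ip (S v) g0 = 0" using S_ip[OF v(1) g(1)] v(2) S(2) by simp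
      then have "ip (S v) e = 0" using S_ip[OF v(1) v(1)] e t by (simp add: g0_def ip_simps)
      then have "S v = 0" using e'(3) False S_ip[OF v(1) v(1)] by blast
      then have "nrm v = 0" using S_ip[OF v(1) v(1)] by (simp add: hnorm_def ip_zero_left)
      then show ?thesis using nrm_eq_0[OF v(1)] by simp
    qed
    then show ?thesis using g by (simp add: s_zero ip_simps)
  qed
  have perp: "s v w = of_real (\<phi> t) * ip v w" if v: "v \<in> H" "ip v g = 0" and w: "w \<in> H" "ip w g = 0" for v w
  proof (cases "w = 0")
    case True
    then show ?thesis using v by (simp add: s_zero ip_simps)
  next
    case False
    \<comment> \<open>In place of polarization, v is split into a multiple of w and a vector
      orthogonal to w, which \<open>s_orth\<close> uncouples from w.\<close>
    define a where "a = ip v w / ip w w"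
    have nz: "ip w w \<noteq> 0" using positive[OF w(1) False] by auto
    define v' where "v' = v - cscale a w"
    have v': "v' \<in> H" "ip v' g = 0" "ip v' w = 0"
      using v w g nz by (simp_all add: v'_def ip_simps a_def)
    have "ip w v' = 0" using ip_commute[OF v'(1) w(1)] v'(3) by simp
    then have "s v' w = 0" using s_orth[OF v'(1,2) w(1)] by simp
    moreover have "v = v' + cscale a w" by (simp add: v'_def)
    ultimately have "s v w = a * s w w" using v' w by (simp add: s_add s_cscale mem)
    also have "\<dots> = of_real (\<phi> t) * ip v w" using perp_self[OF w] nz by (simp add: a_def)
    finally show ?thesis .
  qed
  have sgg: "s g g = of_real (t * \<theta> t)"
  proof -
    have "s g g = \<sigma> g0 g0 g0"
      using inv[OF T(1) g00 g0(1) g0(1)] unfolding T(2) s_def .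
    also have "\<dots> = of_real t * \<sigma> g0 e e"
    proof -
      have sc: "\<sigma> g0 (cscale c v) w = c * \<sigma> g0 v w" "\<sigma> g0 v (cscale c w) = cnj c * \<sigma> g0 v w"
        if "v \<in> H" "w \<in> H" for c v w
        using herm[OF g00] that unfolding hermitean_form_on_def by blast+
      have "\<sigma> g0 g0 g0 = \<sigma> g0 (cscale (of_real (sqrt t)) e) (cscale (of_real (sqrt t)) e)"
        by (simp add: g0_def scaleR_eq_cscale)
      also have "\<dots> = of_real (sqrt t * sqrt t) * \<sigma> g0 e e"
        using e by (simp only: sc mem complex_cnj_complex_of_real of_real_mult mult.assoc)
      finally show ?thesis using t by simp
    qed
    also have "\<sigma> g0 e e = of_real (\<theta> t)"
    proof -
      have "\<sigma> g0 e e = cnj (\<sigma> g0 e e)"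
        using herm[OF g00] e unfolding hermitean_form_on_def by blast
      then have "Im (\<sigma> g0 e e) = 0" by (metis Reals_cnj_iff complex_is_Real_iff)
      then show ?thesis by (simp add: \<theta>_def g0_def complex_eq_iff)
    qed
    finally show ?thesis by simp
  qed
  have igg: "ip g g = of_real t" using ip_self[OF g(1)] by (simp add: t_def)
  \<comment> \<open>Components along g and orthogonal to g; the cross terms vanish by
    \<open>s_orth\<close>. What s has along g beyond \<phi> times the inner product becomes the
    coefficient (\<theta> - \<phi>)/t.\<close>
  define a b f' h' where "a = ip f g / of_real t" and "b = ip h g / of_real t"
    and "f' = f - cscale a g" and "h' = h - cscale b g"
  have f': "f' \<in> H" "ip f' g = 0" and h': "h' \<in> H" "ip h' g = 0"
    using f h g t by (simp_all add: f'_def h'_def a_def b_def ip_simps igg)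
  have gh': "ip g h' = 0" "ip g f' = 0" using ip_commute h' f' g by (metis complex_cnj_zero)+
  have feq: "f = cscale a g + f'" and heq: "h = cscale b g + h'" by (simp_all add: f'_def h'_def)
  have s0: "s f' g = 0" "s h' g = 0"
    using s_orth[OF f' g(1)] s_orth[OF h' g(1)] gh' by auto
  then have s1: "s g h' = 0" using s_cnj[OF h'(1) g(1)] by simp
  have "s f h = a * cnj b * s g g + s f' h'"
    using g f' h' by (simp add: feq heq s_add s_cscale mem s0 s1)
  also have "s f' h' = of_real (\<phi> t) * ip f' h'" by (rule perp[OF f' h'])
  also have "ip f' h' = ip f h - a * cnj b * of_real t"
    using g f' h' by (simp add: feq heq ip_simps gh' igg)
  also have "cnj b = ip g h / of_real t"
    using ip_commute[OF h g(1)] by (simp add: b_def)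
  finally show ?thesis
    using t unfolding sgg a_def by (simp add: s_def field_simps)
qed

end

section \<open>The dual space\<close>

lemma hilbert_function_space_inner:
  assumes "hilbert_function_space A F ip" shows "function_inner_space F ip"
  using assms unfolding hilbert_function_space_def by unfold_locales blast+

locale dual_hilbert_space =
  fixes A :: "'a set" and F :: "('a \<Rightarrow> complex) set" and ip
  assumes hilbert: "hilbert_function_space A F ip"
begin

sublocale F: function_inner_space F ip
  using hilbert by (rule hilbert_function_space_inner)

abbreviation "dual \<equiv> dual_space F ip"
abbreviation "dip \<equiv> dual_ip F ip"
abbreviation "star \<equiv> hstar F ip"

lemma star_add: "g \<in> F \<Longrightarrow> h \<in> F \<Longrightarrow> star (g + h) = star g + star h"
  by (auto simp: hstar_def fun_eq_iff F.ip_simps)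

lemma star_cscale: "h \<in> F \<Longrightarrow> star (cscale c h) = cscale (cnj c) (star h)"
  by (intro ext) (simp add: hstar_def cscale_def[of "cnj c"] F.ip_simps)

lemma star_diff: "g \<in> F \<Longrightarrow> h \<in> F \<Longrightarrow> star (g - h) = star g - star h"
  by (auto simp: hstar_def fun_eq_iff F.ip_simps)

lemma star_scaleR: "h \<in> F \<Longrightarrow> star (r *\<^sub>R h) = r *\<^sub>R star h"
  by (simp add: scaleR_eq_cscale star_cscale)

lemma star_inject: "g \<in> F \<Longrightarrow> h \<in> F \<Longrightarrow> star g = star h \<longleftrightarrow> g = h"
proof
  assume gh: "g \<in> F" "h \<in> F" "star g = star h"
  then have "ip (g - h) g = ip (g - h) h"
    by (auto simp: hstar_def fun_eq_iff F.mem dest: spec[of _ "g - h"])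
  then have "ip (g - h) (g - h) = 0" using gh by (simp add: F.ip_diff_right F.mem)
  then show "g = h" using F.positive[of "g - h"] gh by (auto simp: F.mem)
qed simp

lemma star_mem: "h \<in> F \<Longrightarrow> star h \<in> dual"
  unfolding dual_space_def mem_Collect_eq
proof (intro conjI)
  assume h: "h \<in> F"
  have "\<forall>f\<in>F. norm (star h f) \<le> F.nrm h * F.nrm f"
    using F.Cauchy_Schwarz[OF _ h] by (simp add: hstar_def mult.commute)
  then show "\<exists>C. \<forall>f\<in>F. norm (star h f) \<le> C * F.nrm f" ..
qed (auto simp: hstar_def F.ip_simps)

lemma riesz_star: "h \<in> F \<Longrightarrow> riesz F ip (star h) = h"
  unfolding riesz_def by (rule the_equality) (auto simp: star_inject)

lemma ex_star: assumes "p \<in> dual" obtains h where "h \<in> F" "p = star h"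
proof -
  from assms obtain C where p: "\<And>f. f \<notin> F \<Longrightarrow> p f = 0"
    "\<And>f g. f \<in> F \<Longrightarrow> g \<in> F \<Longrightarrow> p (f + g) = p f + p g"
    "\<And>c f. f \<in> F \<Longrightarrow> p (cscale c f) = c * p f"
    "\<And>f. f \<in> F \<Longrightarrow> norm (p f) \<le> C * F.nrm f"
    unfolding dual_space_def by blast
  have "\<exists>h\<in>F. \<forall>f\<in>F. p f = ip f h"
    using hilbert unfolding hilbert_function_space_def
    by (intro F.Riesz_representation[of p C] p) auto
  then obtain h where "h \<in> F" "p = star h" using p(1) by (auto simp: hstar_def fun_eq_iff)
  then show ?thesis by (rule that)
qed

lemma dip_star: "g \<in> F \<Longrightarrow> h \<in> F \<Longrightarrow> dip (star g) (star h) = ip h g"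
  by (simp add: dual_ip_def riesz_star)

lemma dual_nrm_star: "h \<in> F \<Longrightarrow> hnorm dip (star h) = F.nrm h"
  by (simp add: hnorm_def dip_star)

lemma star_zero: "star 0 = 0"
  by (auto simp: hstar_def fun_eq_iff F.ip_simps)

text \<open>By Riesz representation every functional is \<open>star g\<close> for some g in F, so
  each axiom is an identity in F; the conjugate-linearity of \<open>star\<close> is offset by the
  exchange of arguments in \<open>dip_star\<close>.\<close>

sublocale D: function_inner_space dual dip
proof
  show "0 \<in> dual" using star_mem[of 0] by (simp add: star_zero)
  show add: "p + q \<in> dual" if pq: "p \<in> dual" "q \<in> dual" for p q
  proof -
    obtain g h where "g \<in> F" "p = star g" "h \<in> F" "q = star h" using ex_star pq by metis
    then show ?thesis using star_mem[of "g + h"] by (simp add: star_add F.mem)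
  qed
  show scale: "cscale c p \<in> dual" if p: "p \<in> dual" for c p
  proof -
    obtain g where "g \<in> F" "p = star g" using ex_star p by metis
    then show ?thesis using star_mem[of "cscale (cnj c) g"] by (simp add: star_cscale F.mem)
  qed
  show "0 < Re (dip p p)" if p: "p \<in> dual" "p \<noteq> 0" for p
  proof -
    obtain g where "g \<in> F" "p = star g" using ex_star p(1) by metis
    moreover from this have "g \<noteq> 0" using p(2) star_zero by auto
    ultimately show ?thesis using F.positive by (simp add: dip_star)
  qed
  show "hermitean_form_on cscale dual dip"
    unfolding hermitean_form_on_def
  proof (intro conjI ballI allI)
    fix p q r assume "p \<in> dual" "q \<in> dual" "r \<in> dual"
    then obtain f g h where "f \<in> F" "p = star f" "g \<in> F" "q = star g" "h \<in> F" "r = star h"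
      using ex_star by metis
    then show "dip (p + q) r = dip p r + dip q r" "dip r (p + q) = dip r p + dip r q"
      by (simp_all add: star_add[symmetric] dip_star F.ip_simps)
  next
    fix c p q assume "p \<in> dual" "q \<in> dual"
    then obtain f g where fg: "f \<in> F" "p = star f" "g \<in> F" "q = star g" using ex_star by metis
    have "cscale c (star f) = star (cscale (cnj c) f)" "cscale c (star g) = star (cscale (cnj c) g)"
      using fg by (simp_all add: star_cscale)
    then show "dip (cscale c p) q = c * dip p q" "dip p (cscale c q) = cnj c * dip p q"
      using fg by (simp_all add: dip_star F.ip_simps)
    show "dip q p = cnj (dip p q)"
      using fg F.ip_commute[OF fg(3,1)] by (simp add: dip_star)
  qed
qed

end

section \<open>Smoothness of the coefficient functions\<close>

text \<open>On the real line a k-linear map is a number times the product of its arguments, so a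
  tower of ordinary derivatives carries the same information as the multilinear derivatives in
  \<open>smooth_wrt\<close>.\<close>

definition smooth_halfline :: "(real \<Rightarrow> real) \<Rightarrow> bool" where
  "smooth_halfline f \<longleftrightarrow> (\<exists>d. d 0 = f \<and> (\<forall>k::nat. \<forall>t>0. (d k has_real_derivative d (Suc k) t) (at t)))"

lemma smooth_on_halfline:
  assumes "smooth_halfline f" shows "smooth_on {0<..} f"
proof -
  obtain d where d: "d 0 = f" "\<And>k t. 0 < t \<Longrightarrow> (d k has_real_derivative d (Suc k) t) (at t)"
    using assms unfolding smooth_halfline_def by blast
  define D where "D t vs = d (length vs) t * prod_list vs" for t and vs :: "real list"
  have norm_prod: "norm (prod_list vs) = prod_list (map norm vs)" for vs :: "real list"
    by (induction vs) (simp_all add: abs_mult)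
  show ?thesis
    unfolding smooth_wrt_def
  proof (intro exI[of _ D] conjI ballI allI impI)
    show "D x [] = f x" for x by (simp add: D_def d(1))
    show "bounded_multilinear_on norm UNIV (D x)" for x
      unfolding bounded_multilinear_on_def
    proof (intro conjI allI impI)
      fix k
      show "\<exists>C. \<forall>vs. length vs = k \<longrightarrow> set vs \<subseteq> UNIV \<longrightarrow> norm (D x vs) \<le> C * prod_list (map norm vs)"
        by (intro exI[of _ "norm (d k x)"]) (auto simp: D_def norm_prod[symmetric] abs_mult)
    qed (auto simp: D_def algebra_simps)
    fix k and x \<epsilon> :: real
    assume x: "x \<in> {0<..}" and \<epsilon>: "0 < \<epsilon>"
    have "((\<lambda>y. (d k y - d k x) / (y - x)) \<longlongrightarrow> d (Suc k) x) (at x)"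
      using d(2)[of x k] x by (simp add: has_field_derivative_iff)
    then have "\<forall>\<^sub>F y in at x. dist ((d k y - d k x) / (y - x)) (d (Suc k) x) < \<epsilon>"
      using \<epsilon> by (rule tendstoD)
    then obtain \<delta> where \<delta>: "0 < \<delta>" "\<And>y. y \<noteq> x \<Longrightarrow> dist y x < \<delta> \<Longrightarrow> dist ((d k y - d k x) / (y - x)) (d (Suc k) x) < \<epsilon>"
      unfolding eventually_at by auto
    have key: "\<bar>d k y - d k x - d (Suc k) x * (y - x)\<bar> \<le> \<epsilon> * \<bar>y - x\<bar>" if "\<bar>y - x\<bar> < \<delta>" for y
    proof (cases "y = x")
      case False
      then have "\<bar>(d k y - d k x) / (y - x) - d (Suc k) x\<bar> * \<bar>y - x\<bar> \<le> \<epsilon> * \<bar>y - x\<bar>"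
        using \<delta>(2)[of y] that by (intro mult_right_mono) (auto simp: dist_real_def)
      moreover have "d k y - d k x - d (Suc k) x * (y - x) = ((d k y - d k x) / (y - x) - d (Suc k) x) * (y - x)"
        using False by (simp add: field_simps)
      ultimately show ?thesis by (simp add: abs_mult)
    qed auto
    show "\<exists>\<delta>>0. \<forall>y\<in>{0<..}. norm (y - x) < \<delta> \<longrightarrow> (\<forall>vs. length vs = k \<longrightarrow> set vs \<subseteq> UNIV \<longrightarrow>
        norm (D y vs - D x vs - D x ((y - x) # vs)) \<le> \<epsilon> * norm (y - x) * prod_list (map norm vs))"
    proof (intro exI[of _ \<delta>] conjI ballI allI impI \<delta>(1))
      fix y and vs :: "real list" assume y: "norm (y - x) < \<delta>" and vs: "length vs = k"
      have "D y vs - D x vs - D x ((y - x) # vs) = (d k y - d k x - d (Suc k) x * (y - x)) * prod_list vs"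
        using vs by (simp add: D_def algebra_simps)
      also have "norm \<dots> = \<bar>d k y - d k x - d (Suc k) x * (y - x)\<bar> * prod_list (map norm vs)"
        by (simp add: abs_mult flip: norm_prod)
      also have "\<dots> \<le> \<epsilon> * norm (y - x) * prod_list (map norm vs)"
        using key[of y] y by (intro mult_right_mono) (auto simp flip: norm_prod)
      finally show "norm (D y vs - D x vs - D x ((y - x) # vs)) \<le> \<epsilon> * norm (y - x) * prod_list (map norm vs)" .
    qed
  qed
qed

text \<open>Reduces smoothness to finding a set of functions closed under differentiation, which
  spares a formula for the k-th derivative.\<close>

lemma smooth_halfline_coinduct:
  assumes "f \<in> S" and S: "\<And>f. f \<in> S \<Longrightarrow> \<exists>f'\<in>S. \<forall>t>0. (f has_real_derivative f' t) (at t)"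
  shows "smooth_halfline f"
proof -
  obtain d' where d': "\<And>f. f \<in> S \<Longrightarrow> d' f \<in> S" "\<And>f t. f \<in> S \<Longrightarrow> 0 < t \<Longrightarrow> (f has_real_derivative d' f t) (at t)"
    using S by metis
  have "(d' ^^ k) f \<in> S" for k using \<open>f \<in> S\<close> d'(1) by (induction k) auto
  then show ?thesis
    unfolding smooth_halfline_def using d'(2) by (intro exI[of _ "\<lambda>k. (d' ^^ k) f"]) auto
qed

text \<open>Differentiating \<open>d\<^sub>k(\<surd>t) (\<surd>t)\<^sup>m\<close> stays within the span of functions of this form.\<close>

inductive_set sqrt_span :: "(real \<Rightarrow> real) set \<Rightarrow> (real \<Rightarrow> real) set" for B where
  base: "f \<in> B \<Longrightarrow> (\<lambda>t. c * f (sqrt t) * sqrt t powi m) \<in> sqrt_span B"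
| add: "f \<in> sqrt_span B \<Longrightarrow> g \<in> sqrt_span B \<Longrightarrow> (\<lambda>t. f t + g t) \<in> sqrt_span B"

lemma smooth_halfline_sqrt_span:
  assumes B: "\<And>f. f \<in> B \<Longrightarrow> \<exists>f'\<in>B. \<forall>t>0. (f has_real_derivative f' t) (at t)"
    and f: "f \<in> sqrt_span B"
  shows "smooth_halfline f"
  using f
proof (rule smooth_halfline_coinduct)
  fix f assume "f \<in> sqrt_span B"
  then show "\<exists>f'\<in>sqrt_span B. \<forall>t>0. (f has_real_derivative f' t) (at t)"
  proof induction
    case (base f c m)
    then obtain f' where f': "f' \<in> B" "\<And>t. 0 < t \<Longrightarrow> (f has_real_derivative f' t) (at t)" using B by metis
    \<comment> \<open>The inner derivative 1/(2 sqrt t) lowers the exponent by one in both terms,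
      and the power rule lowers it once more in the second. Integer exponents make room for negative
      powers.\<close>
    let ?g = "\<lambda>t. (c/2) * f' (sqrt t) * sqrt t powi (m - 1) + (c * of_int m / 2) * f (sqrt t) * sqrt t powi (m - 2)"
    have "?g \<in> sqrt_span B" using base f' by (intro sqrt_span.intros)
    moreover have "((\<lambda>t. c * f (sqrt t) * sqrt t powi m) has_real_derivative ?g t) (at t)" if t: "0 < t" for t
    proof -
      have s: "0 < sqrt t" using t by simp
      have sq: "(sqrt has_real_derivative inverse (sqrt t) / 2) (at t)" using t by (rule DERIV_real_sqrt)
      have 1: "((\<lambda>t. f (sqrt t)) has_real_derivative f' (sqrt t) * (inverse (sqrt t) / 2)) (at t)"
        by (rule DERIV_chain2[OF f'(2)[OF s] sq])
      have 2: "((\<lambda>t. sqrt t powi m) has_real_derivative of_int m * sqrt t powi (m - 1) * (inverse (sqrt t) / 2)) (at t)"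
        using sq s by (intro DERIV_power_int) auto
      have p1: "sqrt t powi (m - 1) = sqrt t powi m * inverse (sqrt t)"
        "sqrt t powi (m - 2) = sqrt t powi (m - 1) * inverse (sqrt t)"
        using s power_int_diff[of "sqrt t" m 1] power_int_diff[of "sqrt t" "m - 1" 1]
        by (simp_all add: divide_inverse)
      have "((\<lambda>t. c * (f (sqrt t) * sqrt t powi m)) has_real_derivative
         c * (f' (sqrt t) * (inverse (sqrt t) / 2) * sqrt t powi m + of_int m * sqrt t powi (m - 1) * (inverse (sqrt t) / 2) * f (sqrt t))) (at t)"
        using DERIV_mult[OF 1 2] by (intro DERIV_cmult)
      moreover have "c * (f' (sqrt t) * (inverse (sqrt t) / 2) * sqrt t powi m + of_int m * sqrt t powi (m - 1) * (inverse (sqrt t) / 2) * f (sqrt t)) = ?g t"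
      proof -
        have "c * (a * (i / 2) * p + n * (p * i) * (i / 2) * b) =
            (c/2) * a * (p * i) + (c * n / 2) * b * (p * i * i)" for a b n p i :: real
          by algebra
        then show ?thesis unfolding p1(2) unfolding p1(1) .
      qed
      ultimately show ?thesis by (simp only: mult.assoc)
    qed
    ultimately show ?case by (intro bexI[where x = ?g] allI impI)
  next
    case (add f g)
    then obtain f' g' where "f' \<in> sqrt_span B" "g' \<in> sqrt_span B"
      "\<forall>t>0. (f has_real_derivative f' t) (at t)" "\<forall>t>0. (g has_real_derivative g' t) (at t)" by blast
    then show ?case
      by (intro bexI[of _ "\<lambda>t. f' t + g' t"] sqrt_span.add) (auto intro: DERIV_add)
  qed
qed

section \<open>Unitary-invariant metrics along a ray\<close>

text \<open>The ray is an affine curve of constant velocity E = (e, 0, 0), so the k-th derivative of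
  the metric along it is the multilinear derivative applied to k copies of E. As E has
  \<open>norm3\<close> equal to 1, the estimate in \<open>smooth_wrt\<close> becomes the scalar
  one.\<close>

lemma (in function_inner_space) smooth_metric_along_ray:
  assumes smooth: "smooth_wrt (norm3 nrm) (H \<times> H \<times> H) ((H - {0}) \<times> H \<times> H) (\<lambda>(x, u, v). \<sigma> x u v)"
    and e: "e \<in> H" "nrm e = 1" and u: "u \<in> H"
  obtains d :: "nat \<Rightarrow> real \<Rightarrow> real" where "\<And>s. 0 < s \<Longrightarrow> d 0 s = Re (\<sigma> (s *\<^sub>R e) u u)"
    "\<And>k s. 0 < s \<Longrightarrow> (d k has_real_derivative d (Suc k) s) (at s)"
proof -
  let ?V = "H \<times> H \<times> H" and ?S = "(H - {0}) \<times> H \<times> H"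
  obtain D where D: "(\<forall>x\<in>?S. D x [] = (case x of (x, u, v) \<Rightarrow> \<sigma> x u v)) \<and>
      (\<forall>x\<in>?S. bounded_multilinear_on (norm3 nrm) ?V (D x)) \<and>
      (\<forall>k. \<forall>x\<in>?S. \<forall>\<epsilon>>0. \<exists>\<delta>>0. \<forall>y\<in>?S. norm3 nrm (y - x) < \<delta> \<longrightarrow>
        (\<forall>vs. length vs = k \<longrightarrow> set vs \<subseteq> ?V \<longrightarrow>
          norm (D y vs - D x vs - D x ((y - x) # vs)) \<le> \<epsilon> * norm3 nrm (y - x) * prod_list (map (norm3 nrm) vs)))"
    using smooth unfolding smooth_wrt_def by (elim exE) (rule that)
  note D0 = D[THEN conjunct1, THEN bspec] and Dm = D[THEN conjunct2, THEN conjunct1, THEN bspec]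
    and Dd = D[THEN conjunct2, THEN conjunct2, THEN spec, THEN bspec, THEN spec, THEN mp]
  define E where "E = (e, 0 :: 'a \<Rightarrow> complex, 0 :: 'a \<Rightarrow> complex)"
  define p where "p s = (s *\<^sub>R e, u, u)" for s
  define d where "d k s = Re (D (p s) (replicate k E))" for k s
  have E: "E \<in> ?V" "norm3 nrm E = 1" using e by (simp_all add: E_def norm3_def)
  have p: "p s \<in> ?S" if "0 < s" for s
  proof -
    have "nrm (s *\<^sub>R e) \<noteq> 0" using e that by (simp add: nrm_scaleR)
    then show ?thesis using e u by (auto simp: p_def mem)
  qed
  have pdiff: "p y - p s = (y - s) *\<^sub>R E" for y s
    by (simp add: p_def E_def scaleR_diff_left zero_prod_def)
  have npdiff: "norm3 nrm (p y - p s) = \<bar>y - s\<bar>" for y s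
    using e by (simp add: pdiff E_def norm3_def nrm_scaleR)
  have "(d k has_real_derivative d (Suc k) s) (at s)" if s: "0 < s" for k s
    unfolding has_field_derivative_iff
  proof (rule tendstoI)
    fix \<epsilon> :: real assume "0 < \<epsilon>"
    \<comment> \<open>Halving turns the non-strict estimate of \<open>smooth_wrt\<close> into the
      strict one required of a limit.\<close>
    then have "0 < \<epsilon>/2" by simp
    from Dd[OF p[OF s] this, of k] obtain \<delta> where \<delta>: "0 < \<delta>" and est: "\<And>y vs. y \<in> ?S \<Longrightarrow> norm3 nrm (y - p s) < \<delta> \<Longrightarrow> length vs = k \<Longrightarrow> set vs \<subseteq> ?V \<Longrightarrow>
        norm (D y vs - D (p s) vs - D (p s) ((y - p s) # vs)) \<le> \<epsilon>/2 * norm3 nrm (y - p s) * prod_list (map (norm3 nrm) vs)"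
      by (elim exE conjE) (rule that, assumption, blast)
    have prl: "prod_list (map (norm3 nrm) (replicate k E)) = 1" using E by (simp add: prod_list_replicate map_replicate)
    have "dist ((d k y - d k s) / (y - s)) (d (Suc k) s) < \<epsilon>" if y: "y \<noteq> s" "dist y s < min \<delta> s" for y
    proof -
      have y0: "0 < y" using y(2) by (auto simp: dist_real_def abs_if split: if_splits)
      have scale: "D (p s) ((y - s) *\<^sub>R E # replicate k E) = (y - s) *\<^sub>R D (p s) (replicate (Suc k) E)"
      proof -
        have "set [] \<subseteq> ?V" "set (replicate k E) \<subseteq> ?V" using E by (auto simp: set_replicate_conv_if)
        then have "\<forall>r. \<forall>u\<in>?V. D (p s) ([] @ r *\<^sub>R u # replicate k E) = r *\<^sub>R D (p s) ([] @ u # replicate k E)"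
          using Dm[OF p[OF s]] unfolding bounded_multilinear_on_def by blast
        from this[THEN spec, THEN bspec, OF E(1), of "y - s"] show ?thesis by simp
      qed
      have "norm (D (p y) (replicate k E) - D (p s) (replicate k E) - D (p s) ((p y - p s) # replicate k E)) \<le> \<epsilon>/2 * \<bar>y - s\<bar> * 1"
        using est[OF p[OF y0], of "replicate k E"] y(2) E unfolding prl npdiff
        by (auto simp: set_replicate_conv_if dist_real_def)
      then have "norm (D (p y) (replicate k E) - D (p s) (replicate k E) - (y - s) *\<^sub>R D (p s) (replicate (Suc k) E)) \<le> \<epsilon>/2 * \<bar>y - s\<bar>"
        unfolding pdiff scale by simp
      then have "\<bar>Re (D (p y) (replicate k E) - D (p s) (replicate k E) - (y - s) *\<^sub>R D (p s) (replicate (Suc k) E))\<bar> \<le> \<epsilon>/2 * \<bar>y - s\<bar>"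
        using abs_Re_le_cmod order_trans by blast
      then have "\<bar>d k y - d k s - (y - s) * d (Suc k) s\<bar> \<le> \<epsilon>/2 * \<bar>y - s\<bar>" by (simp add: d_def)
      then have "\<bar>d k y - d k s - (y - s) * d (Suc k) s\<bar> / \<bar>y - s\<bar> \<le> \<epsilon>/2" using y by (simp add: divide_le_eq)
      moreover have "(d k y - d k s) / (y - s) - d (Suc k) s = (d k y - d k s - (y - s) * d (Suc k) s) / (y - s)"
        using y by (simp add: field_simps)
      ultimately have "\<bar>(d k y - d k s) / (y - s) - d (Suc k) s\<bar> \<le> \<epsilon>/2" by (simp add: abs_divide)
      then show ?thesis using \<open>0 < \<epsilon>\<close> by (simp add: dist_real_def)
    qed
    then show "\<forall>\<^sub>F y in at s. dist ((d k y - d k s) / (y - s)) (d (Suc k) s) < \<epsilon>"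
      using \<delta> s unfolding eventually_at by (intro exI[of _ "min \<delta> s"]) auto
  qed
  moreover have "d 0 s = Re (\<sigma> (s *\<^sub>R e) u u)" if "0 < s" for s
    using D0[OF p[OF that]] by (simp add: d_def p_def)
  ultimately show ?thesis using that by blast
qed

text \<open>The coefficients are read off on the ray of e: \<phi> from the value at e', and \<psi> =
  (\<theta> - \<phi>)/t from the values at e and e'. Both values are smooth in s = sqrt t, and
  dividing by s^2 is harmless for s > 0.\<close>

proposition (in function_inner_space) unitary_invariant_metric_classification:
  assumes uim: "unitary_invariant_metric H ip \<sigma>" and nontrivial: "e0 \<in> H" "e0 \<noteq> 0"
  obtains \<phi> \<psi> :: "real \<Rightarrow> real" where "smooth_on {0<..} \<phi>" "smooth_on {0<..} \<psi>"
    "\<And>g f h. g \<in> H \<Longrightarrow> g \<noteq> 0 \<Longrightarrow> f \<in> H \<Longrightarrow> h \<in> H \<Longrightarrow>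
      \<sigma> g f h = of_real (\<phi> ((nrm g)\<^sup>2)) * ip f h + of_real (\<psi> ((nrm g)\<^sup>2)) * ip f g * ip g h"
proof -
  have inv: "\<And>T g f h. unitary_on H ip T \<Longrightarrow> g \<in> H - {0} \<Longrightarrow> f \<in> H \<Longrightarrow> h \<in> H \<Longrightarrow> \<sigma> (T g) (T f) (T h) = \<sigma> g f h"
    using uim unfolding unitary_invariant_metric_def by blast
  have herm: "\<And>g. g \<in> H - {0} \<Longrightarrow> hermitean_form_on cscale H (\<sigma> g)"
    and smooth: "smooth_wrt (norm3 nrm) (H \<times> H \<times> H) ((H - {0}) \<times> H \<times> H) (\<lambda>(x, u, v). \<sigma> x u v)"
    using uim unfolding unitary_invariant_metric_def hermitean_metric_on_def by blast+
  have normalize: "nrm (inverse (nrm f) *\<^sub>R f) = 1" if "f \<in> H" "f \<noteq> 0" for f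
    using that nrm_pos[OF that] by (simp add: nrm_scaleR)
  define e where "e = inverse (nrm e0) *\<^sub>R e0"
  have e: "e \<in> H" "nrm e = 1" using nontrivial normalize by (simp_all add: e_def mem)
  obtain e' where e': "e' \<in> H" "ip e' e = 0" "nrm e' = 1 \<or> (\<forall>f\<in>H. ip f e = 0 \<longrightarrow> f = 0)"
  proof (cases "\<forall>f\<in>H. ip f e = 0 \<longrightarrow> f = 0")
    case True
    then show ?thesis using that[of 0] e by (simp add: ip_zero_left)
  next
    case False
    then obtain f where f: "f \<in> H" "ip f e = 0" "f \<noteq> 0" by blast
    then show ?thesis using that[of "inverse (nrm f) *\<^sub>R f"] normalize[OF f(1,3)] e by (simp add: ip_simps)
  qed
  obtain d1 where d1: "\<And>s. 0 < s \<Longrightarrow> d1 0 s = Re (\<sigma> (s *\<^sub>R e) e' e')"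
    "\<And>k s. 0 < s \<Longrightarrow> (d1 k has_real_derivative d1 (Suc k) s) (at s)"
    using smooth_metric_along_ray[OF smooth e e'(1)] by blast
  obtain d2 where d2: "\<And>s. 0 < s \<Longrightarrow> d2 0 s = Re (\<sigma> (s *\<^sub>R e) e e)"
    "\<And>k s. 0 < s \<Longrightarrow> (d2 k has_real_derivative d2 (Suc k) s) (at s)"
    using smooth_metric_along_ray[OF smooth e e(1)] by blast
  define B where "B = range d1 \<union> range d2"
  have B: "\<exists>f'\<in>B. \<forall>t>0. (f has_real_derivative f' t) (at t)" if "f \<in> B" for f
    using that d1(2) d2(2) unfolding B_def by blast
  \<comment> \<open>The trivial factors give \<phi> and \<psi> literally the shape of the rules of
    \<open>sqrt_span\<close>; the exponent -2 is the division by t.\<close>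
  define \<phi> where "\<phi> t = 1 * d1 0 (sqrt t) * sqrt t powi 0" for t
  define \<psi> where "\<psi> t = 1 * d2 0 (sqrt t) * sqrt t powi (-2) + (-1) * d1 0 (sqrt t) * sqrt t powi (-2)" for t
  have "\<phi> \<in> sqrt_span B" "\<psi> \<in> sqrt_span B"
    unfolding \<phi>_def[abs_def] \<psi>_def[abs_def] by (intro sqrt_span.intros; simp add: B_def)+
  then have smooth': "smooth_on {0<..} \<phi>" "smooth_on {0<..} \<psi>"
    by (auto intro!: smooth_on_halfline smooth_halfline_sqrt_span[OF B])
  have "\<sigma> g f h = of_real (\<phi> ((nrm g)\<^sup>2)) * ip f h + of_real (\<psi> ((nrm g)\<^sup>2)) * ip f g * ip g h"
    if g: "g \<in> H" "g \<noteq> 0" and fh: "f \<in> H" "h \<in> H" for g f h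
  proof -
    have t: "0 < (nrm g)\<^sup>2" "sqrt ((nrm g)\<^sup>2) = nrm g" "0 < nrm g" using nrm_pos[OF g] by auto
    have "\<phi> ((nrm g)\<^sup>2) = Re (\<sigma> (sqrt ((nrm g)\<^sup>2) *\<^sub>R e) e' e')"
      using t d1(1)[of "nrm g"] by (simp add: \<phi>_def)
    moreover have "\<psi> ((nrm g)\<^sup>2) = (Re (\<sigma> (sqrt ((nrm g)\<^sup>2) *\<^sub>R e) e e) - Re (\<sigma> (sqrt ((nrm g)\<^sup>2) *\<^sub>R e) e' e')) / (nrm g)\<^sup>2"
      using t d1(1)[of "nrm g"] d2(1)[of "nrm g"]
      by (simp add: \<psi>_def power_int_minus divide_inverse algebra_simps)
    moreover have "\<sigma> g f h = of_real (Re (\<sigma> (sqrt ((nrm g)\<^sup>2) *\<^sub>R e) e' e')) * ip f h +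
        of_real ((Re (\<sigma> (sqrt ((nrm g)\<^sup>2) *\<^sub>R e) e e) - Re (\<sigma> (sqrt ((nrm g)\<^sup>2) *\<^sub>R e) e' e')) / (nrm g)\<^sup>2)
          * ip f g * ip g h"
    proof (rule unitary_invariant_form[OF _ _ e e' g fh])
      show "\<sigma> (T g) (T f) (T h) = \<sigma> g f h" if "unitary_on H ip T" "g \<in> H - {0}" "f \<in> H" "h \<in> H" for T g f h
        using inv that .
      show "hermitean_form_on cscale H (\<sigma> g)" if "g \<in> H - {0}" for g using herm that .
    qed
    ultimately show ?thesis by (simp only:)
  qed
  then show ?thesis using smooth' that by blast
qed

section \<open>Local boundedness of the kernel functions\<close>

lemma bounded_on_compact_if_locally_bounded:
  fixes N :: "'a::metric_space \<Rightarrow> real"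
  assumes S: "compact S" and loc: "\<And>x. x \<in> S \<Longrightarrow> \<exists>r>0. \<exists>B. \<forall>y\<in>ball x r. N y \<le> B"
  obtains B where "\<And>y. y \<in> S \<Longrightarrow> N y \<le> B"
proof -
  obtain r B where rB: "\<And>x. x \<in> S \<Longrightarrow> 0 < r x" "\<And>x y. x \<in> S \<Longrightarrow> y \<in> ball x (r x) \<Longrightarrow> N y \<le> B x"
    using loc by metis
  have "S \<subseteq> (\<Union>x\<in>S. ball x (r x))"
  proof
    fix x assume "x \<in> S" then show "x \<in> (\<Union>x\<in>S. ball x (r x))" using rB(1) by (intro UN_I) auto
  qed
  then obtain T where T: "T \<subseteq> S" "finite T" "S \<subseteq> (\<Union>x\<in>T. ball x (r x))"
    using compactE_image[OF S, of S "\<lambda>x. ball x (r x)"] by auto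
  have "N y \<le> Max (insert 0 (B ` T))" if y: "y \<in> S" for y
  proof -
    obtain x where x: "x \<in> T" "y \<in> ball x (r x)" using T(3) y by blast
    then have "N y \<le> B x" using rB(2) T(1) by blast
    also have "\<dots> \<le> Max (insert 0 (B ` T))" using x T(2) by (intro Max_ge) auto
    finally show ?thesis .
  qed
  then show ?thesis by (rule that)
qed

section \<open>Holomorphy on complex lines and planes in the domain\<close>

lemma bounded_linear_vector_smult: "bounded_linear (\<lambda>z. z *s (a :: complex^'n))"
proof -
  have "linear (\<lambda>z. z *s a)"
    by (intro linearI) (simp_all add: vec_eq_iff algebra_simps)
  then show ?thesis by (simp add: linear_conv_bounded_linear)
qed

lemma has_field_derivative_along_line:
  assumes f: "holomorphic_several_on f X" and z: "x + z *s a \<in> X"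
  shows "\<exists>d. ((\<lambda>z. f (x + z *s a)) has_field_derivative d) (at z)"
proof -
  obtain D where D: "(f has_derivative D) (at (x + z *s a))" "\<And>c v. D (c *s v) = c * D v"
    using f z unfolding holomorphic_several_on_def by blast
  have "((\<lambda>z. x + z *s a) has_derivative (\<lambda>h. 0 + h *s a)) (at z)"
    by (intro has_derivative_add has_derivative_const bounded_linear_imp_has_derivative bounded_linear_vector_smult)
  from has_derivative_compose[OF this D(1)]
  have "((\<lambda>z. f (x + z *s a)) has_derivative (\<lambda>h. D a * h)) (at z)"
    by (simp add: D(2) mult.commute)
  then show ?thesis unfolding has_field_derivative_def by (intro exI[of _ "D a"]) 
qed

lemma holomorphic_on_along_line:
  assumes f: "holomorphic_several_on f X" and S: "\<And>z. z \<in> S \<Longrightarrow> x + z *s a \<in> X"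
  shows "(\<lambda>z. f (x + z *s a)) holomorphic_on S"
  unfolding holomorphic_on_def field_differentiable_def
  using has_field_derivative_along_line[OF f S] by (blast intro: DERIV_subset)

lemma holomorphic_on_along_scaled_line:
  assumes f: "holomorphic_several_on f X" and S: "\<And>z. z \<in> S \<Longrightarrow> x + (c * z) *s a \<in> X"
  shows "(\<lambda>z. f (x + (c * z) *s a)) holomorphic_on S"
proof -
  have eq: "(c * z) *s a = z *s (c *s a)" for z by (simp add: vec_eq_iff mult_ac)
  show ?thesis using holomorphic_on_along_line[OF f, of S x "c *s a"] S unfolding eq by blast
qed

lemma holomorphic_several_on_add:
  assumes "holomorphic_several_on f X" "holomorphic_several_on g X"
  shows "holomorphic_several_on (f + g) X"
  unfolding holomorphic_several_on_def
proof
  fix x assume "x \<in> X"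
  then obtain D E where "(f has_derivative D) (at x)" "\<And>c v. D (c *s v) = c * D v"
    "(g has_derivative E) (at x)" "\<And>c v. E (c *s v) = c * E v"
    using assms unfolding holomorphic_several_on_def by metis
  then show "\<exists>D. (f + g has_derivative D) (at x) \<and> (\<forall>c v. D (c *s v) = c * D v)"
    unfolding plus_fun_def
    by (intro exI[of _ "\<lambda>v. D v + E v"]) (auto intro: has_derivative_add simp: algebra_simps)
qed

lemma holomorphic_several_on_cscale:
  assumes "holomorphic_several_on f X"
  shows "holomorphic_several_on (cscale b f) X"
  unfolding holomorphic_several_on_def
proof
  fix x assume "x \<in> X"
  then obtain D where "(f has_derivative D) (at x)" "\<And>c v. D (c *s v) = c * D v"
    using assms unfolding holomorphic_several_on_def by metis
  then show "\<exists>D. (cscale b f has_derivative D) (at x) \<and> (\<forall>c v. D (c *s v) = c * D v)"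
    unfolding cscale_def
    by (intro exI[of _ "\<lambda>v. b * D v"]) (auto intro: has_derivative_mult_right simp: algebra_simps)
qed

lemma open_contains_bidisc:
  fixes X :: "(complex^'n) set"
  assumes "open X" "x \<in> X"
  obtains r where "0 < r" "\<And>z w. norm z < r \<Longrightarrow> norm w < r \<Longrightarrow> x + z *s a + w *s b \<in> X"
proof -
  obtain e where e: "0 < e" "ball x e \<subseteq> X" using assms open_contains_ball by blast
  obtain A where A: "0 < A" "\<And>z. norm (z *s a) \<le> norm z * A"
    using bounded_linear.pos_bounded[OF bounded_linear_vector_smult[of a]] by blast
  obtain B where B: "0 < B" "\<And>z. norm (z *s b) \<le> norm z * B"
    using bounded_linear.pos_bounded[OF bounded_linear_vector_smult[of b]] by blast
  define r where "r = e / (A + B)"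
  have r: "0 < r" using e A B by (simp add: r_def)
  have "x + z *s a + w *s b \<in> X" if "norm z < r" "norm w < r" for z w
  proof -
    have "norm (z *s a + w *s b) \<le> norm z * A + norm w * B"
      by (intro norm_triangle_le add_mono A B)
    also have "\<dots> < r * A + r * B"
      using that A B by (intro add_strict_mono mult_strict_right_mono) auto
    also have "\<dots> = r * (A + B)" by (rule distrib_left[symmetric])
    also have "\<dots> = e" using A(1) B(1) by (simp add: r_def)
    finally have "norm (z *s a + w *s b) < e" .
    moreover have "dist x (x + z *s a + w *s b) = norm (z *s a + w *s b)"
      by (metis add.assoc dist_norm add_diff_cancel_left' dist_commute)
    ultimately have "x + z *s a + w *s b \<in> ball x e" by simp
    then show ?thesis using e by blast
  qed
  with r show ?thesis by (rule that)
qed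

section \<open>Kernel functions and holomorphic members of the RKHS\<close>

locale rkhs_domain =
  fixes X :: "(complex^'n) set" and K F ip
  assumes open_X: "open X" and sesqui: "sesqui_holomorphic_on K X"
    and nondegenerate: "nondegenerate_on K X" and rkhs: "is_rkhs X K F ip"
begin

sublocale dual_hilbert_space X F ip
  using rkhs by unfold_locales (simp add: is_rkhs_def)

abbreviation "k \<equiv> kernel_section X K"

lemma k_mem [simp]: "x \<in> X \<Longrightarrow> k x \<in> F"
  and reproducing: "f \<in> F \<Longrightarrow> x \<in> X \<Longrightarrow> ip f (k x) = f x"
  using rkhs by (auto simp: is_rkhs_def)

lemma K_eq_ip: "x \<in> X \<Longrightarrow> y \<in> X \<Longrightarrow> K x y = ip (k y) (k x)"
  by (simp add: reproducing) (simp add: kernel_section_def)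

lemma nrm_k_power2: "x \<in> X \<Longrightarrow> (F.nrm (k x))\<^sup>2 = Re (K x x)"
  by (simp add: F.nrm_power2 K_eq_ip)

lemma nrm_k_pos: "x \<in> X \<Longrightarrow> 0 < F.nrm (k x)"
  using nondegenerate nrm_k_power2[of x] F.nrm_nonneg[of "k x"]
  by (force simp: nondegenerate_on_def diag_def order_le_less)

definition FH where "FH = {f \<in> F. holomorphic_several_on f X}"

lemma FH_F: "f \<in> FH \<Longrightarrow> f \<in> F"
  and FH_hol: "f \<in> FH \<Longrightarrow> holomorphic_several_on f X"
  by (simp_all add: FH_def)

lemma FH_add: "f \<in> FH \<Longrightarrow> g \<in> FH \<Longrightarrow> f + g \<in> FH"
  by (simp add: FH_def F.mem holomorphic_several_on_add)

lemma FH_cscale: "f \<in> FH \<Longrightarrow> cscale c f \<in> FH"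
  by (simp add: FH_def F.mem holomorphic_several_on_cscale)

lemma FH_diff: "f \<in> FH \<Longrightarrow> g \<in> FH \<Longrightarrow> f - g \<in> FH"
  using FH_add[of f "- g"] FH_cscale[of g "-1"] by (simp add: uminus_eq_cscale[of g, symmetric])

lemma k_FH: "x \<in> X \<Longrightarrow> k x \<in> FH"
  unfolding FH_def holomorphic_several_on_def
proof (intro CollectI conjI ballI)
  fix y assume xy: "x \<in> X" "y \<in> X"
  then obtain D where D: "((\<lambda>x'. K x' x) has_derivative D) (at y)" "\<forall>c v. D (c *s v) = c * D v"
    using sesqui unfolding sesqui_holomorphic_on_def holomorphic_several_on_def by blast
  have "(k x has_derivative D) (at y)"
    by (rule has_derivative_transform_within_open[OF D(1) open_X xy(2)]) (simp add: kernel_section_def)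
  with D(2) show "\<exists>D. (k x has_derivative D) (at y) \<and> (\<forall>c v. D (c *s v) = c * D v)" by blast
qed simp

text \<open>Take f = u in the hypothesis. The point is that only tests with holomorphic f are
  demanded, for which Cauchy estimates are available.\<close>

lemma nrm_le_by_FH:
  assumes "u \<in> FH" "0 \<le> c" and le: "\<And>f. f \<in> FH \<Longrightarrow> norm (ip f u) \<le> c * F.nrm f"
  shows "F.nrm u \<le> c"
proof (cases "u = 0")
  case False
  then have pos: "0 < F.nrm u" using F.nrm_pos FH_F assms(1) by blast
  have "(F.nrm u)\<^sup>2 \<le> c * F.nrm u"
    using le[OF assms(1)] F.ip_self[OF FH_F[OF assms(1)]] by (simp add: norm_power)
  then show ?thesis using pos by (simp add: power2_eq_square)
qed (use assms in simp)

text \<open>Conjugating the second parameter makes G separately holomorphic, and the squared norm of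
  the kernel function is the value of G at (z, cnj z). The Hartogs bound is applied to this single
  function, hence the index type \<open>unit\<close>.\<close>

lemma kernel_bounded_on_line:
  assumes x: "x \<in> X"
  obtains r B where "0 < r" "\<And>z. norm z < r \<Longrightarrow> x + z *s a \<in> X" "\<And>z. norm z < r \<Longrightarrow> F.nrm (k (x + z *s a)) \<le> B"
proof -
  obtain s0 where s0: "0 < s0" "\<And>z w. norm z < s0 \<Longrightarrow> norm w < s0 \<Longrightarrow> x + z *s a + w *s a \<in> X"
    using open_contains_bidisc[OF open_X x, of a a] by metis
  \<comment> \<open>After this scaling the discs of radius 3 are mapped into X, so each slice is
    continuous, hence bounded, on the closed disc of radius 2.\<close>
  define s where "s = complex_of_real (s0 / 3)"
  have s: "norm s = s0 / 3" "cnj s = s" using s0 by (simp_all add: s_def)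
  have inX: "x + (s * z) *s a \<in> X" if "norm z < 3" for z
  proof -
    have "norm (s * z) < s0" using that s0 by (simp add: norm_mult s)
    then show ?thesis using s0(2)[of "s * z" 0] s0(1) by simp
  qed
  define y where "y z = x + (s * z) *s a" for z
  have yX: "y z \<in> X" if "norm z < 3" for z using inX that by (simp add: y_def)
  define G where "G p z w = K (y z) (y (cnj w))" for p :: unit and z w
  have holz: "(\<lambda>z. G p z w) holomorphic_on ball 0 3" if "norm w < 3" for p w
    unfolding G_def y_def
    using sesqui yX[of "cnj w"] that inX
    by (intro holomorphic_on_along_scaled_line[where f = "\<lambda>x'. K x' (x + (s * cnj w) *s a)" and X = X])
       (auto simp: sesqui_holomorphic_on_def y_def)
  have holw: "G p z holomorphic_on ball 0 3" if z: "norm z < 3" for p z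
  proof -
    have "(\<lambda>w. cnj (K (y z) (y w))) holomorphic_on ball 0 3"
      unfolding y_def using sesqui yX[of z] z inX
      by (intro holomorphic_on_along_scaled_line[where f = "\<lambda>y'. cnj (K (x + (s * z) *s a) y')" and X = X])
         (auto simp: sesqui_holomorphic_on_def y_def)
    moreover have "cnj ` ball 0 3 = ball 0 3"
    proof
      show "ball 0 3 \<subseteq> cnj ` ball 0 3"
      proof
        fix w :: complex assume "w \<in> ball 0 3"
        then show "w \<in> cnj ` ball 0 3" by (intro image_eqI[of _ _ "cnj w"]) auto
      qed
    qed auto
    ultimately have "cnj \<circ> (\<lambda>w. cnj (K (y z) (y w))) \<circ> cnj holomorphic_on ball 0 3"
      by (intro holomorphic_on_compose_cnj_cnj) auto
    then show ?thesis by (simp add: o_def G_def[abs_def])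
  qed
  have sub: "cball 0 2 \<subseteq> ball 0 (3::real)" "ball 0 2 \<subseteq> ball (0::complex) 3" "cball 0 2 \<subseteq> ball (0::complex) 3" by auto
  have bdd: "\<exists>C. \<forall>w\<in>ball 0 2. norm (f w) \<le> C" if f: "f holomorphic_on ball 0 3" for f :: "complex \<Rightarrow> complex"
  proof -
    have "compact (f ` cball 0 2)"
      using f sub(3) by (intro compact_continuous_image holomorphic_on_imp_continuous_on holomorphic_on_subset[OF f]) auto
    then have "bounded (f ` cball 0 2)" by (rule compact_imp_bounded)
    then obtain C where "\<forall>w\<in>cball 0 2. norm (f w) \<le> C" unfolding bounded_iff by auto
    then show ?thesis by (intro exI[of _ C]) auto
  qed
  obtain B where B: "\<And>p z w. p \<in> (UNIV :: unit set) \<Longrightarrow> norm z \<le> 1/4 \<Longrightarrow> norm w \<le> 1/2 \<Longrightarrow> norm (G p z w) \<le> B"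
  proof (rule hartogs_bounded[of UNIV G])
    show "(\<lambda>z. G p z w) holomorphic_on ball 0 2" if "norm w < 2" for p w
      using holz[of w p] that sub(2) by (auto intro: holomorphic_on_subset)
    show "G p z holomorphic_on ball 0 2" if "norm z < 2" for p z
      using holw[of z p] that sub(2) by (auto intro: holomorphic_on_subset)
    show "\<exists>C. \<forall>p\<in>UNIV. \<forall>w\<in>ball 0 2. norm (G p z w) \<le> C" if "norm z < 2" for z
      using bdd[OF holw[of z "()"]] that by simp
    show "\<exists>C. \<forall>p\<in>UNIV. \<forall>z\<in>ball 0 2. norm (G p z w) \<le> C" if "norm w < 2" for w
      using bdd[OF holz[of w "()"]] that by simp
  qed blast
  have "F.nrm (k (x + z *s a)) \<le> sqrt B" "x + z *s a \<in> X" if z: "norm z < s0 / 12" for z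
  proof -
    \<comment> \<open>As |s| = s0/3, the bound s0/12 on |z| means |w| < 1/4, where the Hartogs bound
      holds.\<close>
    define w where "w = z / s"
    have w: "norm w \<le> 1/4" using z s0 by (simp add: w_def norm_divide s divide_le_eq)
    have "s \<noteq> 0" using s0 by (simp add: s_def)
    then have yw: "y w = x + z *s a" by (simp add: y_def w_def)
    show X: "x + z *s a \<in> X" using yX[of w] w yw by simp
    have "norm (G () w (cnj w)) \<le> B" using w by (intro B) auto
    then have "Re (K (y w) (y w)) \<le> B"
      using complex_Re_le_cmod[of "K (y w) (y w)"] by (simp add: G_def)
    then have "(F.nrm (k (x + z *s a)))\<^sup>2 \<le> B" using nrm_k_power2[OF X] yw by simp
    then show "F.nrm (k (x + z *s a)) \<le> sqrt B" by (rule real_le_rsqrt)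
  qed
  then show ?thesis using s0(1) by (intro that[of "s0 / 12" "sqrt B"]) auto
qed

text \<open>The norm of \<open>k y\<close> is the largest value |f y| over the unit ball of
  \<open>FH\<close>, so it suffices to bound that family on the plane. Its slices lie on complex
  lines, where the norms of the kernel functions are already locally bounded.\<close>

lemma kernel_bounded_on_bidisc:
  assumes x: "x \<in> X"
  obtains r B where "0 < r" "\<And>z w. norm z < r \<Longrightarrow> norm w < r \<Longrightarrow> x + z *s a + w *s b \<in> X"
    "\<And>z w. norm z < r \<Longrightarrow> norm w < r \<Longrightarrow> F.nrm (k (x + z *s a + w *s b)) \<le> B"
proof -
  obtain s0 where s0: "0 < s0" "\<And>z w. norm z < s0 \<Longrightarrow> norm w < s0 \<Longrightarrow> x + z *s a + w *s b \<in> X"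
    using open_contains_bidisc[OF open_X x, of a b] by metis
  define s where "s = complex_of_real (s0 / 3)"
  have s: "norm s = s0 / 3" "s \<noteq> 0" using s0 by (simp_all add: s_def)
  define y where "y z w = x + (s * z) *s a + (s * w) *s b" for z w
  have yX: "y z w \<in> X" if "norm z < 3" "norm w < 3" for z w
    unfolding y_def using that s0 by (intro s0(2)) (simp_all add: norm_mult s)
  have y_w: "y z (w + h) = y z w + h *s (s *s b)" and y_z: "y (z + h) w = y z w + h *s (s *s a)" for z w h
    by (simp_all add: y_def vec_eq_iff algebra_simps)
  \<comment> \<open>With z fixed the point moves on a complex line; finitely many of the local
    bounds on lines cover the closed disc.\<close>
  have bound_w: "\<exists>C. \<forall>w\<in>ball 0 2. F.nrm (k (y z w)) \<le> C" if z: "norm z < 2" for z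
  proof -
    obtain C where C: "\<And>w. w \<in> cball 0 2 \<Longrightarrow> F.nrm (k (y z w)) \<le> C"
    proof (rule bounded_on_compact_if_locally_bounded[of "cball (0::complex) 2" "\<lambda>w. F.nrm (k (y z w))"])
      fix w :: complex assume "w \<in> cball 0 2"
      then have "y z w \<in> X" using z by (intro yX) auto
      then obtain r B where "0 < r" "\<And>h. norm h < r \<Longrightarrow> F.nrm (k (y z w + h *s (s *s b))) \<le> B"
        using kernel_bounded_on_line by metis
      then have rB: "0 < r" "\<And>h. norm h < r \<Longrightarrow> F.nrm (k (y z (w + h))) \<le> B" by (simp_all only: y_w)
      have "F.nrm (k (y z v)) \<le> B" if "v \<in> ball w r" for v
        using rB(2)[of "v - w"] that by (simp add: dist_norm norm_minus_commute)
      then show "\<exists>r>0. \<exists>B. \<forall>v\<in>ball w r. F.nrm (k (y z v)) \<le> B" using rB(1) by blast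
    qed auto
    then show ?thesis by (intro exI[of _ C]) auto
  qed
  have bound_z: "\<exists>C. \<forall>z\<in>ball 0 2. F.nrm (k (y z w)) \<le> C" if w: "norm w < 2" for w
  proof -
    obtain C where C: "\<And>z. z \<in> cball 0 2 \<Longrightarrow> F.nrm (k (y z w)) \<le> C"
    proof (rule bounded_on_compact_if_locally_bounded[of "cball (0::complex) 2" "\<lambda>z. F.nrm (k (y z w))"])
      fix z :: complex assume "z \<in> cball 0 2"
      then have "y z w \<in> X" using w by (intro yX) auto
      then obtain r B where "0 < r" "\<And>h. norm h < r \<Longrightarrow> F.nrm (k (y z w + h *s (s *s a))) \<le> B"
        using kernel_bounded_on_line by metis
      then have rB: "0 < r" "\<And>h. norm h < r \<Longrightarrow> F.nrm (k (y (z + h) w)) \<le> B" by (simp_all only: y_z)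
      have "F.nrm (k (y v w)) \<le> B" if "v \<in> ball z r" for v
        using rB(2)[of "v - z"] that by (simp add: dist_norm norm_minus_commute)
      then show "\<exists>r>0. \<exists>B. \<forall>v\<in>ball z r. F.nrm (k (y v w)) \<le> B" using rB(1) by blast
    qed auto
    then show ?thesis by (intro exI[of _ C]) auto
  qed
  define P where "P = {f \<in> FH. F.nrm f \<le> 1}"
  have P_le: "norm (f (y z w)) \<le> F.nrm (k (y z w))" if f: "f \<in> P" and zw: "norm z < 2" "norm w < 2" for f z w
  proof -
    have X: "y z w \<in> X" using zw by (intro yX) auto
    have "norm (f (y z w)) \<le> F.nrm f * F.nrm (k (y z w))"
      using F.Cauchy_Schwarz[of f "k (y z w)"] f X by (simp add: P_def FH_F reproducing)
    also have "\<dots> \<le> 1 * F.nrm (k (y z w))" using f X by (intro mult_right_mono) (auto simp: P_def)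
    finally show ?thesis by simp
  qed
  obtain B where B: "\<And>f z w. f \<in> P \<Longrightarrow> norm z \<le> 1/4 \<Longrightarrow> norm w \<le> 1/2 \<Longrightarrow> norm (f (y z w)) \<le> B"
  proof (rule hartogs_bounded[of P "\<lambda>f z w. f (y z w)"])
    show "(\<lambda>z. f (y z w)) holomorphic_on ball 0 2" if f: "f \<in> P" and w: "norm w < 2" for f w
    proof -
      have eq: "y z w = (x + (s * w) *s b) + (s * z) *s a" for z by (simp add: y_def)
      have "(x + (s * w) *s b) + (s * z) *s a \<in> X" if "z \<in> ball 0 2" for z
        using yX[of z w] w that by (simp add: eq)
      then show ?thesis
        unfolding eq using f by (intro holomorphic_on_along_scaled_line[of f X]) (auto simp: P_def FH_hol)
    qed
    show "(\<lambda>w. f (y z w)) holomorphic_on ball 0 2" if f: "f \<in> P" and z: "norm z < 2" for f z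
    proof -
      have "x + (s * z) *s a + (s * w) *s b \<in> X" if "w \<in> ball 0 2" for w
        using yX[of z w] z that by (simp add: y_def)
      then show ?thesis
        unfolding y_def using f by (intro holomorphic_on_along_scaled_line[of f X]) (auto simp: P_def FH_hol)
    qed
    show "\<exists>C. \<forall>f\<in>P. \<forall>w\<in>ball 0 2. norm (f (y z w)) \<le> C" if z: "norm z < 2" for z
    proof -
      obtain C where "\<And>w. w \<in> ball 0 2 \<Longrightarrow> F.nrm (k (y z w)) \<le> C" using bound_w[OF z] by blast
      then have "norm (f (y z w)) \<le> C" if "f \<in> P" "w \<in> ball 0 2" for f w
        using that z by (intro order_trans[OF P_le]) auto
      then show ?thesis by blast
    qed
    show "\<exists>C. \<forall>f\<in>P. \<forall>z\<in>ball 0 2. norm (f (y z w)) \<le> C" if w: "norm w < 2" for w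
    proof -
      obtain C where "\<And>z. z \<in> ball 0 2 \<Longrightarrow> F.nrm (k (y z w)) \<le> C" using bound_z[OF w] by blast
      then have "norm (f (y z w)) \<le> C" if "f \<in> P" "z \<in> ball 0 2" for f z
        using that w by (intro order_trans[OF P_le]) auto
      then show ?thesis by blast
    qed
  qed blast
  have "F.nrm (k (x + z *s a + w *s b)) \<le> B" "x + z *s a + w *s b \<in> X" if zw: "norm z < s0 / 12" "norm w < s0 / 12" for z w
  proof -
    have eq: "x + z *s a + w *s b = y (z / s) (w / s)" using s by (simp add: y_def)
    have n: "norm (z / s) \<le> 1/4" "norm (w / s) \<le> 1/4" using zw s0 by (simp_all add: norm_divide s divide_le_eq)
    let ?v = "y (z / s) (w / s)"
    have X: "?v \<in> X" using n by (intro yX) auto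
    then show "x + z *s a + w *s b \<in> X" by (simp add: eq)
    \<comment> \<open>The extremal member of the unit ball at this point: its value there is the
      norm of the kernel function.\<close>
    define f where "f = cscale (of_real (1 / F.nrm (k ?v))) (k ?v)"
    have "f \<in> P" using X nrm_k_pos[OF X] by (simp add: P_def f_def FH_cscale k_FH F.nrm_cscale norm_divide)
    then have "norm (f ?v) \<le> B" using n by (intro B) auto
    moreover have "f ?v = of_real (F.nrm (k ?v))"
    proof -
      have "k ?v ?v = of_real ((F.nrm (k ?v))\<^sup>2)"
        using reproducing[of "k ?v" ?v] F.ip_self[of "k ?v"] X by simp
      then show ?thesis using nrm_k_pos[OF X] by (simp add: f_def cscale_def power2_eq_square)
    qed
    ultimately show "F.nrm (k (x + z *s a + w *s b)) \<le> B" using nrm_k_pos[OF X] by (simp add: eq)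
  qed
  then show ?thesis using s0(1) by (intro that[of "s0 / 12" B]) auto
qed

end

section \<open>Directional derivatives of the kernel functions\<close>

lemma has_vector_derivative_quotient:
  fixes f :: "real \<Rightarrow> 'a::real_normed_vector"
  assumes "((\<lambda>t. (f t - f 0) /\<^sub>R t) \<longlongrightarrow> d) (at 0)"
  shows "(f has_vector_derivative d) (at 0)"
proof -
  have "((\<lambda>t. norm ((f t - f 0) /\<^sub>R t - d)) \<longlongrightarrow> 0) (at 0)"
    using assms by (simp add: LIM_zero tendsto_norm_zero)
  moreover have "\<forall>\<^sub>F t in at 0. norm ((f t - f 0) /\<^sub>R t - d) = norm (f t - f 0 - t *\<^sub>R d) / norm t"
    unfolding eventually_at_filter
  proof (rule always_eventually, intro allI impI)
    fix t :: real assume that: "t \<noteq> 0"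
    have "(f t - f 0) /\<^sub>R t - d = (f t - f 0 - t *\<^sub>R d) /\<^sub>R t"
      using that by (simp add: scaleR_diff_right)
    then show "norm ((f t - f 0) /\<^sub>R t - d) = norm (f t - f 0 - t *\<^sub>R d) / norm t"
      by (simp add: divide_inverse mult.commute)
  qed
  ultimately have "((\<lambda>t. norm (f t - f 0 - t *\<^sub>R d) / norm t) \<longlongrightarrow> 0) (at 0)"
    by (rule Lim_transform_eventually)
  then show ?thesis
    unfolding has_vector_derivative_def has_derivative_iff_norm
    by (simp add: bounded_linear_scaleR_left)
qed

section \<open>Norm derivatives of curves in an inner product space\<close>

context function_inner_space
begin

definition has_directional_limit :: "(real \<Rightarrow> 'a \<Rightarrow> complex) \<Rightarrow> ('a \<Rightarrow> complex) \<Rightarrow> bool" where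
  "has_directional_limit w d \<longleftrightarrow> (\<forall>\<^sub>F t in at 0. w t \<in> H) \<and> w 0 \<in> H \<and> d \<in> H \<and>
     ((\<lambda>t. nrm ((w t - w 0) /\<^sub>R t - d)) \<longlongrightarrow> 0) (at 0)"

lemma has_directional_limit_unique:
  assumes "\<forall>\<^sub>F t in at (0::real). q t \<in> H" "d \<in> H" "d' \<in> H"
    and "((\<lambda>t. nrm (q t - d)) \<longlongrightarrow> 0) (at 0)" "((\<lambda>t. nrm (q t - d')) \<longlongrightarrow> 0) (at 0)"
  shows "d = d'"
proof -
  have "((\<lambda>t. nrm (q t - d) + nrm (q t - d')) \<longlongrightarrow> 0 + 0) (at 0)" by (intro tendsto_add assms)
  moreover have "\<forall>\<^sub>F t in at 0. nrm (d - d') \<le> nrm (q t - d) + nrm (q t - d')"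
    using assms(1)
  proof eventually_elim
    case (elim t)
    then show ?case
      using nrm_triangle_diff[of d "q t" d'] nrm_minus_commute[of d "q t"] assms(2,3) by simp
  qed
  ultimately have "nrm (d - d') \<le> 0 + 0" by (intro tendsto_lowerbound) auto
  then have "nrm (d - d') = 0" using nrm_nonneg[OF diff_mem[OF assms(2,3)]] by simp
  then show ?thesis using nrm_eq_0[of "d - d'"] assms(2,3) by (simp add: mem)
qed

lemma has_directional_limit_continuous:
  assumes "has_directional_limit w d" shows "((\<lambda>t. nrm (w t - w 0)) \<longlongrightarrow> 0) (at 0)"
proof (rule Lim_null_comparison)
  have w: "\<forall>\<^sub>F t in at 0. w t \<in> H" "w 0 \<in> H" "d \<in> H" "((\<lambda>t. nrm ((w t - w 0) /\<^sub>R t - d)) \<longlongrightarrow> 0) (at 0)"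
    using assms by (auto simp: has_directional_limit_def)
  have ne: "\<forall>\<^sub>F t::real in at 0. t \<noteq> 0" by (simp add: eventually_at_filter)
  show "\<forall>\<^sub>F t in at 0. norm (nrm (w t - w 0)) \<le> \<bar>t\<bar> * (nrm ((w t - w 0) /\<^sub>R t - d) + nrm d)"
    using w(1) ne
  proof eventually_elim
    case (elim t)
    have "nrm ((w t - w 0) /\<^sub>R t) \<le> nrm ((w t - w 0) /\<^sub>R t - d) + nrm d"
      using nrm_triangle[of "(w t - w 0) /\<^sub>R t - d" d] elim w by (simp add: mem)
    moreover have "nrm ((w t - w 0) /\<^sub>R t) = nrm (w t - w 0) / \<bar>t\<bar>"
      using elim w by (simp add: nrm_scaleR mem divide_inverse mult.commute)
    ultimately show ?case using elim w by (simp add: mem divide_le_eq mult.commute)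
  qed
  have "((\<lambda>t. \<bar>t\<bar> * (nrm ((w t - w 0) /\<^sub>R t - d) + nrm d)) \<longlongrightarrow> \<bar>0\<bar> * (0 + nrm d)) (at 0)"
    by (intro tendsto_intros w)
  then show "((\<lambda>t. \<bar>t\<bar> * (nrm ((w t - w 0) /\<^sub>R t - d) + nrm d)) \<longlongrightarrow> 0) (at 0)" by simp
qed

lemma has_vector_derivative_ip_left:
  assumes w: "has_directional_limit w d" and g: "g \<in> H"
  shows "((\<lambda>t. ip (w t) g) has_vector_derivative ip d g) (at 0)"
proof (rule has_vector_derivative_quotient)
  have w: "\<forall>\<^sub>F t in at 0. w t \<in> H" "w 0 \<in> H" "d \<in> H" "((\<lambda>t. nrm ((w t - w 0) /\<^sub>R t - d)) \<longlongrightarrow> 0) (at 0)"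
    using w by (auto simp: has_directional_limit_def)
  have "((\<lambda>t. (ip (w t) g - ip (w 0) g) /\<^sub>R t - ip d g) \<longlongrightarrow> 0) (at 0)"
  proof (rule Lim_null_comparison)
    show "\<forall>\<^sub>F t in at 0. norm ((ip (w t) g - ip (w 0) g) /\<^sub>R t - ip d g) \<le> nrm ((w t - w 0) /\<^sub>R t - d) * nrm g"
      using w(1)
    proof eventually_elim
      case (elim t)
      have "ip ((w t - w 0) /\<^sub>R t - d) g = (ip (w t) g - ip (w 0) g) /\<^sub>R t - ip d g"
        using elim w g by (simp add: ip_simps scaleR_conv_of_real)
      then show ?case using Cauchy_Schwarz[of "(w t - w 0) /\<^sub>R t - d" g] elim w g by (simp add: mem)
    qed
    show "((\<lambda>t. nrm ((w t - w 0) /\<^sub>R t - d) * nrm g) \<longlongrightarrow> 0) (at 0)"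
      by (rule tendsto_mult_left_zero[OF w(4)])
  qed
  then show "((\<lambda>t. (ip (w t) g - ip (w 0) g) /\<^sub>R t) \<longlongrightarrow> ip d g) (at 0)" by (rule LIM_zero_cancel)
qed

text \<open>The product rule from <u t, w t> - <u 0, w 0> = <u t - u 0, w 0> + <u t, w t - w 0>. The
  factor u has only to be continuous in norm and differentiable when paired with the fixed vector w
  0, which is exactly what is shown later for the derivative of the kernel.\<close>

lemma has_vector_derivative_ip:
  assumes u: "\<forall>\<^sub>F t in at 0. u t \<in> H" "u 0 \<in> H" "((\<lambda>t. nrm (u t - u 0)) \<longlongrightarrow> 0) (at 0)"
    and w: "has_directional_limit w d"
    and s: "((\<lambda>t. ip (u t) (w 0)) has_vector_derivative s) (at 0)"
  shows "((\<lambda>t. ip (u t) (w t)) has_vector_derivative s + ip (u 0) d) (at 0)"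
proof (rule has_vector_derivative_quotient)
  have w: "\<forall>\<^sub>F t in at 0. w t \<in> H" "w 0 \<in> H" "d \<in> H" "((\<lambda>t. nrm ((w t - w 0) /\<^sub>R t - d)) \<longlongrightarrow> 0) (at 0)"
    using w by (auto simp: has_directional_limit_def)
  define Q where "Q t = (w t - w 0) /\<^sub>R t" for t
  have Q: "((\<lambda>t. nrm (Q t - d)) \<longlongrightarrow> 0) (at 0)" using w(4) by (simp add: Q_def)
  have "((\<lambda>t. ip (u t) (Q t) - ip (u 0) d) \<longlongrightarrow> 0) (at 0)"
  proof (rule Lim_null_comparison)
    show "\<forall>\<^sub>F t in at 0. norm (ip (u t) (Q t) - ip (u 0) d)
        \<le> nrm (u t - u 0) * (nrm (Q t - d) + nrm d) + nrm (u 0) * nrm (Q t - d)"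
      using w(1) u(1)
    proof eventually_elim
      case (elim t)
      have QH: "Q t \<in> H" using elim w by (simp add: Q_def mem)
      have eq: "ip (u t) (Q t) - ip (u 0) d = ip (u t - u 0) (Q t) + ip (u 0) (Q t - d)"
        using elim u w QH by (simp add: ip_simps)
      have "norm (ip (u t - u 0) (Q t)) \<le> nrm (u t - u 0) * nrm (Q t)"
        using elim u QH by (intro Cauchy_Schwarz mem)
      moreover have "nrm (u t - u 0) * nrm (Q t) \<le> nrm (u t - u 0) * (nrm (Q t - d) + nrm d)"
      proof (intro mult_left_mono)
        show "nrm (Q t) \<le> nrm (Q t - d) + nrm d" using nrm_triangle[OF diff_mem[OF QH w(3)] w(3)] by simp
        show "0 \<le> nrm (u t - u 0)" using elim u by (simp add: mem)
      qed
      moreover have "norm (ip (u 0) (Q t - d)) \<le> nrm (u 0) * nrm (Q t - d)"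
        using u QH w by (intro Cauchy_Schwarz mem)
      ultimately show ?case
        unfolding eq using norm_triangle_ineq[of "ip (u t - u 0) (Q t)" "ip (u 0) (Q t - d)"] by linarith
    qed
    have "((\<lambda>t. nrm (u t - u 0) * (nrm (Q t - d) + nrm d) + nrm (u 0) * nrm (Q t - d)) \<longlongrightarrow>
        0 * (0 + nrm d) + nrm (u 0) * 0) (at 0)"
      by (intro tendsto_intros u Q)
    then show "((\<lambda>t. nrm (u t - u 0) * (nrm (Q t - d) + nrm d) + nrm (u 0) * nrm (Q t - d)) \<longlongrightarrow> 0) (at 0)"
      by simp
  qed
  then have 1: "((\<lambda>t. ip (u t) (Q t)) \<longlongrightarrow> ip (u 0) d) (at 0)" by (rule LIM_zero_cancel)
  have 2: "((\<lambda>t. (ip (u t) (w 0) - ip (u 0) (w 0)) /\<^sub>R t) \<longlongrightarrow> s) (at 0)"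
  proof -
    have "((\<lambda>t. norm (ip (u t) (w 0) - ip (u 0) (w 0) - t *\<^sub>R s) / norm t) \<longlongrightarrow> 0) (at 0)"
      using s unfolding has_vector_derivative_def has_derivative_iff_norm by simp
    moreover have "\<forall>\<^sub>F t in at 0. norm (ip (u t) (w 0) - ip (u 0) (w 0) - t *\<^sub>R s) / norm t
        = norm ((ip (u t) (w 0) - ip (u 0) (w 0)) /\<^sub>R t - s)"
      unfolding eventually_at_filter
    proof (rule always_eventually, intro allI impI)
      fix t :: real assume that: "t \<noteq> 0"
      have "(ip (u t) (w 0) - ip (u 0) (w 0)) /\<^sub>R t - s = (ip (u t) (w 0) - ip (u 0) (w 0) - t *\<^sub>R s) /\<^sub>R t"
        using that by (simp add: scaleR_diff_right)
      then show "norm (ip (u t) (w 0) - ip (u 0) (w 0) - t *\<^sub>R s) / norm t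
          = norm ((ip (u t) (w 0) - ip (u 0) (w 0)) /\<^sub>R t - s)"
        by (simp add: divide_inverse mult.commute)
    qed
    ultimately have "((\<lambda>t. norm ((ip (u t) (w 0) - ip (u 0) (w 0)) /\<^sub>R t - s)) \<longlongrightarrow> 0) (at 0)"
      by (rule Lim_transform_eventually)
    from tendsto_norm_zero_cancel[OF this] show ?thesis by (rule LIM_zero_cancel)
  qed
  have "\<forall>\<^sub>F t in at 0. (ip (u t) (w 0) - ip (u 0) (w 0)) /\<^sub>R t + ip (u t) (Q t)
      = (ip (u t) (w t) - ip (u 0) (w 0)) /\<^sub>R t"
    using w(1) u(1)
  proof eventually_elim
    case (elim t)
    then have "ip (u t) (Q t) = (ip (u t) (w t) - ip (u t) (w 0)) /\<^sub>R t"
      using w(2) by (simp add: Q_def ip_simps scaleR_conv_of_real)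
    then show ?case by (simp add: scaleR_add_right[symmetric])
  qed
  with tendsto_add[OF 2 1] show "((\<lambda>t. (ip (u t) (w t) - ip (u 0) (w 0)) /\<^sub>R t) \<longlongrightarrow> s + ip (u 0) d) (at 0)"
    by (rule Lim_transform_eventually)
qed

end

lemma (in dual_hilbert_space) complete:
  assumes "\<And>n::nat. s n \<in> F" "\<forall>\<epsilon>>0. \<exists>M. \<forall>m\<ge>M. \<forall>n\<ge>M. F.nrm (s m - s n) < \<epsilon>"
  shows "\<exists>l\<in>F. (\<lambda>n. F.nrm (s n - l)) \<longlonglongrightarrow> 0"
proof -
  have "\<forall>s::nat \<Rightarrow> 'a \<Rightarrow> complex. (\<forall>n. s n \<in> F) \<longrightarrow>
     (\<forall>\<epsilon>>0. \<exists>M. \<forall>m\<ge>M. \<forall>n\<ge>M. F.nrm (s m - s n) < \<epsilon>) \<longrightarrow> (\<exists>l\<in>F. (\<lambda>n. F.nrm (s n - l)) \<longlonglongrightarrow> 0)"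
    using hilbert unfolding hilbert_function_space_def by (elim conjE)
  then show ?thesis using assms by simp
qed

section \<open>Norm derivatives of the kernel functions\<close>

context rkhs_domain
begin

text \<open>The quotient is by the conjugate of h because the kernel function depends
  antiholomorphically on its point; pairing f with it then yields the ordinary complex difference
  quotient of f, see \<open>ip_kquot\<close>.\<close>

definition kquot :: "complex^'n \<Rightarrow> complex^'n \<Rightarrow> complex \<Rightarrow> complex^'n \<Rightarrow> complex" where
  "kquot x b h = cscale (inverse (cnj h)) (k (x + h *s b) - k x)"

lemma kquot_FH: "x \<in> X \<Longrightarrow> x + h *s b \<in> X \<Longrightarrow> kquot x b h \<in> FH"
  by (simp add: kquot_def FH_cscale FH_diff k_FH)

lemma ip_kquot:
  assumes "f \<in> F" "x \<in> X" "x + h *s b \<in> X"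
  shows "ip f (kquot x b h) = (f (x + h *s b) - f x) / h"
  using assms by (simp add: kquot_def F.ip_simps reproducing divide_inverse mult.commute)

lemma FH_bounded:
  assumes "f \<in> F" "y \<in> X" "F.nrm (k y) \<le> B" shows "norm (f y) \<le> F.nrm f * B"
proof -
  have "norm (f y) \<le> F.nrm f * F.nrm (k y)"
    using F.Cauchy_Schwarz[of f "k y"] assms by (simp add: reproducing)
  also have "\<dots> \<le> F.nrm f * B" using assms by (intro mult_left_mono) auto
  finally show ?thesis .
qed

text \<open>For f in \<open>FH\<close> the difference quotient differs from the derivative by at
  most C ||f|| |h|, with C independent of f since f is bounded on the line by ||f|| B. Two quotients
  are therefore close in norm at a linear rate, and completeness provides their limit.\<close>

lemma ex_kernel_derivative:
  assumes x: "x \<in> X"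
  shows "\<exists>d\<in>F. \<exists>r>0. \<exists>C. \<forall>h. 0 < norm h \<longrightarrow> norm h < r \<longrightarrow> x + h *s b \<in> X \<and> F.nrm (kquot x b h - d) \<le> C * norm h"
proof -
  obtain r B where r: "0 < r" and X: "\<And>z. norm z < r \<Longrightarrow> x + z *s b \<in> X"
    and B: "\<And>z. norm z < r \<Longrightarrow> F.nrm (k (x + z *s b)) \<le> B"
    using kernel_bounded_on_line[OF x, of b] by metis
  have B0: "0 \<le> B" using order_trans[OF F.nrm_nonneg B[of 0]] r X[of 0] by simp
  define C where "C = 8 * B / r\<^sup>2"
  have C0: "0 \<le> C" using B0 by (simp add: C_def)
  have est: "norm (ip f (kquot x b h) - deriv (\<lambda>z. f (x + z *s b)) 0) \<le> C * F.nrm f * norm h"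
    if f: "f \<in> FH" and h: "0 < norm h" "norm h < r / 4" for f h
  proof -
    let ?g = "\<lambda>z. f (x + z *s b)"
    have "norm (?g (0 + h) - ?g 0 - h * deriv ?g 0) \<le> 8 * (F.nrm f * B) / r\<^sup>2 * norm h ^ 2"
    proof (rule holomorphic_bounded_Taylor[OF _ r _ h(2)])
      show "?g holomorphic_on ball 0 r" using X by (intro holomorphic_on_along_line[OF FH_hol[OF f]]) auto
      show "norm (?g z) \<le> F.nrm f * B" if "z \<in> ball 0 r" for z
        using that X B by (intro FH_bounded FH_F f) auto
    qed
    then have "norm (?g h - ?g 0 - h * deriv ?g 0) / norm h \<le> C * F.nrm f * norm h"
      using h by (simp add: C_def divide_le_eq power2_eq_square mult_ac)
    moreover have "ip f (kquot x b h) - deriv ?g 0 = (?g h - ?g 0 - h * deriv ?g 0) / h"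
      using h r X[of h] x FH_F[OF f] by (simp add: ip_kquot field_simps)
    ultimately show ?thesis by (simp add: norm_divide)
  qed
  have X': "x + h *s b \<in> X" if "norm h < r/4" for h using that r by (intro X) auto
  have qF: "kquot x b h \<in> FH" if "norm h < r/4" for h using kquot_FH[OF x X'[OF that]] .
  have dist: "F.nrm (kquot x b h - kquot x b h') \<le> C * (norm h + norm h')"
    if h: "0 < norm h" "norm h < r / 4" and h': "0 < norm h'" "norm h' < r / 4" for h h'
  proof (rule nrm_le_by_FH)
    show "kquot x b h - kquot x b h' \<in> FH" using h h' by (intro FH_diff qF)
    show "0 \<le> C * (norm h + norm h')" using C0 by simp
    fix f assume f: "f \<in> FH"
    have "ip f (kquot x b h - kquot x b h') = (ip f (kquot x b h) - deriv (\<lambda>z. f (x + z *s b)) 0)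
        - (ip f (kquot x b h') - deriv (\<lambda>z. f (x + z *s b)) 0)"
      using f h h' qF FH_F by (simp add: F.ip_diff_right)
    also have "norm \<dots> \<le> C * F.nrm f * norm h + C * F.nrm f * norm h'"
      by (intro norm_triangle_le_diff add_mono est f h h')
    finally show "norm (ip f (kquot x b h - kquot x b h')) \<le> C * (norm h + norm h') * F.nrm f"
      by (simp add: algebra_simps)
  qed
  \<comment> \<open>Some null sequence, used to produce the limit d; the estimate for arbitrary h
    follows by comparison with this sequence.\<close>
  define h where "h n = complex_of_real (r / 8 * inverse (real (Suc n)))" for n
  have nh: "norm (h n) = r / 8 * inverse (real (Suc n))" for n using r by (simp add: h_def norm_mult norm_inverse norm_divide del: of_nat_Suc)
  have h: "0 < norm (h n)" "norm (h n) < r / 4" for n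
  proof -
    show "0 < norm (h n)" unfolding nh using r by simp
    have "r / 8 * inverse (real (Suc n)) \<le> r / 8 * 1"
      using r by (intro mult_left_mono) (auto simp: inverse_eq_divide)
    then show "norm (h n) < r / 4" unfolding nh using r by linarith
  qed
  have hlim: "(\<lambda>n. norm (h n)) \<longlonglongrightarrow> 0"
    unfolding nh by (rule tendsto_mult_right_zero[OF LIMSEQ_inverse_real_of_nat])
  have "\<forall>\<epsilon>>0. \<exists>M. \<forall>m\<ge>M. \<forall>n\<ge>M. F.nrm (kquot x b (h m) - kquot x b (h n)) < \<epsilon>"
  proof (intro allI impI)
    fix \<epsilon> :: real assume "0 < \<epsilon>"
    have "(\<lambda>n. C * norm (h n)) \<longlonglongrightarrow> 0" by (rule tendsto_mult_right_zero[OF hlim])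
    then have "\<forall>\<^sub>F n in sequentially. C * norm (h n) < \<epsilon> / 2" using \<open>0 < \<epsilon>\<close> by (intro order_tendstoD) auto
    then obtain M where M: "\<And>n. n \<ge> M \<Longrightarrow> C * norm (h n) < \<epsilon> / 2" unfolding eventually_sequentially by blast
    have "F.nrm (kquot x b (h m) - kquot x b (h n)) < \<epsilon>" if "m \<ge> M" "n \<ge> M" for m n
      using dist[OF h h, of m n] M[OF that(1)] M[OF that(2)] by (simp add: algebra_simps)
    then show "\<exists>M. \<forall>m\<ge>M. \<forall>n\<ge>M. F.nrm (kquot x b (h m) - kquot x b (h n)) < \<epsilon>" by blast
  qed
  moreover have qhF: "\<forall>n. kquot x b (h n) \<in> F" using qF h FH_F by blast
  ultimately have "\<exists>l\<in>F. (\<lambda>n. F.nrm (kquot x b (h n) - l)) \<longlonglongrightarrow> 0"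
    by (intro complete) auto
  then obtain d where d: "d \<in> F" "(\<lambda>n. F.nrm (kquot x b (h n) - d)) \<longlonglongrightarrow> 0" by blast
  have "F.nrm (kquot x b g - d) \<le> C * norm g" if g: "0 < norm g" "norm g < r / 4" for g
  proof -
    have "(\<lambda>n. C * (norm g + norm (h n)) + F.nrm (kquot x b (h n) - d)) \<longlonglongrightarrow> C * (norm g + 0) + 0"
      by (intro tendsto_intros hlim d)
    moreover have "F.nrm (kquot x b g - d) \<le> C * (norm g + norm (h n)) + F.nrm (kquot x b (h n) - d)" for n
      using F.nrm_triangle_diff[of "kquot x b g" "kquot x b (h n)" d] dist[OF g h, of n] qhF d(1) FH_F[OF qF[OF g(2)]]
      by simp
    ultimately show ?thesis by (intro LIMSEQ_le_const[of _ "C * norm g"]) auto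
  qed
  then show ?thesis using d(1) r X' by (intro bexI[of _ d] exI[of _ "r/4"] conjI exI[of _ C]) auto
qed

definition kd :: "complex^'n \<Rightarrow> complex^'n \<Rightarrow> complex^'n \<Rightarrow> complex" where
  "kd x b = (SOME d. d \<in> F \<and> (\<exists>r>0. \<exists>C. \<forall>h. 0 < norm h \<longrightarrow> norm h < r \<longrightarrow>
     x + h *s b \<in> X \<and> F.nrm (kquot x b h - d) \<le> C * norm h))"

lemma kd:
  assumes "x \<in> X"
  shows kd_mem: "kd x b \<in> F"
    and kd_bound: "\<exists>r>0. \<exists>C. \<forall>h. 0 < norm h \<longrightarrow> norm h < r \<longrightarrow>
      x + h *s b \<in> X \<and> F.nrm (kquot x b h - kd x b) \<le> C * norm h"
proof -
  note ex = someI_ex[OF ex_kernel_derivative[OF assms, of b, unfolded Bex_def]]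
  show "kd x b \<in> F" unfolding kd_def by (rule ex[THEN conjunct1])
  show "\<exists>r>0. \<exists>C. \<forall>h. 0 < norm h \<longrightarrow> norm h < r \<longrightarrow>
      x + h *s b \<in> X \<and> F.nrm (kquot x b h - kd x b) \<le> C * norm h"
    unfolding kd_def using ex[THEN conjunct2] by simp
qed

lemma kquot_tendsto:
  assumes x: "x \<in> X"
  shows "\<forall>\<^sub>F h in at 0. x + h *s b \<in> X" "((\<lambda>h. F.nrm (kquot x b h - kd x b)) \<longlongrightarrow> 0) (at 0)"
proof -
  obtain r C where rC: "0 < r" "\<And>h. 0 < norm h \<Longrightarrow> norm h < r \<Longrightarrow>
      x + h *s b \<in> X \<and> F.nrm (kquot x b h - kd x b) \<le> C * norm h"
    using kd_bound[OF x, of b] by blast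
  have ev: "\<forall>\<^sub>F h in at 0. x + h *s b \<in> X \<and> F.nrm (kquot x b h - kd x b) \<le> C * norm h"
    unfolding eventually_at using rC by (intro exI[of _ r]) auto
  then show X: "\<forall>\<^sub>F h in at 0. x + h *s b \<in> X" by (rule eventually_mono) simp
  show "((\<lambda>h. F.nrm (kquot x b h - kd x b)) \<longlongrightarrow> 0) (at 0)"
  proof (rule Lim_null_comparison)
    show "\<forall>\<^sub>F h in at 0. norm (F.nrm (kquot x b h - kd x b)) \<le> C * norm h"
      using ev
    proof eventually_elim
      case (elim h)
      then show ?case using F.nrm_nonneg[of "kquot x b h - kd x b"] kquot_FH[OF x, of h b] FH_F kd_mem[OF x]
        by (simp add: F.mem)
    qed
    show "((\<lambda>h. C * norm h) \<longlongrightarrow> 0) (at (0::complex))" by (auto intro!: tendsto_eq_intros)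
  qed
qed

lemma filterlim_real_line:
  assumes "c \<noteq> 0" shows "filterlim (\<lambda>t. of_real t * c) (at (0::complex)) (at (0::real))"
  unfolding filterlim_at using assms by (auto intro!: tendsto_eq_intros simp: eventually_at_filter)

lemma scaleR_smult: "t *\<^sub>R (c *s b) = (of_real t * c) *s (b :: complex^'n)"
  by (simp add: vec_eq_iff mult.assoc flip: scaleR_conv_of_real)

text \<open>One complex derivative serves all real directions c b, with antiholomorphy visible in
  the factor cnj c. The cases c = 1 and c = i are the two line derivatives in a Wirtinger
  operator.\<close>

lemma kernel_directional_limit:
  assumes x: "x \<in> X" and c: "c \<noteq> 0"
  shows "F.has_directional_limit (\<lambda>t. k (x + t *\<^sub>R (c *s b))) (cscale (cnj c) (kd x b))"
  unfolding F.has_directional_limit_def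
proof (intro conjI)
  have ev: "\<forall>\<^sub>F t in at 0. x + t *\<^sub>R (c *s b) \<in> X"
    using eventually_compose_filterlim[OF kquot_tendsto(1)[OF x, of b] filterlim_real_line[OF c]]
    by (simp add: scaleR_smult)
  then show "\<forall>\<^sub>F t in at 0. k (x + t *\<^sub>R (c *s b)) \<in> F" by (rule eventually_mono) simp
  show "cscale (cnj c) (kd x b) \<in> F" using kd_mem[OF x] by (rule F.cscale_mem)
  show "k (x + 0 *\<^sub>R (c *s b)) \<in> F" using x by simp
  have "((\<lambda>t. norm c * F.nrm (kquot x b (of_real t * c) - kd x b)) \<longlongrightarrow> 0) (at 0)"
    by (rule tendsto_mult_right_zero[OF filterlim_compose[OF kquot_tendsto(2)[OF x] filterlim_real_line[OF c]]])
  moreover have "\<forall>\<^sub>F t in at 0. norm c * F.nrm (kquot x b (of_real t * c) - kd x b) =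
      F.nrm ((k (x + t *\<^sub>R (c *s b)) - k (x + 0 *\<^sub>R (c *s b))) /\<^sub>R t - cscale (cnj c) (kd x b))"
  proof -
    have ne: "\<forall>\<^sub>F t::real in at 0. t \<noteq> 0" by (simp add: eventually_at_filter)
    show ?thesis
      using ev ne
    proof eventually_elim
      case (elim t)
      have q: "kquot x b (of_real t * c) \<in> F"
        using elim x by (intro FH_F kquot_FH) (simp_all add: scaleR_smult)
      have "(k (x + t *\<^sub>R (c *s b)) - k (x + 0 *\<^sub>R (c *s b))) /\<^sub>R t - cscale (cnj c) (kd x b)
          = cscale (cnj c) (kquot x b (of_real t * c) - kd x b)"
        unfolding scaleR_smult kquot_def using c elim(2)
        by (simp add: cscale_def fun_eq_iff scaleR_fun_def field_simps) (simp add: scaleR_conv_of_real field_simps)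
      then show ?case using q kd_mem[OF x] by (simp add: F.nrm_cscale F.mem)
    qed
  qed
  ultimately show "((\<lambda>t. F.nrm ((k (x + t *\<^sub>R (c *s b)) - k (x + 0 *\<^sub>R (c *s b))) /\<^sub>R t - cscale (cnj c) (kd x b))) \<longlongrightarrow> 0) (at 0)"
    by (rule Lim_transform_eventually)
qed

end

section \<open>Wirtinger derivatives of the diagonal\<close>

lemma axis_eq_smult: "axis j c = c *s (axis j 1 :: complex^'n)"
  by (simp add: vec_eq_iff axis_def)

context rkhs_domain
begin

lemma ip_kd:
  assumes x: "x \<in> X" and f: "f \<in> FH"
  shows "ip f (kd x b) = deriv (\<lambda>z. f (x + z *s b)) 0"
proof -
  let ?g = "\<lambda>z. f (x + z *s b)"
  obtain d where d: "(?g has_field_derivative d) (at 0)"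
    using has_field_derivative_along_line[OF FH_hol[OF f], of x 0 b] x by auto
  then have 1: "((\<lambda>h. (?g h - ?g 0) / h) \<longlongrightarrow> d) (at 0)" by (simp add: has_field_derivative_iff)
  have "((\<lambda>h. (?g h - ?g 0) / h - ip f (kd x b)) \<longlongrightarrow> 0) (at 0)"
  proof (rule Lim_null_comparison)
    show "\<forall>\<^sub>F h in at 0. norm ((?g h - ?g 0) / h - ip f (kd x b)) \<le> F.nrm f * F.nrm (kquot x b h - kd x b)"
      using kquot_tendsto(1)[OF x, of b]
    proof eventually_elim
      case (elim h)
      have q: "kquot x b h \<in> F" using kquot_FH[OF x elim] FH_F by blast
      have eq: "(?g h - ?g 0) / h - ip f (kd x b) = ip f (kquot x b h - kd x b)"
        using q f x elim by (simp add: F.ip_diff_right kd_mem ip_kquot FH_F)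
      show ?case
        unfolding eq by (intro F.Cauchy_Schwarz FH_F[OF f] F.diff_mem kd_mem q x)
    qed
    show "((\<lambda>h. F.nrm f * F.nrm (kquot x b h - kd x b)) \<longlongrightarrow> 0) (at 0)"
      by (rule tendsto_mult_right_zero[OF kquot_tendsto(2)[OF x]])
  qed
  then have 2: "((\<lambda>h. (?g h - ?g 0) / h) \<longlongrightarrow> ip f (kd x b)) (at 0)" by (rule LIM_zero_cancel)
  have "ip f (kd x b) = d" by (rule LIM_unique[OF 2 1])
  also have "d = deriv ?g 0" using d by (rule DERIV_imp_deriv[symmetric])
  finally show ?thesis .
qed

text \<open>Tested against f in \<open>FH\<close>, a difference quotient in direction b is a
  holomorphic function of z whose bound does not depend on h; it is thus Lipschitz in z uniformly in
  h, and the estimate survives the limit h to 0.\<close>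

lemma kd_Lipschitz:
  assumes x: "x \<in> X"
  obtains r C where "0 < r" "\<And>z. norm z < r \<Longrightarrow> x + z *s a \<in> X"
    "\<And>z. norm z < r \<Longrightarrow> F.nrm (kd (x + z *s a) b - kd x b) \<le> C * norm z"
proof -
  obtain r B where r: "0 < r" and X: "\<And>z w. norm z < r \<Longrightarrow> norm w < r \<Longrightarrow> x + z *s a + w *s b \<in> X"
    and B: "\<And>z w. norm z < r \<Longrightarrow> norm w < r \<Longrightarrow> F.nrm (k (x + z *s a + w *s b)) \<le> B"
    using kernel_bounded_on_bidisc[OF x, of a b] by metis
  have B0: "0 \<le> B"
  proof -
    have "0 \<le> F.nrm (k x)" using x by simp
    also have "F.nrm (k x) \<le> B" using B[of 0 0] r by simp
    finally show ?thesis .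
  qed
  have Xz: "x + z *s a \<in> X" if "norm z < r" for z using X[of z 0] that r by simp
  define C where "C = 4 * B / r\<^sup>2"
  have quot: "F.nrm (kquot (x + z *s a) b h - kquot x b h) \<le> C * norm z"
    if z: "norm z < r/2" and h: "h \<noteq> 0" "norm h < r/2" for z h
  proof (rule nrm_le_by_FH)
    have Xzh: "x + z *s a + h *s b \<in> X" "x + z *s a \<in> X" "x + h *s b \<in> X"
      using X[of z h] X[of 0 h] X[of z 0] z h r by auto
    show "kquot (x + z *s a) b h - kquot x b h \<in> FH" using Xzh x by (intro FH_diff kquot_FH)
    show "0 \<le> C * norm z" using B0 by (simp add: C_def)
    fix f assume f: "f \<in> FH"
    define g where "g z w = f (x + z *s a + w *s b)" for z w
    have gM: "norm (g z w) \<le> F.nrm f * B" if "norm z < r" "norm w < r" for z w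
      unfolding g_def using that f X B by (intro FH_bounded FH_F) auto
    have hol_w: "g z holomorphic_on ball 0 r" if "norm z < r" for z
      unfolding g_def using that X by (intro holomorphic_on_along_line[OF FH_hol[OF f]]) auto
    have hol_z: "(\<lambda>z. g z w) holomorphic_on ball 0 r" if "norm w < r" for w
    proof -
      have eq: "x + z *s a + w *s b = (x + w *s b) + z *s a" for z by simp
      have "(x + w *s b) + z *s a \<in> X" if "z \<in> ball 0 r" for z
        using X[of z w] \<open>norm w < r\<close> that by (simp add: add_ac)
      then show ?thesis unfolding g_def eq by (intro holomorphic_on_along_line[OF FH_hol[OF f]])
    qed
    \<comment> \<open>p is at most 2 ||f|| B / r by the Lipschitz estimate in w; the same estimate
      applied to p in z gives 4 ||f|| B / r^2, the constant C times ||f||.\<close>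
    define p where "p z = (g z h - g z 0) / h" for z
    have "norm (p z - p 0) \<le> 2 * (2 * (F.nrm f * B) / r) / r * norm (z - 0)"
    proof (rule holomorphic_bounded_Lipschitz)
      show "p holomorphic_on ball 0 r"
        unfolding p_def using h r by (intro holomorphic_intros hol_z) auto
      show "norm (p z) \<le> 2 * (F.nrm f * B) / r" if z: "z \<in> ball 0 r" for z
      proof -
        have "norm (g z h - g z 0) \<le> 2 * (F.nrm f * B) / r * norm (h - 0)"
        proof (rule holomorphic_bounded_Lipschitz)
          show "g z holomorphic_on ball 0 r" using z by (intro hol_w) simp
          show "norm (g z w) \<le> F.nrm f * B" if "w \<in> ball 0 r" for w using z that by (intro gM) auto
        qed (use h r in auto)
        then show ?thesis using h by (simp add: p_def norm_divide divide_le_eq)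
      qed
    qed (use z r in auto)
    moreover have "ip f (kquot (x + z *s a) b h - kquot x b h) = p z - p 0"
      using Xzh x f by (simp add: F.ip_diff_right FH_F kquot_FH ip_kquot p_def g_def)
    ultimately show "norm (ip f (kquot (x + z *s a) b h - kquot x b h)) \<le> C * norm z * F.nrm f"
      by (simp add: C_def power2_eq_square mult_ac)
  qed
  have "F.nrm (kd (x + z *s a) b - kd x b) \<le> C * norm z" if z: "norm z < r/2" for z
  proof -
    have y: "x + z *s a \<in> X" using z r by (intro Xz) auto
    have lim: "((\<lambda>h. F.nrm (kquot (x + z *s a) b h - kd (x + z *s a) b) + C * norm z + F.nrm (kquot x b h - kd x b))
        \<longlongrightarrow> 0 + C * norm z + 0) (at 0)"
      by (intro tendsto_intros kquot_tendsto y x)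
    have small: "\<forall>\<^sub>F h in at (0::complex). h \<noteq> 0 \<and> norm h < r/2"
      unfolding eventually_at using r by (intro exI[of _ "r/2"]) auto
    have "\<forall>\<^sub>F h in at 0. F.nrm (kd (x + z *s a) b - kd x b) \<le>
        F.nrm (kquot (x + z *s a) b h - kd (x + z *s a) b) + C * norm z + F.nrm (kquot x b h - kd x b)"
      using kquot_tendsto(1)[OF y, of b] kquot_tendsto(1)[OF x, of b] small
    proof eventually_elim
      case (elim h)
      let ?p = "kquot (x + z *s a) b h" and ?q = "kquot x b h"
      have m: "?p \<in> F" "?q \<in> F" "kd (x + z *s a) b \<in> F" "kd x b \<in> F"
        using elim x y by (auto intro: FH_F kquot_FH kd_mem)
      have "F.nrm (kd (x + z *s a) b - kd x b) \<le> F.nrm (kd (x + z *s a) b - ?p) + F.nrm (?p - kd x b)"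
        using m by (intro F.nrm_triangle_diff)
      moreover have "F.nrm (?p - kd x b) \<le> F.nrm (?p - ?q) + F.nrm (?q - kd x b)"
        using m by (intro F.nrm_triangle_diff)
      moreover have "F.nrm (kd (x + z *s a) b - ?p) = F.nrm (?p - kd (x + z *s a) b)"
        using m by (intro F.nrm_minus_commute)
      moreover have "F.nrm (?p - ?q) \<le> C * norm z" using quot[OF z] elim by blast
      ultimately show ?case by linarith
    qed
    then have "F.nrm (kd (x + z *s a) b - kd x b) \<le> 0 + C * norm z + 0"
      by (intro tendsto_lowerbound[OF lim]) auto
    then show ?thesis by simp
  qed
  then show ?thesis using r Xz by (intro that[of "r/2" C]) auto
qed

text \<open>Pairing with f turns \<open>kd\<close> into the conjugate of a derivative of f in one
  variable, which depends holomorphically on the other. The value of m is left open because it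
  cancels in \<open>dz_dzbar_diag\<close>.\<close>

lemma kd_weak_derivative:
  assumes x: "x \<in> X" and f: "f \<in> FH"
  obtains m where "\<And>c. c \<noteq> 0 \<Longrightarrow> ((\<lambda>t. ip (kd (x + t *\<^sub>R (c *s a)) b) f) has_vector_derivative cnj c * m) (at 0)"
proof -
  obtain r B where r: "0 < r" and X: "\<And>z w. norm z < r \<Longrightarrow> norm w < r \<Longrightarrow> x + z *s a + w *s b \<in> X"
    and B: "\<And>z w. norm z < r \<Longrightarrow> norm w < r \<Longrightarrow> F.nrm (k (x + z *s a + w *s b)) \<le> B"
    using kernel_bounded_on_bidisc[OF x, of a b] by metis
  define g where "g w z = f (x + z *s a + w *s b)" for z w
  define D where "D z = deriv (\<lambda>w. g w z) 0" for z
  have "D holomorphic_on ball 0 r"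
    unfolding D_def
  proof (rule holomorphic_deriv_parameter[OF open_ball _ r])
    show "(\<lambda>w. g w z) holomorphic_on ball 0 r" if "z \<in> ball 0 r" for z
      unfolding g_def using that X by (intro holomorphic_on_along_line[OF FH_hol[OF f]]) auto
    show "g w holomorphic_on ball 0 r" if "w \<in> ball 0 r" for w
    proof -
      have eq: "x + z *s a + w *s b = (x + w *s b) + z *s a" for z by simp
      have "(x + w *s b) + z *s a \<in> X" if "z \<in> ball 0 r" for z
        using X[of z w] \<open>w \<in> ball 0 r\<close> that by (simp add: add_ac)
      then show ?thesis unfolding g_def[abs_def] eq by (intro holomorphic_on_along_line[OF FH_hol[OF f]])
    qed
    show "norm (g w z) \<le> F.nrm f * B" if "w \<in> ball 0 r" "z \<in> ball 0 r" for w z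
      unfolding g_def using that f X B by (intro FH_bounded FH_F) auto
  qed
  then have derD: "(D has_field_derivative deriv D 0) (at 0)"
    using r by (intro holomorphic_derivI[of D "ball 0 r"]) auto
  have ipD: "ip (kd (x + z *s a) b) f = cnj (D z)" if z: "norm z < r" for z
  proof -
    have y: "x + z *s a \<in> X" using X[of z 0] z r by simp
    have "ip f (kd (x + z *s a) b) = D z" unfolding D_def g_def by (rule ip_kd[OF y f])
    then show ?thesis using F.ip_commute[OF FH_F[OF f] kd_mem[OF y]] by simp
  qed
  have "((\<lambda>t. ip (kd (x + t *\<^sub>R (c *s a)) b) f) has_vector_derivative cnj c * cnj (deriv D 0)) (at 0)" if c: "c \<noteq> 0" for c
  proof -
    have "((\<lambda>t. of_real t * c) has_vector_derivative c) (at (0::real))"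
      by (auto intro!: derivative_eq_intros)
    then have "((D \<circ> (\<lambda>t. of_real t * c)) has_vector_derivative c * deriv D 0) (at (0::real))"
      using derD by (intro field_vector_diff_chain_at) auto
    then have "((\<lambda>t. cnj (D (of_real t * c))) has_vector_derivative cnj (c * deriv D 0)) (at (0::real))"
      by (intro has_vector_derivative_cnj) (simp add: o_def)
    then have "((\<lambda>t. ip (kd (x + t *\<^sub>R (c *s a)) b) f) has_vector_derivative cnj (c * deriv D 0)) (at 0)"
    proof (rule has_vector_derivative_transform_within_open[where S = "ball 0 (r / norm c)"])
      show "0 \<in> ball 0 (r / norm c)" using r c by simp
      show "cnj (D (of_real t * c)) = ip (kd (x + t *\<^sub>R (c *s a)) b) f" if "t \<in> ball 0 (r / norm c)" for t
        using that c by (simp add: scaleR_smult ipD norm_mult field_simps)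
    qed simp
    then show ?thesis by simp
  qed
  then show ?thesis by (rule that)
qed

section \<open>Line derivatives of the diagonal\<close>

lemma open_line_domain: "open {t. x + t *\<^sub>R v \<in> X}"
proof -
  have "{t. x + t *\<^sub>R v \<in> X} = (\<lambda>t. x + t *\<^sub>R v) -` X" by auto
  also have "open \<dots>" using open_X by (intro open_vimage continuous_intros)
  finally show ?thesis .
qed

lemma eventually_line: "x \<in> X \<Longrightarrow> \<forall>\<^sub>F t in at 0. x + t *\<^sub>R v \<in> X"
  using open_line_domain[of x v] unfolding eventually_at_topological by (intro exI[of _ "{t. x + t *\<^sub>R v \<in> X}"]) auto

lemma diag_eq_ip: "x \<in> X \<Longrightarrow> diag K x = ip (k x) (k x)"
  by (simp add: diag_def K_eq_ip)

lemma line_deriv_diag: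
  assumes x: "x \<in> X" and c: "c \<noteq> 0"
  shows "line_deriv (diag K) x (c *s b) = cnj c * ip (kd x b) (k x) + c * ip (k x) (kd x b)"
proof -
  let ?w = "\<lambda>t. k (x + t *\<^sub>R (c *s b))"
  let ?d = "cscale (cnj c) (kd x b)"
  note lim = kernel_directional_limit[OF x c, of b]
  have mem: "\<forall>\<^sub>F t in at 0. ?w t \<in> F" "?w 0 \<in> F"
    using lim unfolding F.has_directional_limit_def by auto
  have left: "((\<lambda>t. ip (?w t) (?w 0)) has_vector_derivative ip ?d (?w 0)) (at 0)"
    by (rule F.has_vector_derivative_ip_left[OF lim mem(2)])
  have "((\<lambda>t. ip (?w t) (?w t)) has_vector_derivative ip ?d (?w 0) + ip (?w 0) ?d) (at 0)"
    using F.has_vector_derivative_ip[OF mem F.has_directional_limit_continuous[OF lim] lim left] .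
  then have "((\<lambda>t. diag K (x + t *\<^sub>R (c *s b))) has_vector_derivative ip ?d (?w 0) + ip (?w 0) ?d) (at 0)"
    by (rule has_vector_derivative_transform_within_open[OF _ open_line_domain[of x "c *s b"]]) (use x in \<open>auto simp: diag_eq_ip\<close>)
  then show ?thesis
    unfolding line_deriv_def using x by (simp add: vector_derivative_at F.ip_simps kd_mem)
qed

text \<open>The line derivative in direction c b has a part linear in c and a part linear in cnj c;
  combining c = 1 and c = i, \<open>dz\<close> keeps the former and \<open>dzbar\<close> the
  latter.\<close>

lemma dz_diag: "x \<in> X \<Longrightarrow> dz j (diag K) x = ip (k x) (kd x (axis j 1))"
  and dzbar_diag: "x \<in> X \<Longrightarrow> dzbar j (diag K) x = ip (kd x (axis j 1)) (k x)"
proof -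
  assume x: "x \<in> X"
  have L1: "line_deriv (diag K) x (axis j 1) = ip (kd x (axis j 1)) (k x) + ip (k x) (kd x (axis j 1))"
    using line_deriv_diag[OF x, of 1 "axis j 1"] by simp
  have Li: "line_deriv (diag K) x (axis j \<i>) = - \<i> * ip (kd x (axis j 1)) (k x) + \<i> * ip (k x) (kd x (axis j 1))"
    using line_deriv_diag[OF x, of \<i> "axis j 1"] by (simp add: axis_eq_smult[of j \<i>])
  show "dz j (diag K) x = ip (k x) (kd x (axis j 1))"
    "dzbar j (diag K) x = ip (kd x (axis j 1)) (k x)"
    unfolding dz_def dzbar_def L1 Li by (simp_all add: algebra_simps)
qed

text \<open>In direction c a the derivative of <\<open>kd\<close>, \<open>k\<close>> is cnj c * m,
  from moving the first factor, plus c times the inner product of the two derivatives, from moving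
  the second. As \<open>dz\<close> keeps only the part linear in c, the unknown m drops out.\<close>

lemma dz_dzbar_diag:
  assumes x: "x \<in> X"
  shows "dz j (dzbar l (diag K)) x = ip (kd x (axis l 1)) (kd x (axis j 1))"
proof -
  define a b where "a = (axis j 1 :: complex^'n)" and "b = (axis l 1 :: complex^'n)"
  obtain m where m: "\<And>c. c \<noteq> 0 \<Longrightarrow> ((\<lambda>t. ip (kd (x + t *\<^sub>R (c *s a)) b) (k x)) has_vector_derivative cnj c * m) (at 0)"
    using kd_weak_derivative[OF x k_FH[OF x]] by metis
  obtain r C where r: "0 < r" "\<And>z. norm z < r \<Longrightarrow> x + z *s a \<in> X"
    "\<And>z. norm z < r \<Longrightarrow> F.nrm (kd (x + z *s a) b - kd x b) \<le> C * norm z"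
    using kd_Lipschitz[OF x] by metis
  have L: "line_deriv (dzbar l (diag K)) x (c *s a) = cnj c * m + c * ip (kd x b) (kd x a)" if c: "c \<noteq> 0" for c
  proof -
    let ?u = "\<lambda>t. kd (x + t *\<^sub>R (c *s a)) b"
    let ?w = "\<lambda>t. k (x + t *\<^sub>R (c *s a))"
    let ?d = "cscale (cnj c) (kd x a)"
    note lim = kernel_directional_limit[OF x c, of a]
    have u: "\<forall>\<^sub>F t in at 0. ?u t \<in> F" "?u 0 \<in> F"
      using eventually_mono[OF eventually_line[OF x] kd_mem] x kd_mem by auto
    have ucont: "((\<lambda>t. F.nrm (?u t - ?u 0)) \<longlongrightarrow> 0) (at 0)"
    proof (rule Lim_null_comparison)
      have "\<forall>\<^sub>F t in at 0. dist t 0 < r / norm c"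
        unfolding eventually_at using r c by (intro exI[of _ "r / norm c"]) auto
      then show "\<forall>\<^sub>F t in at 0. norm (F.nrm (?u t - ?u 0)) \<le> C * (\<bar>t\<bar> * norm c)"
        using u(1)
      proof eventually_elim
        case (elim t)
        have "norm (of_real t * c) < r" using elim(1) c by (simp add: norm_mult field_simps)
        from r(3)[OF this] elim(2) u(2) show ?case
          using F.nrm_nonneg[OF F.diff_mem[OF elim(2) u(2)]] by (simp add: scaleR_smult norm_mult)
      qed
      show "((\<lambda>t. C * (\<bar>t\<bar> * norm c)) \<longlongrightarrow> 0) (at 0)" by (auto intro!: tendsto_eq_intros)
    qed
    have s: "((\<lambda>t. ip (?u t) (?w 0)) has_vector_derivative cnj c * m) (at 0)"
      using m[OF c] by simp
    have "((\<lambda>t. ip (?u t) (?w t)) has_vector_derivative cnj c * m + ip (?u 0) ?d) (at 0)"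
      by (rule F.has_vector_derivative_ip[OF u ucont lim s])
    then have "((\<lambda>t. dzbar l (diag K) (x + t *\<^sub>R (c *s a))) has_vector_derivative cnj c * m + ip (?u 0) ?d) (at 0)"
      by (rule has_vector_derivative_transform_within_open[OF _ open_line_domain[of x "c *s a"]]) (use x in \<open>auto simp: dzbar_diag b_def\<close>)
    then show ?thesis
      unfolding line_deriv_def using x by (simp add: vector_derivative_at F.ip_simps kd_mem)
  qed
  have L1: "line_deriv (dzbar l (diag K)) x (axis j 1) = m + ip (kd x b) (kd x a)"
    using L[of 1] by (simp add: a_def)
  have Li: "line_deriv (dzbar l (diag K)) x (axis j \<i>) = - \<i> * m + \<i> * ip (kd x b) (kd x a)"
    using L[of \<i>] by (simp add: a_def axis_eq_smult[of j \<i>])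
  show ?thesis
    unfolding dz_def L1 Li a_def b_def by (simp add: algebra_simps)
qed

section \<open>The evaluation map and its derivatives\<close>

abbreviation "ev \<equiv> evaluation_map X K F ip"

lemma ev_eq: "ev x = star (k x)"
  by (simp add: evaluation_map_def)

text \<open>\<open>star\<close> is a conjugate-linear isometry, so the norm limit for the kernel
  functions carries over and the factor cnj c becomes c; this is the holomorphy of the evaluation
  map.\<close>

lemma line_deriv_in_ev:
  assumes x: "x \<in> X" and c: "c \<noteq> 0"
  shows "line_deriv_in dual dip ev x (c *s b) = cscale c (star (kd x b))"
  unfolding line_deriv_in_def
proof (rule the_equality)
  let ?w = "\<lambda>t. k (x + t *\<^sub>R (c *s b))"
  let ?d = "cscale (cnj c) (kd x b)"
  let ?q = "\<lambda>t. (ev (x + t *\<^sub>R (c *s b)) - ev x) /\<^sub>R t"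
  have d: "?d \<in> F" "star ?d = cscale c (star (kd x b))" using kd_mem[OF x] by (simp_all add: F.mem star_cscale)
  have lim: "((\<lambda>t. F.nrm ((?w t - k x) /\<^sub>R t - ?d)) \<longlongrightarrow> 0) (at 0)"
    using kernel_directional_limit[OF x c, of b] by (simp add: F.has_directional_limit_def)
  have q: "\<forall>\<^sub>F t in at 0. ?q t = star ((?w t - k x) /\<^sub>R t) \<and> (?w t - k x) /\<^sub>R t \<in> F"
    using eventually_line[OF x, of "c *s b"]
    by eventually_elim (use x in \<open>simp add: ev_eq star_scaleR star_diff F.mem\<close>)
  then have "\<forall>\<^sub>F t in at 0. F.nrm ((?w t - k x) /\<^sub>R t - ?d) = D.nrm (?q t - star ?d)"
  proof eventually_elim
    case (elim t)
    then show ?case using d(1) by (simp add: star_diff[symmetric] dual_nrm_star F.mem)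
  qed
  with lim have lim': "((\<lambda>t. D.nrm (?q t - star ?d)) \<longlongrightarrow> 0) (at 0)" by (rule Lim_transform_eventually)
  then show res: "cscale c (star (kd x b)) \<in> dual \<and> ((\<lambda>t. D.nrm (?q t - cscale c (star (kd x b)))) \<longlongrightarrow> 0) (at 0)"
    unfolding d(2) using star_mem[OF d(1)] d(2) by simp
  have qmem: "\<forall>\<^sub>F t in at 0. ?q t \<in> dual"
    using q by eventually_elim (use star_mem in simp)
  fix p assume "p \<in> dual \<and> ((\<lambda>t. D.nrm (?q t - p)) \<longlongrightarrow> 0) (at 0)"
  then show "p = cscale c (star (kd x b))"
    using res by (intro D.has_directional_limit_unique[OF qmem]) auto
qed

lemma dz_in_ev: "x \<in> X \<Longrightarrow> dz_in dual dip j ev x = star (kd x (axis j 1))"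
  using line_deriv_in_ev[of x 1 "axis j 1"] line_deriv_in_ev[of x \<i> "axis j 1"]
  by (simp add: dz_in_def axis_eq_smult[of j \<i>]) (simp add: cscale_def fun_eq_iff)

lemma tangent_act_in_ev:
  "x \<in> X \<Longrightarrow> tangent_act_in dual dip u ev x = (\<Sum>j\<in>UNIV. cscale (u $ j) (star (kd x (axis j 1))))"
  by (simp add: tangent_act_in_def dz_in_ev)

lemma tangent_act_in_ev_mem: "x \<in> X \<Longrightarrow> tangent_act_in dual dip u ev x \<in> dual"
  by (simp add: tangent_act_in_ev D.sum_mem D.cscale_mem star_mem kd_mem)

lemma dip_tangent_ev:
  assumes x: "x \<in> X"
  shows "dip (tangent_act_in dual dip u ev x) (ev x) = tangent_act u (diag K) x"
    and "dip (ev x) (tangent_act_in dual dip v ev x) = conj_tangent_act v (diag K) x"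
    and "dip (tangent_act_in dual dip u ev x) (tangent_act_in dual dip v ev x) = mixed_act u v (diag K) x"
proof -
  have m: "star (kd x b) \<in> dual" "star (k x) \<in> dual" "cscale c (star (kd x b)) \<in> dual" for b c
    using x by (simp_all add: star_mem kd_mem D.cscale_mem)
  show "dip (tangent_act_in dual dip u ev x) (ev x) = tangent_act u (diag K) x"
    using x m by (simp add: tangent_act_in_ev ev_eq D.ip_sum_left D.ip_cscale_left dip_star kd_mem tangent_act_def dz_diag)
  show "dip (ev x) (tangent_act_in dual dip v ev x) = conj_tangent_act v (diag K) x"
    using x m by (simp add: tangent_act_in_ev ev_eq D.ip_sum_right D.ip_cscale_right dip_star kd_mem conj_tangent_act_def dzbar_diag)
  show "dip (tangent_act_in dual dip u ev x) (tangent_act_in dual dip v ev x) = mixed_act u v (diag K) x"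
    using x m
    by (simp add: tangent_act_in_ev D.ip_sum_left D.ip_sum_right D.sum_mem D.ip_cscale_left D.ip_cscale_right
        dip_star kd_mem mixed_act_def dz_dzbar_diag sum_distrib_left mult_ac) (rule sum.swap)
qed

end

theorem theorem3p3:
  fixes X :: "(complex^'n) set"
    and K :: "complex^'n \<Rightarrow> complex^'n \<Rightarrow> complex"
    and F :: "(complex^'n \<Rightarrow> complex) set"
    and ip :: "(complex^'n \<Rightarrow> complex) \<Rightarrow> (complex^'n \<Rightarrow> complex) \<Rightarrow> complex"
    and \<kappa> :: "complex^'n \<Rightarrow> (complex^'n \<Rightarrow> complex) \<Rightarrow> complex"
    and \<sigma>K :: "complex^'n \<Rightarrow> complex^'n \<Rightarrow> complex^'n \<Rightarrow> complex"
  assumes "domain X"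
    and "sesqui_holomorphic_on K X"
    and "nondegenerate_on K X"
    and "psd_kernel_on K X"
    and "is_rkhs X K F ip"
    and "\<kappa> = evaluation_map X K F ip"
    and "hermitean_metric_on (*s) norm UNIV X \<sigma>K"
    and "\<exists>\<sigma>. unitary_invariant_metric (dual_space F ip) (dual_ip F ip) \<sigma> \<and>
          (\<forall>x\<in>X. \<forall>u v. \<sigma>K x u v = pull_back (dual_space F ip) (dual_ip F ip) \<kappa> \<sigma> x u v)"
  shows "\<exists>\<phi> \<psi> :: real \<Rightarrow> real.
    smooth_on {0<..} \<phi> \<and> smooth_on {0<..} \<psi> \<and>
    (\<forall>x\<in>X. \<forall>u v.
       \<sigma>K x u v =
         complex_of_real (\<phi> (Re (diag K x))) * mixed_act u v (diag K) x +
         complex_of_real (\<psi> (Re (diag K x))) * tangent_act u (diag K) x * conj_tangent_act v (diag K) x)"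
proof (cases "X = {}")
  \<comment> \<open>The definition of a domain admits the empty set; there the formula is vacuous
    and the zero functions serve.\<close>
  case True
  have "smooth_halfline (\<lambda>_. 0)"
    by (rule smooth_halfline_coinduct[of _ "{\<lambda>_. 0}"]) auto
  then have "smooth_on {0<..} (\<lambda>_::real. 0::real)" by (rule smooth_on_halfline)
  with True show ?thesis by auto
next
  case False
  \<comment> \<open>Evaluation at a point of X is the nonzero functional from which the reference
    ray is built.\<close>
  then obtain x0 where x0: "x0 \<in> X" by blast
  interpret rkhs_domain X K F ip
    using assms(1-3,5) by unfold_locales (simp_all add: domain_def)
  obtain \<sigma> where \<sigma>: "unitary_invariant_metric dual dip \<sigma>"
    "\<And>x u v. x \<in> X \<Longrightarrow> \<sigma>K x u v = pull_back dual dip ev \<sigma> x u v"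
    using assms(8) unfolding assms(6) by blast
  have ev: "ev x \<in> dual" "ev x \<noteq> 0" "(D.nrm (ev x))\<^sup>2 = Re (diag K x)" if "x \<in> X" for x
  proof -
    show "ev x \<in> dual" using that by (simp add: ev_eq star_mem)
    have "D.nrm (ev x) = F.nrm (k x)" using that by (simp add: ev_eq dual_nrm_star)
    then show "ev x \<noteq> 0" "(D.nrm (ev x))\<^sup>2 = Re (diag K x)"
      using nrm_k_pos[OF that] nrm_k_power2[OF that] by (auto simp: diag_def)
  qed
  obtain \<phi> \<psi> :: "real \<Rightarrow> real" where smooth: "smooth_on {0<..} \<phi>" "smooth_on {0<..} \<psi>"
    and form: "\<And>g f h. g \<in> dual \<Longrightarrow> g \<noteq> 0 \<Longrightarrow> f \<in> dual \<Longrightarrow> h \<in> dual \<Longrightarrow>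
      \<sigma> g f h = of_real (\<phi> ((D.nrm g)\<^sup>2)) * dip f h + of_real (\<psi> ((D.nrm g)\<^sup>2)) * dip f g * dip g h"
    using D.unitary_invariant_metric_classification[OF \<sigma>(1) ev(1,2)[OF x0]] by metis
  have "\<sigma>K x u v =
         complex_of_real (\<phi> (Re (diag K x))) * mixed_act u v (diag K) x +
         complex_of_real (\<psi> (Re (diag K x))) * tangent_act u (diag K) x * conj_tangent_act v (diag K) x"
    if x: "x \<in> X" for x u v
    using form[OF ev(1,2)[OF x] tangent_act_in_ev_mem[OF x] tangent_act_in_ev_mem[OF x], of u v]
    unfolding ev(3)[OF x] dip_tangent_ev[OF x] \<sigma>(2)[OF x] pull_back_def .
  then show ?thesis using smooth by blast
qed

end
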